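(* Let $p\in\mathbb{M}_d(\mathbb{C}\langle x_1,\dots,x_n \rangle )_h$ and let $B_1,\dots,B_m\in\mathbb{M}_d(\mathbb{C})_h$. Then for any Hilbert space $\mathcal{H}$ and any choice of $T_1,\dots,T_n\in\mathbb{B}(\mathcal{H})_h$, the following are equivalent: (i) There exist $S_1,\dots,S_m\in\mathbb{B}(\mathcal{H})_h$ such that $p(T_1,\dots,T_n)+B_1\otimes S_1+\dots+ B_m\otimes S_m >0.$ (ii) There is some $\varepsilon >0$ such that for all $r\in\mathbb N$ with $r\leq \max\{\dim(\mathcal H),d\}$ and all finite families of matrices $V_j\in\mathbb{M}_{d,r}(\mathbb{C})$ with $\sum_j V_j^*B_iV_j=0$ for all $i=1,\dots,m$ and $\sum_j V_j^*V_j={\rm id}_r$, we have $$\sum_j p_{V_j}(T_1,\dots,T_n) \geqslant \varepsilon\cdot {\rm id}_r\otimes{\rm id}_{\mathcal H}.$$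
   Context: $\mathbb C\langle x_1,\ldots,x_n\rangle$ is the algebra of polynomials in non-commuting variables with involution $*$ determined by $x_i^*=x_i$ and complex conjugation on $\mathbb C$; the involution extends to $\mathbb M_d(\mathbb C\langle x_1,\ldots,x_n\rangle)$ by transposing and applying $*$ entrywise. A subscript $h$ denotes the real vector space of Hermitian (self-adjoint) elements: $\mathbb M_d(\mathbb C\langle x_1,\ldots,x_n\rangle)_h$, $\mathbb M_d(\mathbb C)_h$, and $\mathbb B(\mathcal H)_h$ (bounded self-adjoint operators on a complex Hilbert space $\mathcal H$). $\mathbb M_{d,r}(\mathbb C)$ is the space of complex $d\times r$ matrices, $V^*$ is the conjugate transpose of $V$, and $\mathrm{id}_r$ is the $r\times r$ identity matrix. Every $p\in\mathbb M_d(\mathbb C\langle x_1,\ldots,x_n\rangle)$ is a finite sum $p=\sum_\omega P_\omega\otimes\omega$ over words $\omega$ in $x_1,\dots,x_n$ (including the empty word), with $P_\omega\in\mathbb M_d(\mathbb C)$. Its evaluation at $T_1,\dots,T_n\in\mathbb B(\mathcal H)_h$ is $p(T_1,\ldots,T_n)=\sum_\omega P_\omega\otimes\omega(T_1,\ldots,T_n)$, a bounded operator on $\mathbb C^d\otimes\mathcal H$ (the empty word evaluates to $\mathrm{id}_{\mathcal H}$). For $V\in\mathbb M_{d,r}(\mathbb C)$ one sets $p_V:=\sum_\omega V^*P_\omega V\otimes\omega\in\mathbb M_r(\mathbb C\langle x_1,\ldots,x_n\rangle)$. $\geqslant 0$ means positive semidefinite, and $X\geqslant Y$ means $X-Y\geqslant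 0$. For a bounded self-adjoint operator $X$, $X>0$ means that $X\geqslant\varepsilon\cdot\mathrm{id}$ for some $\varepsilon>0$ (for matrices: positive definite). *)

theory Defs
  imports
    "HOL-Analysis.Bounded_Linear_Function"
    "HOL-Library.Extended_Nat"
    "HOL-Library.Poly_Mapping"
    "HOL-Library.Nonpos_Ints"
    "Jordan_Normal_Form.Schur_Decomposition"
begin

section \<open>Complex Hilbert spaces\<close>

text \<open>The underlying real inner product is the real part of the complex one, so the norm of
  \<open>real_inner\<close> is the usual Hilbert space norm and positive definiteness is inherited.
  The complex inner product is linear in the second argument.\<close>

class complex_hilbert_space = real_inner + complete_space +
  fixes scaleC :: "complex \<Rightarrow> 'a \<Rightarrow> 'a" (infixr \<open>*\<^sub>C\<close> 75)
    and cinner :: "'a \<Rightarrow> 'a \<Rightarrow> complex"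
  assumes scaleC_add_right: "a *\<^sub>C (x + y) = a *\<^sub>C x + a *\<^sub>C y"
    and scaleC_add_left: "(a + b) *\<^sub>C x = a *\<^sub>C x + b *\<^sub>C x"
    and scaleC_scaleC: "a *\<^sub>C b *\<^sub>C x = (a * b) *\<^sub>C x"
    and scaleC_one: "1 *\<^sub>C x = x"
    and scaleR_eq_scaleC: "r *\<^sub>R x = complex_of_real r *\<^sub>C x"
    and cinner_commute: "cinner x y = cnj (cinner y x)"
    and cinner_add_right: "cinner x (y + z) = cinner x y + cinner x z"
    and cinner_scaleC_right: "cinner x (a *\<^sub>C y) = a * cinner x y"
    and inner_eq_Re_cinner: "inner x y = Re (cinner x y)"

instantiation complex :: complex_hilbert_space
begin

definition scaleC_complex :: "complex \<Rightarrow> complex \<Rightarrow> complex"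
  where "scaleC_complex a x = a * x"

definition cinner_complex :: "complex \<Rightarrow> complex \<Rightarrow> complex"
  where "cinner_complex x y = cnj x * y"

instance
  by standard (auto simp: scaleC_complex_def cinner_complex_def inner_complex_def
      algebra_simps scaleR_conv_of_real)

end

global_interpretation complex_vector: vector_space
  "scaleC :: complex \<Rightarrow> 'a \<Rightarrow> 'a::complex_hilbert_space"
  by standard (simp_all add: scaleC_add_right scaleC_add_left scaleC_scaleC scaleC_one)

text \<open>All infinite dimensions are identified with \<open>\<infinity>\<close>, which suffices for comparing them with
  natural numbers.\<close>

definition hilbert_dim :: "'h::complex_hilbert_space itself \<Rightarrow> enat"
  where "hilbert_dim _ =
    (if \<exists>B :: 'h set. finite B \<and> complex_vector.span B = UNIV
     then enat (complex_vector.dim (UNIV :: 'h set)) else \<infinity>)"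

text \<open>Elements of \<open>'h \<Rightarrow>\<^sub>L 'h\<close> are bounded but only real linear, hence the first condition.\<close>

definition herm_ops :: "('h::complex_hilbert_space \<Rightarrow>\<^sub>L 'h) set"
  where "herm_ops = {T. (\<forall>c x. blinfun_apply T (c *\<^sub>C x) = c *\<^sub>C blinfun_apply T x) \<and>
    (\<forall>x y. cinner (blinfun_apply T x) y = cinner x (blinfun_apply T y))}"


section \<open>Complex matrices\<close>

definition herm_mats :: "nat \<Rightarrow> complex mat set"
  where "herm_mats d = {A \<in> carrier_mat d d. mat_adjoint A = A}"

text \<open>Types of matrices and vectors of varying dimension carry no additive monoid structure, so
  finite sums need the dimension as a parameter.\<close>

definition mat_sum :: "nat \<Rightarrow> nat \<Rightarrow> ('i \<Rightarrow> 'a::comm_monoid_add mat) \<Rightarrow> 'i set \<Rightarrow> 'a mat"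
  where "mat_sum nr nc A I = mat nr nc (\<lambda>ij. \<Sum>k\<in>I. A k $$ ij)"


section \<open>Non-commutative polynomials\<close>

text \<open>With concatenation of words as monoid operation, \<open>nat list \<Rightarrow>\<^sub>0 complex\<close> with the convolution
  product of \<open>Poly_Mapping\<close> is the free complex algebra on the letters \<open>x\<^sub>i\<close>, \<open>i :: nat\<close>.\<close>

instantiation list :: (type) monoid_add
begin

definition zero_list :: "'a list" where "zero_list = []"

definition plus_list :: "'a list \<Rightarrow> 'a list \<Rightarrow> 'a list" where "plus_list = (@)"

instance
  by standard (simp_all add: zero_list_def plus_list_def)

end

type_synonym ncpoly = "nat list \<Rightarrow>\<^sub>0 complex"

definition ncvar :: "nat \<Rightarrow> ncpoly"
  where "ncvar i = Poly_Mapping.single [i] 1"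

definition ncstar :: "ncpoly \<Rightarrow> ncpoly"
  where "ncstar f = Poly_Mapping.map cnj (Poly_Mapping.map_key rev f)"

lemma lookup_ncstar: "Poly_Mapping.lookup (ncstar f) w = cnj (Poly_Mapping.lookup f (rev w))"
  by (simp add: ncstar_def Poly_Mapping.map.rep_eq map_key.rep_eq when_def)

text \<open>The following facts characterise the involution.\<close>

lemma ncstar_ncvar: "ncstar (ncvar i) = ncvar i"
  by (rule poly_mapping_eqI) (auto simp: lookup_ncstar ncvar_def lookup_single when_def)

lemma ncstar_ncstar: "ncstar (ncstar f) = f"
  by (rule poly_mapping_eqI) (simp add: lookup_ncstar)

lemma ncstar_add: "ncstar (f + g) = ncstar f + ncstar g"
  by (rule poly_mapping_eqI) (simp add: lookup_ncstar lookup_add)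

lemma ncstar_single: "ncstar (Poly_Mapping.single w c) = Poly_Mapping.single (rev w) (cnj c)"
  by (rule poly_mapping_eqI) (auto simp: lookup_ncstar lookup_single when_def)

lemma ncpoly_induct [case_names single add]:
  fixes f :: ncpoly
  assumes single: "\<And>w c. P (Poly_Mapping.single w c)"
    and add: "\<And>g h. P g \<Longrightarrow> P h \<Longrightarrow> P (g + h)"
  shows "P f"
proof -
  have "P (\<Sum>w\<in>W. Poly_Mapping.single w (Poly_Mapping.lookup f w))" if "finite W" for W
    using that
  proof induction
    case empty
    show ?case using single[of "[]" 0] by simp
  next
    case (insert w W)
    then show ?case by (simp add: add single)
  qed
  moreover have "(\<Sum>w\<in>Poly_Mapping.keys f. Poly_Mapping.single w (Poly_Mapping.lookup f w)) = f"
    by (rule poly_mapping_eqI)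
      (auto simp: lookup_sum lookup_single when_def in_keys_iff sum.delta)
  ultimately show ?thesis by (metis finite_keys)
qed

lemma ncstar_mult: "ncstar (f * g) = ncstar g * ncstar f"
proof (induction f rule: ncpoly_induct)
  case (single v a)
  show ?case
  proof (induction g rule: ncpoly_induct)
    case (single w b)
    show ?case
      by (simp add: mult_single ncstar_single plus_list_def mult.commute)
  next
    case (add g1 g2)
    then show ?case by (simp add: distrib_left distrib_right ncstar_add)
  qed
next
  case (add f1 f2)
  then show ?case by (simp add: distrib_left distrib_right ncstar_add)
qed

text \<open>\<open>ncmat n d\<close> is the space of \<open>d \<times> d\<close> matrices over the polynomials in \<open>x\<^sub>1, \<dots>, x\<^sub>n\<close>.\<close>

definition ncmat :: "nat \<Rightarrow> nat \<Rightarrow> ncpoly mat set"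
  where "ncmat n d =
    {p \<in> carrier_mat d d. \<forall>f \<in> elements_mat p. Poly_Mapping.keys f \<subseteq> lists {1..n}}"

definition ncmat_star :: "ncpoly mat \<Rightarrow> ncpoly mat"
  where "ncmat_star p = map_mat ncstar (transpose_mat p)"

definition herm_ncmat :: "nat \<Rightarrow> nat \<Rightarrow> ncpoly mat set"
  where "herm_ncmat n d = {p \<in> ncmat n d. ncmat_star p = p}"

text \<open>The expansion \<open>p = \<Sum>\<^sub>\<omega> P\<^sub>\<omega> \<otimes> \<omega>\<close>: \<open>nc_words p\<close> is the finite set of words occurring in \<open>p\<close>,
  \<open>nc_coeff p \<omega>\<close> is \<open>P\<^sub>\<omega>\<close>, and \<open>nc_monom P \<omega>\<close> is \<open>P \<otimes> \<omega>\<close>.\<close>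

definition nc_words :: "ncpoly mat \<Rightarrow> nat list set"
  where "nc_words p = (\<Union>f \<in> elements_mat p. Poly_Mapping.keys f)"

definition nc_coeff :: "ncpoly mat \<Rightarrow> nat list \<Rightarrow> complex mat"
  where "nc_coeff p w = map_mat (\<lambda>f. Poly_Mapping.lookup f w) p"

definition nc_monom :: "complex mat \<Rightarrow> nat list \<Rightarrow> ncpoly mat"
  where "nc_monom P w = map_mat (Poly_Mapping.single w) P"

lemma nc_expansion:
  "p = mat_sum (dim_row p) (dim_col p) (\<lambda>w. nc_monom (nc_coeff p w) w) (nc_words p)"
proof (rule eq_matI)
  fix i j
  assume "i < dim_row (mat_sum (dim_row p) (dim_col p)
      (\<lambda>w. nc_monom (nc_coeff p w) w) (nc_words p))"
    and "j < dim_col (mat_sum (dim_row p) (dim_col p)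
      (\<lambda>w. nc_monom (nc_coeff p w) w) (nc_words p))"
  then have ij: "i < dim_row p" "j < dim_col p" by (simp_all add: mat_sum_def)
  then have el: "p $$ (i, j) \<in> elements_mat p" by auto
  have fin: "finite (nc_words p)"
    by (simp add: nc_words_def elements_mat_def)
  show "p $$ (i, j) = mat_sum (dim_row p) (dim_col p)
      (\<lambda>w. nc_monom (nc_coeff p w) w) (nc_words p) $$ (i, j)"
  proof (rule poly_mapping_eqI)
    fix w
    have "w \<notin> nc_words p \<Longrightarrow> Poly_Mapping.lookup (p $$ (i, j)) w = 0"
      using el by (auto simp: nc_words_def in_keys_iff)
    then show "Poly_Mapping.lookup (p $$ (i, j)) w = Poly_Mapping.lookup
        (mat_sum (dim_row p) (dim_col p)
          (\<lambda>w. nc_monom (nc_coeff p w) w) (nc_words p) $$ (i, j)) w"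
      using ij fin
      by (auto simp: mat_sum_def nc_monom_def nc_coeff_def lookup_sum lookup_single when_def
          sum.delta')
  qed
qed (simp_all add: mat_sum_def)

text \<open>\<open>nc_compress V p\<close> is \<open>p\<^sub>V = \<Sum>\<^sub>\<omega> V\<^sup>*P\<^sub>\<omega>V \<otimes> \<omega>\<close>.\<close>

definition nc_compress :: "complex mat \<Rightarrow> ncpoly mat \<Rightarrow> ncpoly mat"
  where "nc_compress V p = mat_sum (dim_col V) (dim_col V)
    (\<lambda>w. nc_monom (mat_adjoint V * nc_coeff p w * V) w) (nc_words p)"


section \<open>Operators on \<open>\<complex>\<^sup>d \<otimes> H\<close>\<close>

text \<open>\<open>\<complex>\<^sup>d \<otimes> H\<close> is the \<open>d\<close>-fold direct sum of \<open>H\<close>, that is, \<open>carrier_vec d\<close> over the Hilbert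
  space type, with \<open>e\<^sub>j \<otimes> x\<close> being \<open>x\<close> in position \<open>j\<close>.\<close>

definition tensor_cinner :: "'h::complex_hilbert_space vec \<Rightarrow> 'h vec \<Rightarrow> complex"
  where "tensor_cinner v w = (\<Sum>i<dim_vec v. cinner (vec_index v i) (vec_index w i))"

definition tensor_op ::
    "complex mat \<Rightarrow> ('h::complex_hilbert_space \<Rightarrow>\<^sub>L 'h) \<Rightarrow> 'h vec \<Rightarrow> 'h vec"
  where "tensor_op P T v = vec (dim_row P)
    (\<lambda>i. \<Sum>j<dim_col P. P $$ (i, j) *\<^sub>C blinfun_apply T (vec_index v j))"

definition op_sum :: "nat \<Rightarrow> ('i \<Rightarrow> 'h vec \<Rightarrow> 'h::comm_monoid_add vec) \<Rightarrow> 'i set \<Rightarrow> 'h vec \<Rightarrow> 'h vec"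
  where "op_sum d F I v = vec d (\<lambda>i. \<Sum>k\<in>I. vec_index (F k v) i)"

definition op_psd :: "nat \<Rightarrow> ('h::complex_hilbert_space vec \<Rightarrow> 'h vec) \<Rightarrow> bool"
  where "op_psd d X \<longleftrightarrow> (\<forall>v \<in> carrier_vec d. tensor_cinner v (X v) \<in> \<real>\<^sub>\<ge>\<^sub>0)"

definition op_ge ::
    "nat \<Rightarrow> ('h::complex_hilbert_space vec \<Rightarrow> 'h vec) \<Rightarrow> ('h vec \<Rightarrow> 'h vec) \<Rightarrow> bool"
  where "op_ge d X Y \<longleftrightarrow> op_psd d (\<lambda>v. X v - Y v)"

text \<open>\<open>scaled_id d \<epsilon>\<close> is \<open>\<epsilon> \<cdot> id\<^sub>d \<otimes> id\<^sub>H\<close>.\<close>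

definition scaled_id :: "nat \<Rightarrow> real \<Rightarrow> 'h::complex_hilbert_space vec \<Rightarrow> 'h vec"
  where "scaled_id d \<epsilon> = tensor_op (complex_of_real \<epsilon> \<cdot>\<^sub>m 1\<^sub>m d) id_blinfun"

definition op_pos :: "nat \<Rightarrow> ('h::complex_hilbert_space vec \<Rightarrow> 'h vec) \<Rightarrow> bool"
  where "op_pos d X \<longleftrightarrow> (\<exists>\<epsilon>>0. op_ge d X (scaled_id d \<epsilon>))"

definition word_eval :: "(nat \<Rightarrow> 'h::complex_hilbert_space \<Rightarrow>\<^sub>L 'h) \<Rightarrow> nat list \<Rightarrow> 'h \<Rightarrow>\<^sub>L 'h"
  where "word_eval T w = foldr (\<lambda>i X. T i o\<^sub>L X) w id_blinfun"

definition nc_eval ::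
    "(nat \<Rightarrow> 'h::complex_hilbert_space \<Rightarrow>\<^sub>L 'h) \<Rightarrow> ncpoly mat \<Rightarrow> 'h vec \<Rightarrow> 'h vec"
  where "nc_eval T p =
    op_sum (dim_row p) (\<lambda>w. tensor_op (nc_coeff p w) (word_eval T w)) (nc_words p)"

end

theory Submission
  imports Defs
begin

text \<open>Write \<open>X\<close> for \<open>p(T)\<close>, an operator on \<open>\<complex>\<^sup>d \<otimes> H\<close>. If \<open>X + \<Sum>\<^sub>i B\<^sub>i \<otimes> S\<^sub>i \<ge> \<epsilon>\<close>, then compressing by
  matrices \<open>V\<^sub>j\<close> as in the second condition and summing removes the terms \<open>B\<^sub>i \<otimes> S\<^sub>i\<close> and keeps the
  bound \<open>\<epsilon>\<close> (\<open>positive_imp_compressions_nonneg\<close>).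

  For the converse, a finite family of vectors \<open>v\<close> of \<open>\<complex>\<^sup>d \<otimes> H\<close> is regarded as the positive finite
  rank operator \<open>\<rho> = \<Sum>\<^sub>v |v\<rangle>\<langle>v|\<close>. It is called null if all partial traces of \<open>\<rho> (B\<^sub>i \<otimes> 1)\<close> over \<open>\<complex>\<^sup>d\<close>
  vanish; these partial traces are what the operators \<open>S\<^sub>i\<close> are paired with. Factoring the family
  through an isometric matrix turns a null family into matrices \<open>V\<^sub>j\<close> as in the second
  condition, so this condition says that \<open>\<Sum>\<^sub>v \<langle>v, X v\<rangle> \<ge> \<epsilon> \<Sum>\<^sub>v \<parallel>v\<parallel>\<^sup>2\<close> for every null family
  (\<open>compressions_nonneg_imp_null_families_nonneg\<close>). It remains to find the \<open>S\<^sub>i\<close>, which is a matter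
  of duality (\<open>positive_on_null_families_imp_operators\<close>).

  The unknowns are eliminated one at a time. Suppose that the families are already required to be
  null for \<open>B\<^sub>i\<close>, \<open>i < j\<close>. If \<open>B\<^sub>j\<close> takes both signs on such families in \<open>\<complex>\<^sup>d\<close>, then tensoring these
  with vectors of \<open>H\<close> shows that the partial traces fill the space of all finite rank Hermitian
  operators. The Hahn-Banach theorem provides a functional on this space, and the same tensors
  bound it, so that the Riesz theorem turns it into an operator \<open>S\<^sub>j\<close> (\<open>eliminate_operator\<close>). If
  \<open>B\<^sub>j\<close> vanishes on these families, \<open>S\<^sub>j = 0\<close> will do.

  In the remaining case \<open>B\<^sub>j\<close> is, up to sign, nonnegative and not identically zero on the scalar
  families null for the earlier \<open>B\<^sub>i\<close>. For the first such \<open>j\<close>, the elimination just described,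
  carried out over the Hilbert space \<open>\<complex>\<close>, produces a real combination \<open>P\<close> of the \<open>B\<^sub>i\<close> that is
  positive semidefinite and nonzero. Null families then lie in the kernel of a nonzero functional
  \<open>\<langle>e, P \<cdot>\<rangle>\<close>, and the matrix size drops by one. The operators found by induction work on this kernel,
  and adding \<open>\<kappa> P \<otimes> 1\<close> with \<open>\<kappa>\<close> large enforces positivity in the complementary direction, as for
  a Schur complement.\<close>

section \<open>A Hahn-Banach theorem for convex cones\<close>

text \<open>A cone \<open>M \<supseteq> E\<close> that is maximal among those avoiding \<open>(0, -1)\<close> contains \<open>z\<close> or \<open>-z\<close> for every
  \<open>z\<close>. Hence the lower boundary \<open>s\<close> of \<open>M\<close> over \<open>G\<close>, which is sublinear, satisfies
  \<open>s (- y) = - s y\<close> and is therefore linear.\<close>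

lemma cone_dominates_linear_functional:
  fixes E :: "('a::real_vector \<times> real) set" and G :: "'a set"
  assumes zero: "0 \<in> E" and up: "(0, 1) \<in> E"
    and add: "\<And>x y. x \<in> E \<Longrightarrow> y \<in> E \<Longrightarrow> x + y \<in> E"
    and scale: "\<And>x t. x \<in> E \<Longrightarrow> t > 0 \<Longrightarrow> t *\<^sub>R x \<in> E"
    and nonneg: "\<And>r. (0, r) \<in> E \<Longrightarrow> r \<ge> 0"
    and G: "real_vector.subspace G"
    and total: "\<And>y. y \<in> G \<Longrightarrow> \<exists>r. (y, r) \<in> E"
  obtains s :: "'a \<Rightarrow> real"
  where "\<And>x y. x \<in> G \<Longrightarrow> y \<in> G \<Longrightarrow> s (x + y) = s x + s y"
    and "\<And>c x. x \<in> G \<Longrightarrow> s (c *\<^sub>R x) = c * s x"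
    and "\<And>y r. (y, r) \<in> E \<Longrightarrow> y \<in> G \<Longrightarrow> s y \<le> r"
proof -
  define K where "K = {M :: ('a \<times> real) set. E \<subseteq> M \<and> (0, -1) \<notin> M \<and>
    (\<forall>x\<in>M. \<forall>y\<in>M. x + y \<in> M) \<and> (\<forall>x\<in>M. \<forall>t>0. t *\<^sub>R x \<in> M)}"
  have "E \<in> K"
    using add scale nonneg[of "-1"] by (auto simp: K_def)
  moreover have "\<Union>C \<in> K" if C: "C \<noteq> {}" "subset.chain K C" for C
  proof -
    have CK: "C \<subseteq> K" and lin: "\<And>X Y. X \<in> C \<Longrightarrow> Y \<in> C \<Longrightarrow> X \<subseteq> Y \<or> Y \<subseteq> X"
      using C(2) by (auto simp: subset.chain_def)
    have "x + y \<in> \<Union>C" if "X \<in> C" "Y \<in> C" "x \<in> X" "y \<in> Y" for x y X Y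
      using lin[OF that(1,2)]
    proof
      assume "X \<subseteq> Y"
      then have "x + y \<in> Y" using that CK by (auto simp: K_def)
      then show ?thesis using that by blast
    next
      assume "Y \<subseteq> X"
      then have "x + y \<in> X" using that CK by (auto simp: K_def)
      then show ?thesis using that by blast
    qed
    moreover have "t *\<^sub>R x \<in> \<Union>C" if "X \<in> C" "x \<in> X" "t > 0" for t x X
    proof -
      have "t *\<^sub>R x \<in> X" using that CK by (auto simp: K_def)
      then show ?thesis using that by blast
    qed
    moreover obtain X where "X \<in> C" using C(1) by blast
    then have "E \<subseteq> X" using CK by (auto simp: K_def)
    with \<open>X \<in> C\<close> have "E \<subseteq> \<Union>C" by blast
    moreover have "(0, -1) \<notin> \<Union>C"
      using CK by (auto simp: K_def)
    ultimately show ?thesis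
      unfolding K_def by blast
  qed
  ultimately obtain M where "M \<in> K" and max: "\<And>X. X \<in> K \<Longrightarrow> M \<subseteq> X \<Longrightarrow> X = M"
    using subset_Zorn_nonempty[of K] by (metis empty_iff)
  then have EM: "E \<subseteq> M" and neg1: "(0, -1) \<notin> M"
    and Madd: "\<And>x y. x \<in> M \<Longrightarrow> y \<in> M \<Longrightarrow> x + y \<in> M"
    and Mscale: "\<And>x t. x \<in> M \<Longrightarrow> t > 0 \<Longrightarrow> t *\<^sub>R x \<in> M"
    by (auto simp: K_def)
  have M0: "0 \<in> M" using EM zero by blast
  have Mscale0: "t *\<^sub>R x \<in> M" if "x \<in> M" "t \<ge> 0" for x t
    using Mscale[OF that(1), of t] M0 that(2) by (cases "t = 0") auto
  have dichotomy: "z \<in> M \<or> - z \<in> M" for z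
  proof (rule ccontr)
    assume *: "\<not> ?thesis"
    define X where "X = {u. \<exists>v\<in>M. \<exists>t\<ge>0. u = v + t *\<^sub>R z}"
    have "M \<subseteq> X"
    proof
      fix u assume "u \<in> M"
      then show "u \<in> X" by (auto simp: X_def intro!: exI[of _ 0] bexI[of _ u])
    qed
    have "z \<in> X" using M0 by (auto simp: X_def intro!: exI[of _ 1] bexI[of _ 0])
    with * have "X \<noteq> M" by blast
    have "u + u' \<in> X" if "u \<in> X" "u' \<in> X" for u u'
    proof -
      from that obtain v t v' t' where
        "v \<in> M" "t \<ge> 0" "u = v + t *\<^sub>R z" "v' \<in> M" "t' \<ge> 0" "u' = v' + t' *\<^sub>R z"
        by (auto simp: X_def)
      then have "v + v' \<in> M" "t + t' \<ge> 0" "u + u' = (v + v') + (t + t') *\<^sub>R z"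
        using Madd by (auto simp: algebra_simps)
      then show ?thesis unfolding X_def by blast
    qed
    moreover have "c *\<^sub>R u \<in> X" if "u \<in> X" "c > 0" for c u
    proof -
      from that obtain v t where "v \<in> M" "t \<ge> 0" "u = v + t *\<^sub>R z" by (auto simp: X_def)
      then have "c *\<^sub>R v \<in> M" "c * t \<ge> 0" "c *\<^sub>R u = c *\<^sub>R v + (c * t) *\<^sub>R z"
        using Mscale that by (auto simp: algebra_simps)
      then show ?thesis unfolding X_def by blast
    qed
    ultimately have "(0, -1) \<in> X"
      using max[of X] \<open>M \<subseteq> X\<close> \<open>X \<noteq> M\<close> subset_trans[OF EM \<open>M \<subseteq> X\<close>]
      unfolding K_def by blast
    then obtain v t where v: "v \<in> M" "t \<ge> 0" "(0, -1) = v + t *\<^sub>R z"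
      by (auto simp: X_def)
    have "t \<noteq> 0" using v neg1 by auto
    have "(0, 1) \<in> M" using EM up by blast
    \<comment> \<open>solving \<open>(0, -1) = v + t z\<close> for \<open>-z\<close>\<close>
    then have "(1 / t) *\<^sub>R (v + (0, 1)) \<in> M"
      using v \<open>t \<noteq> 0\<close> Madd Mscale by auto
    moreover have "t *\<^sub>R z = (0, -1) - v" using v(3) by simp
    then have "v + (0, 1) = - (t *\<^sub>R z)" by (simp add: prod_eq_iff)
    ultimately have "- z \<in> M" using \<open>t \<noteq> 0\<close> by auto
    with * show False by blast
  qed
  have M_up: "(y, r') \<in> M" if "(y, r) \<in> M" "r \<le> r'" for y r r'
  proof -
    have "(0, 1) \<in> M" using EM up by blast
    from Madd[OF that(1) Mscale0[OF this, of "r' - r"]] that(2) show ?thesis by simp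
  qed
  have M_nonneg: "r \<ge> 0" if "(0, r) \<in> M" for r
  proof (rule ccontr)
    assume "\<not> r \<ge> 0"
    with Mscale[OF that, of "1 / (- r)"] neg1 show False by (simp add: field_simps)
  qed
  define s where "s y = Inf {r. (y, r) \<in> M}" for y
  have lower: "- r' \<le> r" if "(y, r) \<in> M" "(- y, r') \<in> M" for y r r'
    using M_nonneg[of "r + r'"] Madd[OF that] by simp
  have minus: "- y \<in> G" if "y \<in> G" for y
    using G that by (simp add: real_vector.subspace_neg)
  have bdd: "bdd_below {r. (y, r) \<in> M}" if "y \<in> G" for y
  proof -
    obtain r' where "(- y, r') \<in> M" using total[OF minus[OF \<open>y \<in> G\<close>]] EM by blast
    then show ?thesis by (auto intro!: bdd_belowI[of _ "- r'"] lower)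
  qed
  have ne: "{r. (y, r) \<in> M} \<noteq> {}" if "y \<in> G" for y
    using total[OF that] EM by blast
  have s_le: "s y \<le> r" if "(y, r) \<in> M" "y \<in> G" for y r
    unfolding s_def by (rule cInf_lower) (use that bdd in auto)
  have above: "(y, r) \<in> M" if yr: "s y < r" "y \<in> G" for y r
  proof -
    obtain r' where "(y, r') \<in> M" "r' < r"
      using cInf_lessD[OF ne[OF yr(2)], of r] yr(1) by (auto simp: s_def)
    then show ?thesis using M_up[of y r' r] by simp
  qed
  have below: "(- y, - r) \<in> M" if "r < s y" "y \<in> G" for y r
    using dichotomy[of "(y, r)"] s_le[of y r] that by auto
  have s_neg: "s (- y) = - s y" if "y \<in> G" for y
  proof (rule antisym)
    show "s (- y) \<le> - s y"
    proof (rule field_le_epsilon)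
      fix e :: real assume "e > 0"
      with below[of "s y - e" y] that s_le[of "- y" "- (s y - e)"] minus
      show "s (- y) \<le> - s y + e" by simp
    qed
    have "- r' \<le> s y" if "(- y, r') \<in> M" for r'
      unfolding s_def by (rule cInf_greatest) (use ne \<open>y \<in> G\<close> lower that in auto)
    then show "- s y \<le> s (- y)"
      unfolding s_def[of "- y"] by (intro cInf_greatest) (use ne minus that in force)+
  qed
  have s_sub: "s (x + y) \<le> s x + s y" if "x \<in> G" "y \<in> G" for x y
  proof (rule field_le_epsilon)
    fix e :: real assume "e > 0"
    then have "(x, s x + e / 2) \<in> M" "(y, s y + e / 2) \<in> M"
      using above that by auto
    from Madd[OF this] s_le[of "x + y" "s x + s y + e"] G that
    show "s (x + y) \<le> s x + s y + e" by (simp add: real_vector.subspace_add algebra_simps)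
  qed
  have s_add: "s (x + y) = s x + s y" if "x \<in> G" "y \<in> G" for x y
    using s_sub[OF that] s_sub[of "x + y" "- y"] s_neg[of y] that G
    by (simp add: real_vector.subspace_add real_vector.subspace_neg)
  have s0: "s 0 = 0" using s_add[of 0 0] G by (simp add: real_vector.subspace_0)
  have s_pos: "s (c *\<^sub>R x) \<le> c * s x" if "x \<in> G" "c > 0" for c x
  proof (rule field_le_epsilon)
    fix e :: real assume "e > 0"
    then have "(x, s x + e / c) \<in> M" using above that by auto
    from Mscale[OF this \<open>c > 0\<close>] s_le[of "c *\<^sub>R x" "c * s x + e"] G that
    show "s (c *\<^sub>R x) \<le> c * s x + e" by (simp add: real_vector.subspace_scale algebra_simps)
  qed
  have s_pos_eq: "s (c *\<^sub>R x) = c * s x" if "x \<in> G" "c > 0" for c x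
    using s_pos[OF that] s_pos[of "- x" c] s_neg[of x] s_neg[of "c *\<^sub>R x"] that G
    by (simp add: real_vector.subspace_scale real_vector.subspace_neg)
  have s_scale: "s (c *\<^sub>R x) = c * s x" if "x \<in> G" for c x
  proof (cases "c = 0 \<or> c > 0")
    case True
    then show ?thesis using s0 s_pos_eq[OF that] by auto
  next
    case False
    then have "- c > 0" by simp
    from s_pos_eq[OF that this] s_neg[of "c *\<^sub>R x"] that G
    show ?thesis by (simp add: real_vector.subspace_scale)
  qed
  show ?thesis
    using that[of s] s_add s_scale s_le EM by blast
qed

section \<open>The Riesz representation theorem\<close>

text \<open>The representing vector minimises \<open>\<parallel>x\<parallel>\<^sup>2 - 2 f x\<close>; minimising sequences are Cauchy by the
  parallelogram law.\<close>

lemma riesz_representation: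
  fixes f :: "'a::{real_inner, complete_space} \<Rightarrow> real"
  assumes "bounded_linear f"
  shows "\<exists>u. \<forall>x. f x = inner u x"
proof -
  interpret f: bounded_linear f by fact
  obtain K where K: "\<And>x. norm (f x) \<le> norm x * K" "K \<ge> 0"
    using f.nonneg_bounded by auto
  define J where "J x = inner x x - 2 * f x" for x
  have J_low: "J x \<ge> - K\<^sup>2" for x
  proof -
    have "f x \<le> norm x * K" using K(1)[of x] by simp
    then have "J x \<ge> (norm x)\<^sup>2 - 2 * (norm x * K)" by (simp add: J_def power2_norm_eq_inner)
    moreover have "(norm x)\<^sup>2 - 2 * (norm x * K) + K\<^sup>2 = (norm x - K)\<^sup>2"
      by (simp add: power2_eq_square algebra_simps)
    ultimately show ?thesis by (smt (verit) zero_le_power2)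
  qed
  define j where "j = Inf (range J)"
  have bdd: "bdd_below (range J)" using J_low by (auto intro!: bdd_belowI)
  have j_le: "j \<le> J x" for x unfolding j_def by (rule cInf_lower) (use bdd in auto)
  have "\<exists>x. J x < j + inverse (Suc n)" for n
  proof -
    have "Inf (range J) < j + inverse (Suc n)" by (simp add: j_def)
    from cInf_lessD[OF _ this] show ?thesis by auto
  qed
  then obtain X where X: "\<And>n::nat. J (X n) < j + inverse (Suc n)" by metis
  have par: "(norm (x - y))\<^sup>2 = 2 * J x + 2 * J y - 4 * J ((1/2) *\<^sub>R (x + y))" for x y
    by (simp add: J_def power2_norm_eq_inner inner_diff_left inner_diff_right inner_add_left
        inner_add_right f.add f.scaleR inner_commute[of y x] field_simps)
  have dist2: "(norm (X m - X n))\<^sup>2 \<le> 4 * inverse (Suc N)" if "m \<ge> N" "n \<ge> N" for m n N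
  proof -
    have "inverse (real (Suc m)) \<le> inverse (Suc N)" "inverse (real (Suc n)) \<le> inverse (Suc N)"
      using that by (auto intro!: le_imp_inverse_le)
    then show ?thesis
      using par[of "X m" "X n"] X[of m] X[of n] j_le[of "(1/2) *\<^sub>R (X m + X n)"] by linarith
  qed
  have "Cauchy X"
  proof (rule metric_CauchyI)
    fix e :: real assume "e > 0"
    then obtain N where N: "inverse (Suc N) < e\<^sup>2 / 4"
      using reals_Archimedean[of "e\<^sup>2 / 4"] by auto
    have "dist (X m) (X n) < e" if "m \<ge> N" "n \<ge> N" for m n
    proof -
      have "(norm (X m - X n))\<^sup>2 < e\<^sup>2" using dist2[OF that] N by linarith
      then show ?thesis using \<open>e > 0\<close> by (simp add: dist_norm power2_less_imp_less)
    qed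
    then show "\<exists>M. \<forall>m\<ge>M. \<forall>n\<ge>M. dist (X m) (X n) < e" by blast
  qed
  then obtain u where u: "X \<longlonglongrightarrow> u" using Cauchy_convergent convergent_def by blast
  have "(\<lambda>n. J (X n)) \<longlonglongrightarrow> J u"
    unfolding J_def by (intro tendsto_intros u f.tendsto)
  moreover have "(\<lambda>n. j + inverse (real (Suc n))) \<longlonglongrightarrow> j + 0"
    by (intro tendsto_intros LIMSEQ_inverse_real_of_nat)
  ultimately have "J u \<le> j"
    using X by (intro LIMSEQ_le[of "\<lambda>n. J (X n)" _ "\<lambda>n. j + inverse (real (Suc n))"])
      (auto intro: less_imp_le)
  have "f x = inner u x" for x
  proof (rule ccontr)
    assume "f x \<noteq> inner u x"
    define g where "g = inner u x - f x"
    have "g \<noteq> 0" using \<open>f x \<noteq> inner u x\<close> by (simp add: g_def)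
    have x: "inner x x > 0" using \<open>g \<noteq> 0\<close> by (auto simp: g_def f.zero)
    define t where "t = - g / inner x x"
    have "J (u + t *\<^sub>R x) = J u + 2 * t * g + t\<^sup>2 * inner x x"
      by (simp add: J_def g_def inner_add_left inner_add_right f.add f.scaleR inner_commute[of x u]
          algebra_simps power2_eq_square)
    also have "\<dots> = J u - g\<^sup>2 / inner x x"
      using x by (simp add: t_def field_simps power2_eq_square)
    also have "\<dots> < J u" using x \<open>g \<noteq> 0\<close> by simp
    finally show False using j_le[of "u + t *\<^sub>R x"] \<open>J u \<le> j\<close> by simp
  qed
  then show ?thesis by blast
qed

section \<open>Complex inner products and Hermitian operators\<close>

lemma scaleC_0_left: "0 *\<^sub>C (x::'h::complex_hilbert_space) = 0"
  by (rule complex_vector.scale_zero_left)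

lemma scaleC_0_right: "a *\<^sub>C (0::'h::complex_hilbert_space) = 0"
  by (rule complex_vector.scale_zero_right)

lemma scaleC_minus_left: "(- a) *\<^sub>C (x::'h::complex_hilbert_space) = - (a *\<^sub>C x)"
  by (rule complex_vector.scale_minus_left)

lemma scaleC_sum_right: "a *\<^sub>C (\<Sum>i\<in>A. f i :: 'h::complex_hilbert_space) = (\<Sum>i\<in>A. a *\<^sub>C f i)"
  by (rule complex_vector.scale_sum_right)

lemma scaleC_sum_left: "(\<Sum>i\<in>A. f i) *\<^sub>C (x :: 'h::complex_hilbert_space) = (\<Sum>i\<in>A. f i *\<^sub>C x)"
  by (rule complex_vector.scale_sum_left)

lemma cinner_add_left: "cinner (x + y) (z::'h::complex_hilbert_space) = cinner x z + cinner y z"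
  by (metis cinner_add_right cinner_commute complex_cnj_add)

lemma cinner_scaleC_left: "cinner (a *\<^sub>C x) (z::'h::complex_hilbert_space) = cnj a * cinner x z"
  by (metis cinner_scaleC_right cinner_commute complex_cnj_mult)

lemma cinner_scaleR_left: "cinner (r *\<^sub>R x) (z::'h::complex_hilbert_space) = of_real r * cinner x z"
  by (simp add: scaleR_eq_scaleC cinner_scaleC_left)

lemma cinner_scaleR_right: "cinner x (r *\<^sub>R z::'h::complex_hilbert_space) = of_real r * cinner x z"
  by (simp add: scaleR_eq_scaleC cinner_scaleC_right)

lemma cinner_0_left: "cinner 0 (z::'h::complex_hilbert_space) = 0"
  using cinner_add_left[of 0 0 z] by simp

lemma cinner_0_right: "cinner (z::'h::complex_hilbert_space) 0 = 0"
  using cinner_add_right[of z 0 0] by simp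

lemma cinner_minus_left: "cinner (- x) (z::'h::complex_hilbert_space) = - cinner x z"
  using cinner_scaleC_left[of "-1" x z] by (simp add: scaleC_minus_left scaleC_one)

lemma cinner_minus_right: "cinner x (- z::'h::complex_hilbert_space) = - cinner x z"
  using cinner_scaleC_right[of x "-1" z] by (simp add: scaleC_minus_left scaleC_one)

lemma cinner_diff_left: "cinner (x - y) (z::'h::complex_hilbert_space) = cinner x z - cinner y z"
  using cinner_add_left[of x "- y" z] by (simp add: cinner_minus_left)

lemma cinner_diff_right: "cinner z (x - y::'h::complex_hilbert_space) = cinner z x - cinner z y"
  using cinner_add_right[of z x "- y"] by (simp add: cinner_minus_right)

lemma cinner_sum_left:
  "cinner (\<Sum>i\<in>A. f i) (z::'h::complex_hilbert_space) = (\<Sum>i\<in>A. cinner (f i) z)"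
  by (induction A rule: infinite_finite_induct) (simp_all add: cinner_0_left cinner_add_left)

lemma cinner_sum_right:
  "cinner z (\<Sum>i\<in>A. f i :: 'h::complex_hilbert_space) = (\<Sum>i\<in>A. cinner z (f i))"
  by (induction A rule: infinite_finite_induct) (simp_all add: cinner_0_right cinner_add_right)

lemmas cinner_simps =
  cinner_add_left cinner_add_right cinner_diff_left cinner_diff_right
  cinner_scaleC_left cinner_scaleC_right cinner_scaleR_left cinner_scaleR_right
  cinner_minus_left cinner_minus_right cinner_0_left cinner_0_right

lemma cinner_self: "cinner (x::'h::complex_hilbert_space) x = of_real ((norm x)\<^sup>2)"
proof (rule complex_eqI)
  show "Re (cinner x x) = Re (of_real ((norm x)\<^sup>2))"
    by (simp add: power2_norm_eq_inner inner_eq_Re_cinner)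
  show "Im (cinner x x) = Im (of_real ((norm x)\<^sup>2))"
    using cinner_commute[of x x] by (metis Im_complex_of_real Reals_cnj_iff complex_is_Real_iff)
qed

lemma cinner_self_eq_0: "cinner (x::'h::complex_hilbert_space) x = 0 \<Longrightarrow> x = 0"
  by (simp add: cinner_self)

lemma norm_scaleC: "norm (a *\<^sub>C (x::'h::complex_hilbert_space)) = cmod a * norm x"
proof -
  have "complex_of_real ((norm (a *\<^sub>C x))\<^sup>2) = of_real ((cmod a * norm x)\<^sup>2)"
    unfolding cinner_self[symmetric] cinner_scaleC_left cinner_scaleC_right
    by (simp add: cinner_self power_mult_distrib complex_norm_square mult_ac del: of_real_power)
  then have "(norm (a *\<^sub>C x))\<^sup>2 = (cmod a * norm x)\<^sup>2"
    by (simp only: of_real_eq_iff)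
  then show ?thesis by simp
qed

lemma norm_cinner_le: "cmod (cinner x (y::'h::complex_hilbert_space)) \<le> norm x * norm y"
proof (cases "cinner x y = 0")
  case False
  define c where "c = cinner x y"
  define u where "u = cnj c / of_real (cmod c)"
  have "cmod u = 1" using False by (simp add: u_def c_def norm_divide)
  have "u * c = of_real (cmod c)"
    using False by (simp add: u_def c_def complex_norm_square[symmetric] power2_eq_square
        mult.commute[of "cnj (cinner x y)"] flip: complex_norm_square)
  then have "cmod c = inner x (u *\<^sub>C y)"
    by (simp add: inner_eq_Re_cinner cinner_scaleC_right c_def)
  also have "\<dots> \<le> norm x * norm (u *\<^sub>C y)" by (rule norm_cauchy_schwarz)
  finally show ?thesis using \<open>cmod u = 1\<close> by (simp add: norm_scaleC c_def)
qed simp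

lemma inner_imaginary_left:
  "inner (\<i> *\<^sub>C x) (y::'h::complex_hilbert_space) = - inner x (\<i> *\<^sub>C y)"
  by (simp add: inner_eq_Re_cinner cinner_simps)

lemma cinner_eq_inner:
  "cinner x (y::'h::complex_hilbert_space) = Complex (inner x y) (- inner x (\<i> *\<^sub>C y))"
  by (rule complex_eqI) (simp_all add: inner_eq_Re_cinner cinner_simps)

lemma herm_opsI_inner:
  fixes T :: "'h::complex_hilbert_space \<Rightarrow>\<^sub>L 'h"
  assumes imaginary: "\<And>x. blinfun_apply T (\<i> *\<^sub>C x) = \<i> *\<^sub>C blinfun_apply T x"
    and sym: "\<And>x y. inner (blinfun_apply T x) y = inner x (blinfun_apply T y)"
  shows "T \<in> herm_ops"
proof -
  have "blinfun_apply T (c *\<^sub>C x) = c *\<^sub>C blinfun_apply T x" for c x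
  proof -
    have dec: "c *\<^sub>C y = Re c *\<^sub>R y + Im c *\<^sub>R (\<i> *\<^sub>C y)" for y :: 'h
      by (metis complex_eq mult.commute scaleC_add_left scaleC_scaleC scaleR_eq_scaleC)
    show ?thesis
      unfolding dec[of x] by (simp add: blinfun.add_right blinfun.scaleR_right imaginary dec)
  qed
  moreover have "cinner (blinfun_apply T x) y = cinner x (blinfun_apply T y)" for x y
    by (simp add: cinner_eq_inner sym flip: imaginary)
  ultimately show ?thesis by (simp add: herm_ops_def)
qed

lemma herm_opsD:
  assumes "T \<in> herm_ops"
  shows "blinfun_apply T (c *\<^sub>C x) = c *\<^sub>C blinfun_apply T x"
    and "cinner (blinfun_apply T x) y = cinner x (blinfun_apply T y)"
  using assms by (auto simp: herm_ops_def)

lemma zero_herm_ops: "0 \<in> herm_ops"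
  by (simp add: herm_ops_def scaleC_0_right cinner_simps)

lemma add_herm_ops: "S \<in> herm_ops \<Longrightarrow> T \<in> herm_ops \<Longrightarrow> S + T \<in> herm_ops"
  by (simp add: herm_ops_def blinfun.add_left scaleC_add_right cinner_simps)

lemma scaleR_id_herm_ops: "r *\<^sub>R id_blinfun \<in> herm_ops"
  by (simp add: herm_ops_def blinfun.scaleR_left cinner_simps scaleR_eq_scaleC scaleC_scaleC
      mult.commute)

text \<open>Riesz' theorem turns a form into an operator; invariance of the form under multiplication of
  both arguments by \<open>\<i>\<close> makes the operator complex linear.\<close>

lemma herm_op_of_real_form:
  fixes \<beta> :: "'h::complex_hilbert_space \<Rightarrow> 'h \<Rightarrow> real"
  assumes add: "\<And>x y z. \<beta> x (y + z) = \<beta> x y + \<beta> x z"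
    and scale: "\<And>c x y. \<beta> x (c *\<^sub>R y) = c * \<beta> x y"
    and sym: "\<And>x y. \<beta> x y = \<beta> y x"
    and imaginary: "\<And>x y. \<beta> (\<i> *\<^sub>C x) (\<i> *\<^sub>C y) = \<beta> x y"
    and bound: "\<And>x. \<bar>\<beta> x x\<bar> \<le> C * (norm x)\<^sup>2"
  obtains S where "S \<in> herm_ops" and "\<And>x y. \<beta> x y = inner x (blinfun_apply S y)"
proof -
  have add_l: "\<beta> (x + y) z = \<beta> x z + \<beta> y z" for x y z using add sym by metis
  have scale_l: "\<beta> (c *\<^sub>R x) y = c * \<beta> x y" for c x y using scale sym by metis
  have minus: "\<beta> x (- y) = - \<beta> x y" for x y using scale[of x "-1" y] by simp
  have minus_l: "\<beta> (- x) y = - \<beta> x y" for x y using minus sym by metis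
  have unit: "\<bar>\<beta> x y\<bar> \<le> C" if "norm x = 1" "norm y = 1" for x y
  proof -
    have "4 * \<beta> x y = \<beta> (x + y) (x + y) - \<beta> (x + - y) (x + - y)"
      unfolding add add_l minus minus_l using sym[of y x] by simp
    then have "4 * \<bar>\<beta> x y\<bar> \<le> C * (norm (x + y))\<^sup>2 + C * (norm (x - y))\<^sup>2"
      using bound[of "x + y"] bound[of "x - y"] by simp
    also have "\<dots> = C * 4"
      using that by (simp add: power2_norm_eq_inner inner_simps norm_eq_1 algebra_simps)
    finally show ?thesis by simp
  qed
  have bound2: "\<bar>\<beta> x y\<bar> \<le> C * norm x * norm y" for x y
  proof (cases "x = 0 \<or> y = 0")
    case True
    then show ?thesis using scale[of x 0 y] scale_l[of 0 x y] by auto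
  next
    case False
    then have "\<bar>\<beta> ((1 / norm x) *\<^sub>R x) ((1 / norm y) *\<^sub>R y)\<bar> \<le> C" by (intro unit) auto
    then show ?thesis using False by (simp add: scale scale_l abs_mult field_simps)
  qed
  have "\<exists>u. \<forall>x. \<beta> x y = inner u x" for y
  proof (rule riesz_representation)
    show "bounded_linear (\<lambda>x. \<beta> x y)"
      by (rule bounded_linear_intro[where K = "C * norm y"])
        (use bound2 in \<open>auto simp: add_l scale_l algebra_simps\<close>)
  qed
  then obtain R where R: "\<And>x y. \<beta> x y = inner (R y) x" by metis
  have eqI: "u = v" if "\<And>x. inner u x = inner v x" for u v :: 'h
  proof -
    have "inner (u - v) (u - v) = 0" using that[of "u - v"] by (simp add: inner_diff_left)
    then show ?thesis by simp
  qed
  have "bounded_linear R"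
  proof (rule bounded_linear_intro[where K = C])
    show "R (x + y) = R x + R y" for x y
      by (rule eqI) (simp add: inner_add_left add flip: R)
    show "R (c *\<^sub>R x) = c *\<^sub>R R x" for c x
      by (rule eqI) (simp add: scale flip: R)
    show "norm (R x) \<le> norm x * C" for x
    proof (cases "R x = 0")
      case True
      have "0 \<le> \<bar>\<beta> x x\<bar>" by simp
      then have "0 \<le> C * (norm x)\<^sup>2" using bound[of x] by linarith
      then show ?thesis using True by (cases "x = 0") (auto simp: zero_le_mult_iff)
    next
      case False
      have "norm (R x) * norm (R x) = \<beta> (R x) x"
        by (simp add: R power2_norm_eq_inner flip: power2_eq_square)
      also have "\<dots> \<le> C * norm (R x) * norm x" using bound2[of "R x" x] by simp
      finally show ?thesis using False by (simp add: mult_ac)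
    qed
  qed
  then have app: "blinfun_apply (Blinfun R) = R" by (rule bounded_linear_Blinfun_apply)
  have "Blinfun R \<in> herm_ops"
  proof (rule herm_opsI_inner)
    show "inner (blinfun_apply (Blinfun R) x) y = inner x (blinfun_apply (Blinfun R) y)" for x y
      unfolding app using R[of y x] R[of x y] sym[of x y] by (simp add: inner_commute)
    have ii: "\<i> *\<^sub>C \<i> *\<^sub>C x = - x" for x :: 'h
      by (simp add: scaleC_scaleC scaleC_minus_left scaleC_one)
    have "\<beta> x (\<i> *\<^sub>C y) = - \<beta> (\<i> *\<^sub>C x) y" for x y
      using imaginary[of x "\<i> *\<^sub>C y"] by (simp add: ii minus)
    then show "blinfun_apply (Blinfun R) (\<i> *\<^sub>C x) = \<i> *\<^sub>C blinfun_apply (Blinfun R) x" for x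
      unfolding app by (intro eqI) (simp add: inner_imaginary_left flip: R)
  qed
  then show ?thesis
    using that[of "Blinfun R"] R by (simp add: app inner_commute)
qed

section \<open>Families of vectors and the forms they annihilate\<close>

text \<open>For a family \<open>v\<close> over the index set \<open>I\<close>, read as a vector of \<open>\<complex>\<^sup>I \<otimes> H\<close>, this is
  \<open>\<langle>v, (A \<otimes> S) v\<rangle>\<close>.\<close>

definition tensor_form ::
    "nat set \<Rightarrow> (nat \<Rightarrow> nat \<Rightarrow> complex) \<Rightarrow> ('h \<Rightarrow> 'h) \<Rightarrow> (nat \<Rightarrow> 'h::complex_hilbert_space) \<Rightarrow> complex"
  where "tensor_form I A S v = (\<Sum>a\<in>I. \<Sum>b\<in>I. A a b * cinner (v a) (S (v b)))"

definition re_form ::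
    "nat set \<Rightarrow> (nat \<Rightarrow> nat \<Rightarrow> complex) \<Rightarrow> ('h \<Rightarrow> 'h) \<Rightarrow> (nat \<Rightarrow> 'h::complex_hilbert_space) \<Rightarrow> real"
  where "re_form I A S v = Re (tensor_form I A S v)"

abbreviation scalar_form :: "nat set \<Rightarrow> (nat \<Rightarrow> nat \<Rightarrow> complex) \<Rightarrow> (nat \<Rightarrow> complex) \<Rightarrow> real"
  where "scalar_form I A w \<equiv> re_form I A (\<lambda>x. x) w"

definition slice :: "'h::complex_hilbert_space \<Rightarrow> (nat \<Rightarrow> 'h) \<Rightarrow> nat \<Rightarrow> complex"
  where "slice z v a = cinner z (v a)"

text \<open>A list \<open>vs\<close> stands for the positive finite rank operator \<open>\<rho> = \<Sum>\<^sub>v |v\<rangle>\<langle>v|\<close> on \<open>\<complex>\<^sup>I \<otimes> H\<close>; it is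
  null if the partial traces of \<open>\<rho> (B\<^sub>i \<otimes> 1)\<close> over \<open>\<complex>\<^sup>I\<close> vanish for all \<open>i < k\<close>. For Hermitian
  \<open>B\<^sub>i\<close> the sums below are the diagonal matrix elements of these partial traces, which determine
  them by polarisation. Stated with slices, nullity passes between \<open>H\<close> and \<open>\<complex>\<close> in both
  directions: slices of null families are null, and so are the tensors of scalar null families
  with a vector.\<close>

definition null_family ::
    "nat set \<Rightarrow> (nat \<Rightarrow> nat \<Rightarrow> nat \<Rightarrow> complex) \<Rightarrow> nat \<Rightarrow> (nat \<Rightarrow> 'h::complex_hilbert_space) list \<Rightarrow> bool"
  where "null_family I B k vs \<longleftrightarrow> (\<forall>i<k. \<forall>z. (\<Sum>v\<leftarrow>vs. scalar_form I (B i) (slice z v)) = 0)"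

lemma re_form_expand: "re_form I A S v = Re (\<Sum>a\<in>I. \<Sum>b\<in>I. A a b * cinner (v a) (S (v b)))"
  by (simp add: re_form_def tensor_form_def)

lemma scalar_form_eq: "scalar_form I A w = Re (\<Sum>a\<in>I. \<Sum>b\<in>I. A a b * cnj (w a) * w b)"
  by (simp add: re_form_expand cinner_complex_def mult.assoc)

lemma Re_of_real_mult: "Re (of_real r * z) = r * Re z"
  by simp

lemma re_form_scaleR:
  assumes "\<And>c x. S (c *\<^sub>R x) = c *\<^sub>R S x"
  shows "re_form I A S (\<lambda>a. t *\<^sub>R v a) = t\<^sup>2 * re_form I A S v"
proof -
  have "(\<Sum>a\<in>I. \<Sum>b\<in>I. A a b * cinner (t *\<^sub>R v a) (S (t *\<^sub>R v b))) =
      of_real (t\<^sup>2) * (\<Sum>a\<in>I. \<Sum>b\<in>I. A a b * cinner (v a) (S (v b)))"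
    by (simp add: assms cinner_simps sum_distrib_left power2_eq_square mult_ac)
  then show ?thesis unfolding re_form_expand by (simp only: Re_of_real_mult)
qed

lemma scalar_form_scale: "scalar_form I A (\<lambda>a. c * w a) = (cmod c)\<^sup>2 * scalar_form I A w"
proof -
  have "(\<Sum>a\<in>I. \<Sum>b\<in>I. A a b * cnj (c * w a) * (c * w b)) =
      of_real ((cmod c)\<^sup>2) * (\<Sum>a\<in>I. \<Sum>b\<in>I. A a b * cnj (w a) * w b)"
    by (simp add: sum_distrib_left complex_norm_square mult_ac del: of_real_power)
  then show ?thesis unfolding scalar_form_eq by (simp only: Re_of_real_mult)
qed

lemma null_family_Nil: "null_family I B k []"
  by (simp add: null_family_def)

lemma null_family_append:
  "null_family I B k us \<Longrightarrow> null_family I B k vs \<Longrightarrow> null_family I B k (us @ vs)"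
  by (simp add: null_family_def)

lemma null_family_scale:
  assumes "null_family I B k vs"
  shows "null_family I B k (map (\<lambda>v a. t *\<^sub>R v a) vs)"
proof -
  have "slice z (\<lambda>a. t *\<^sub>R v a) = (\<lambda>a. of_real t * slice z v a)" for z and v :: "nat \<Rightarrow> 'a"
    by (simp add: slice_def cinner_simps fun_eq_iff)
  then show ?thesis
    using assms by (simp add: null_family_def o_def scalar_form_scale sum_list_const_mult)
qed

lemma null_family_scalarD:
  fixes ws :: "(nat \<Rightarrow> complex) list"
  assumes "null_family I B k ws" and "i < k"
  shows "(\<Sum>w\<leftarrow>ws. scalar_form I (B i) w) = 0"
proof -
  have "(\<Sum>w\<leftarrow>ws. scalar_form I (B i) (slice 1 w)) = 0"
    using assms unfolding null_family_def by blast
  moreover have "slice 1 = (\<lambda>w. w)" by (simp add: slice_def cinner_complex_def fun_eq_iff)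
  ultimately show ?thesis by simp
qed

lemma null_family_tensor:
  assumes "null_family I B k ws"
  shows "null_family I B k (map (\<lambda>w a. w a *\<^sub>C (x::'h::complex_hilbert_space)) ws)"
proof -
  have "slice z (\<lambda>a. w a *\<^sub>C x) = (\<lambda>a. cinner z x * w a)" for z and w
    by (simp add: slice_def cinner_simps fun_eq_iff)
  moreover have "(\<Sum>w\<leftarrow>ws. scalar_form I (B i) w) = 0" if "i < k" for i
    using assms that by (rule null_family_scalarD)
  ultimately show ?thesis
    by (simp add: null_family_def o_def scalar_form_scale sum_list_const_mult)
qed

definition sym_outer :: "'h::complex_hilbert_space \<Rightarrow> 'h \<Rightarrow> 'h \<Rightarrow>\<^sub>L 'h"
  where "sym_outer x y = Blinfun (\<lambda>z. cinner y z *\<^sub>C x + cinner x z *\<^sub>C y)"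

lemma sym_outer_apply: "blinfun_apply (sym_outer x y) z = cinner y z *\<^sub>C x + cinner x z *\<^sub>C y"
proof -
  have "bounded_linear (\<lambda>z. cinner y z *\<^sub>C x + cinner x z *\<^sub>C y)"
  proof (rule bounded_linear_intro[where K = "2 * norm x * norm y"])
    fix u v :: 'a and r
    show "cinner y (u + v) *\<^sub>C x + cinner x (u + v) *\<^sub>C y =
        cinner y u *\<^sub>C x + cinner x u *\<^sub>C y + (cinner y v *\<^sub>C x + cinner x v *\<^sub>C y)"
      by (simp add: cinner_simps scaleC_add_left)
    show "cinner y (r *\<^sub>R u) *\<^sub>C x + cinner x (r *\<^sub>R u) *\<^sub>C y =
        r *\<^sub>R (cinner y u *\<^sub>C x + cinner x u *\<^sub>C y)"
      by (simp add: cinner_simps scaleR_eq_scaleC scaleC_add_right scaleC_scaleC)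
    have "norm (cinner y u *\<^sub>C x + cinner x u *\<^sub>C y) \<le>
        (norm y * norm u) * norm x + (norm x * norm u) * norm y"
      by (intro norm_triangle_mono) (simp_all add: norm_scaleC mult_right_mono norm_cinner_le)
    then show "norm (cinner y u *\<^sub>C x + cinner x u *\<^sub>C y) \<le> norm u * (2 * norm x * norm y)"
      by (simp add: algebra_simps)
  qed
  then show ?thesis by (simp add: sym_outer_def bounded_linear_Blinfun_apply)
qed

lemma sym_outer_commute: "sym_outer x y = sym_outer y x"
  by (rule blinfun_eqI) (simp add: sym_outer_apply)

lemma sym_outer_add: "sym_outer x (y + z) = sym_outer x y + sym_outer x z"
  by (rule blinfun_eqI)
    (simp add: sym_outer_apply blinfun.add_left cinner_simps scaleC_add_left scaleC_add_right)

lemma sym_outer_scaleR: "sym_outer x (c *\<^sub>R y) = c *\<^sub>R sym_outer x y"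
  by (rule blinfun_eqI)
    (simp add: sym_outer_apply blinfun.scaleR_left cinner_simps scaleR_eq_scaleC scaleC_add_right
      scaleC_scaleC mult.commute)

lemma sym_outer_add_left: "sym_outer (x + y) z = sym_outer x z + sym_outer y z"
  unfolding sym_outer_commute[of _ z] by (rule sym_outer_add)

lemma sym_outer_scaleR_left: "sym_outer (c *\<^sub>R x) y = c *\<^sub>R sym_outer x y"
  unfolding sym_outer_commute[of _ y] by (rule sym_outer_scaleR)

lemma sym_outer_imaginary: "sym_outer (\<i> *\<^sub>C x) (\<i> *\<^sub>C y) = sym_outer x y"
proof (rule blinfun_eqI)
  fix z
  have "\<i> * c * \<i> = - c" for c by (simp add: complex_eq_iff)
  then show "blinfun_apply (sym_outer (\<i> *\<^sub>C x) (\<i> *\<^sub>C y)) z = blinfun_apply (sym_outer x y) z"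
    by (simp add: sym_outer_apply cinner_simps scaleC_scaleC scaleC_minus_left)
qed

lemma sym_outer_scaleC: "sym_outer (c *\<^sub>C x) (d *\<^sub>C x) = Re (c * cnj d) *\<^sub>R sym_outer x x"
proof (rule blinfun_eqI)
  fix z
  have "blinfun_apply (sym_outer (c *\<^sub>C x) (d *\<^sub>C x)) z = ((c * cnj d + cnj (c * cnj d)) * cinner x z) *\<^sub>C x"
    by (simp add: sym_outer_apply cinner_simps scaleC_scaleC algebra_simps flip: scaleC_add_left)
  also have "c * cnj d + cnj (c * cnj d) = of_real (2 * Re (c * cnj d))"
    by (simp only: complex_add_cnj)
  also have "(of_real (2 * Re (c * cnj d)) * cinner x z) *\<^sub>C x =
      blinfun_apply (Re (c * cnj d) *\<^sub>R sym_outer x x) z"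
    by (simp add: sym_outer_apply blinfun.scaleR_left scaleR_eq_scaleC scaleC_scaleC
        flip: scaleC_add_left)
  finally show "blinfun_apply (sym_outer (c *\<^sub>C x) (d *\<^sub>C x)) z =
      blinfun_apply (Re (c * cnj d) *\<^sub>R sym_outer x x) z" .
qed

text \<open>The Hermitian part of the partial trace of \<open>|v\<rangle>\<langle>v| (A \<otimes> 1)\<close> over \<open>\<complex>\<^sup>I\<close>.\<close>

definition contraction ::
    "nat set \<Rightarrow> (nat \<Rightarrow> nat \<Rightarrow> complex) \<Rightarrow> (nat \<Rightarrow> 'h::complex_hilbert_space) \<Rightarrow> 'h \<Rightarrow>\<^sub>L 'h"
  where "contraction I A v = (1/2) *\<^sub>R (\<Sum>a\<in>I. \<Sum>b\<in>I. sym_outer (v a) (A a b *\<^sub>C v b))"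

lemma contraction_slice: "Re (cinner z (blinfun_apply (contraction I A v) z)) = scalar_form I A (slice z v)"
proof -
  have "Re (cinner z (blinfun_apply (sym_outer (v a) (A a b *\<^sub>C v b)) z)) =
      2 * Re (A a b * cnj (slice z v a) * slice z v b)" for a b
  proof -
    have "cinner z (blinfun_apply (sym_outer (v a) (A a b *\<^sub>C v b)) z) =
        A a b * cnj (slice z v a) * slice z v b + cnj (A a b * cnj (slice z v a) * slice z v b)"
      by (simp add: sym_outer_apply cinner_simps slice_def flip: cinner_commute)
    then show ?thesis by (simp only: complex_add_cnj) simp
  qed
  then show ?thesis
    by (simp add: contraction_def scalar_form_eq blinfun.scaleR_left blinfun.sum_left cinner_scaleR_right
        cinner_sum_right sum_distrib_left Re_of_real_mult del: times_complex.sel)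
qed

lemma contraction_tensor:
  "contraction I A (\<lambda>a. w a *\<^sub>C x) = (scalar_form I A w / 2) *\<^sub>R sym_outer x x"
proof -
  have "sym_outer (w a *\<^sub>C x) (A a b *\<^sub>C w b *\<^sub>C x) = Re (A a b * cnj (w a) * w b) *\<^sub>R sym_outer x x" for a b
  proof -
    have "sym_outer (w a *\<^sub>C x) (A a b *\<^sub>C w b *\<^sub>C x) = sym_outer ((A a b * w b) *\<^sub>C x) (w a *\<^sub>C x)"
      by (simp add: scaleC_scaleC sym_outer_commute)
    then show ?thesis by (simp add: sym_outer_scaleC mult_ac)
  qed
  then show ?thesis
    by (simp add: contraction_def scalar_form_eq scaleR_sum_left sum_divide_distrib scaleR_sum_right)
qed

lemma blinfun_apply_sum_list:
  "blinfun_apply (sum_list xs) z = (\<Sum>x\<leftarrow>xs. blinfun_apply x z)"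
  by (induction xs) (simp_all add: blinfun.add_left)

lemma cinner_sum_list: "cinner z (sum_list xs) = (\<Sum>x\<leftarrow>xs. cinner z x)"
  for z :: "'h::complex_hilbert_space"
  by (induction xs) (simp_all add: cinner_simps)

lemma Re_sum_list: "Re (sum_list xs) = (\<Sum>x\<leftarrow>xs. Re x)"
  by (induction xs) simp_all

section \<open>Eliminating one unknown operator\<close>

text \<open>On the space of finite rank Hermitian operators, the functional \<open>y \<mapsto> tr(S y)\<close> has to
  dominate \<open>- \<Sum>\<^sub>v F v\<close> at the contraction \<open>y\<close> of every family in \<open>Cs\<close>. Families with contraction
  zero impose no obstruction by \<open>F_nonneg\<close>, and every \<open>y\<close> is the contraction of some family,
  because \<open>A\<close> takes both signs on scalar families; so the Hahn-Banach theorem applies. The tensors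
  of the scalar families with a vector \<open>x\<close> bound the functional at \<open>|x\<rangle>\<langle>x|\<close>, which makes it an
  operator.\<close>

lemma eliminate_operator:
  fixes F :: "(nat \<Rightarrow> 'h::complex_hilbert_space) \<Rightarrow> real"
    and Cs :: "(nat \<Rightarrow> 'h) list set"
  assumes Nil: "[] \<in> Cs"
    and append: "\<And>us vs. us \<in> Cs \<Longrightarrow> vs \<in> Cs \<Longrightarrow> us @ vs \<in> Cs"
    and scale: "\<And>t vs. vs \<in> Cs \<Longrightarrow> map (\<lambda>v a. t *\<^sub>R v a) vs \<in> Cs"
    and F_scale: "\<And>t v. F (\<lambda>a. t *\<^sub>R v a) = t\<^sup>2 * F v"
    and F_bound: "\<And>v. F v \<le> C * (\<Sum>a\<in>I. (norm (v a))\<^sup>2)"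
    and F_nonneg: "\<And>vs. vs \<in> Cs \<Longrightarrow> (\<And>z. (\<Sum>v\<leftarrow>vs. scalar_form I A (slice z v)) = 0) \<Longrightarrow> 0 \<le> (\<Sum>v\<leftarrow>vs. F v)"
    and tensor: "\<And>x w. w \<in> {wp, wn} \<Longrightarrow> map (\<lambda>w a. w a *\<^sub>C x) w \<in> Cs"
    and wp: "(\<Sum>w\<leftarrow>wp. scalar_form I A w) > 0" and wn: "(\<Sum>w\<leftarrow>wn. scalar_form I A w) < 0"
  obtains S where "S \<in> herm_ops"
    and "\<And>vs. vs \<in> Cs \<Longrightarrow> 0 \<le> (\<Sum>v\<leftarrow>vs. F v + re_form I A (blinfun_apply S) v)"
proof -
  define \<Phi> where "\<Phi> vs = (\<Sum>v\<leftarrow>vs. contraction I A v)" for vs :: "(nat \<Rightarrow> 'h) list"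
  define E where "E = {(\<Phi> vs, r) | vs r. vs \<in> Cs \<and> (\<Sum>v\<leftarrow>vs. F v) \<le> r}"
  have E_I: "(\<Phi> vs, r) \<in> E" if "vs \<in> Cs" "(\<Sum>v\<leftarrow>vs. F v) \<le> r" for vs r
    using that unfolding E_def by blast
  define G where "G = real_vector.span (range (\<lambda>x::'h. sym_outer x x))"
  have G: "real_vector.subspace G" by (simp add: G_def real_vector.subspace_span)
  have \<Phi>_scale: "\<Phi> (map (\<lambda>v a. t *\<^sub>R v a) vs) = t\<^sup>2 *\<^sub>R \<Phi> vs" for t vs
  proof -
    have "sym_outer (t *\<^sub>R x) (A a b *\<^sub>C t *\<^sub>R y) = t\<^sup>2 *\<^sub>R sym_outer x (A a b *\<^sub>C y)" for x y :: 'h and a b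
    proof -
      have "A a b *\<^sub>C t *\<^sub>R y = t *\<^sub>R A a b *\<^sub>C y"
        by (simp add: scaleR_eq_scaleC scaleC_scaleC mult.commute)
      then show ?thesis
        by (simp add: sym_outer_scaleR sym_outer_scaleR_left power2_eq_square)
    qed
    then have "contraction I A (\<lambda>a. t *\<^sub>R v a) = t\<^sup>2 *\<^sub>R contraction I A v" for v :: "nat \<Rightarrow> 'h"
      by (simp add: contraction_def scaleR_sum_right mult.commute)
    then show ?thesis by (induction vs) (simp_all add: \<Phi>_def algebra_simps)
  qed
  have F_sum_scale: "(\<Sum>v\<leftarrow>map (\<lambda>v a. t *\<^sub>R v a) vs. F v) = t\<^sup>2 * (\<Sum>v\<leftarrow>vs. F v)" for t vs
    by (simp add: o_def F_scale sum_list_const_mult)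
  \<comment> \<open>scalar families produce all multiples of \<open>|x\<rangle>\<langle>x|\<close>, at a cost proportional to \<open>\<parallel>x\<parallel>\<^sup>2\<close>\<close>
  have E_tensor: "((t * (\<Sum>w\<leftarrow>ws. scalar_form I A w) / 2) *\<^sub>R sym_outer x x,
      t * (C * (\<Sum>w\<leftarrow>ws. \<Sum>a\<in>I. (cmod (w a))\<^sup>2) * (norm x)\<^sup>2)) \<in> E"
    if "ws \<in> {wp, wn}" "t \<ge> 0" for t ws x
  proof -
    let ?y = "sqrt t *\<^sub>R x"
    let ?vs = "map (\<lambda>w a. w a *\<^sub>C ?y) ws"
    have "?vs \<in> Cs" by (rule tensor[OF that(1)])
    moreover have "sym_outer ?y ?y = t *\<^sub>R sym_outer x x"
      using that(2) by (simp add: sym_outer_scaleR sym_outer_scaleR_left)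
    then have "\<Phi> ?vs = (t * (\<Sum>w\<leftarrow>ws. scalar_form I A w) / 2) *\<^sub>R sym_outer x x"
      by (induction ws) (simp_all add: \<Phi>_def contraction_tensor algebra_simps add_divide_distrib)
    moreover have "(\<Sum>v\<leftarrow>?vs. F v) \<le> t * (C * (\<Sum>w\<leftarrow>ws. \<Sum>a\<in>I. (cmod (w a))\<^sup>2) * (norm x)\<^sup>2)"
    proof (induction ws)
      case (Cons w ws)
      have "F (\<lambda>a. w a *\<^sub>C ?y) \<le> C * (\<Sum>a\<in>I. (norm (w a *\<^sub>C ?y))\<^sup>2)" by (rule F_bound)
      also have "\<dots> = t * (C * (\<Sum>a\<in>I. (cmod (w a))\<^sup>2) * (norm x)\<^sup>2)"
        using that(2) by (simp add: norm_scaleC power_mult_distrib sum_distrib_left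
            sum_distrib_right mult_ac)
      finally show ?case using Cons by (simp add: algebra_simps)
    qed simp
    ultimately show ?thesis using E_I[of ?vs] by simp
  qed
  have E_add: "x + y \<in> E" if xy: "x \<in> E" "y \<in> E" for x y
  proof -
    obtain us r vs q where *: "x = (\<Phi> us, r)" "us \<in> Cs" "(\<Sum>v\<leftarrow>us. F v) \<le> r"
        "y = (\<Phi> vs, q)" "vs \<in> Cs" "(\<Sum>v\<leftarrow>vs. F v) \<le> q"
      using xy unfolding E_def by blast
    then have "x + y = (\<Phi> (us @ vs), r + q)" "us @ vs \<in> Cs" "(\<Sum>v\<leftarrow>us @ vs. F v) \<le> r + q"
      using append by (auto simp: \<Phi>_def)
    then show ?thesis unfolding E_def by blast
  qed
  have E_scale: "t *\<^sub>R x \<in> E" if x: "x \<in> E" "t > 0" for t x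
  proof -
    obtain vs r where *: "x = (\<Phi> vs, r)" "vs \<in> Cs" "(\<Sum>v\<leftarrow>vs. F v) \<le> r"
      using x unfolding E_def by blast
    let ?vs = "map (\<lambda>v a. sqrt t *\<^sub>R v a) vs"
    have "t *\<^sub>R x = (\<Phi> ?vs, t * r)" "?vs \<in> Cs" "(\<Sum>v\<leftarrow>?vs. F v) \<le> t * r"
      unfolding \<Phi>_scale F_sum_scale using * x(2) scale by auto
    then show ?thesis unfolding E_def by blast
  qed
  have pos: "0 \<le> r" if "(0, r) \<in> E" for r
  proof -
    obtain vs where vs: "0 = \<Phi> vs" "vs \<in> Cs" "(\<Sum>v\<leftarrow>vs. F v) \<le> r"
      using \<open>(0, r) \<in> E\<close> by (auto simp: E_def)
    have "(\<Sum>v\<leftarrow>vs. scalar_form I A (slice z v)) = 0" for z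
    proof -
      have "(\<Sum>v\<leftarrow>vs. scalar_form I A (slice z v)) = Re (cinner z (blinfun_apply (\<Phi> vs) z))"
        by (simp add: \<Phi>_def blinfun_apply_sum_list cinner_sum_list Re_sum_list o_def
            flip: contraction_slice)
      then show ?thesis by (simp add: cinner_simps flip: vs(1))
    qed
    then have "0 \<le> (\<Sum>v\<leftarrow>vs. F v)" by (rule F_nonneg[OF vs(2)])
    then show ?thesis using vs(3) by linarith
  qed
  have total: "\<exists>r. (y, r) \<in> E" if "y \<in> G" for y
    using that unfolding G_def
  proof (induction rule: real_vector.span_induct_alt)
    case base
    have "(\<Phi> [], 0) \<in> E" using Nil by (force simp: E_def)
    then show ?case by (auto simp: \<Phi>_def)
  next
    case (step c u y)
    then obtain x r where u: "u = sym_outer x x" and r: "(y, r) \<in> E" by auto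
    have "\<exists>q. (c *\<^sub>R sym_outer x x, q) \<in> E"
    proof (cases "c \<ge> 0")
      case True
      then show ?thesis
        using E_tensor[of wp "2 * c / (\<Sum>w\<leftarrow>wp. scalar_form I A w)" x] wp by auto
    next
      case False
      then show ?thesis
        using E_tensor[of wn "2 * c / (\<Sum>w\<leftarrow>wn. scalar_form I A w)" x] wn
        by (auto simp: divide_nonpos_neg)
    qed
    with E_add r show ?case unfolding u by fastforce
  qed
  have zero: "0 \<in> E" using Nil unfolding E_def zero_prod_def \<Phi>_def by force
  have up: "(0, 1) \<in> E" using Nil unfolding E_def \<Phi>_def by force
  from cone_dominates_linear_functional[OF zero up E_add E_scale pos G total]
  obtain s where s_add: "\<And>x y. x \<in> G \<Longrightarrow> y \<in> G \<Longrightarrow> s (x + y) = s x + s y"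
    and s_scale: "\<And>c x. x \<in> G \<Longrightarrow> s (c *\<^sub>R x) = c * s x"
    and s_le: "\<And>y r. (y, r) \<in> E \<Longrightarrow> y \<in> G \<Longrightarrow> s y \<le> r"
    by metis
  have s_minus: "s (- y) = - s y" if "y \<in> G" for y
    using s_scale[OF that, of "-1"] by simp
  have rank_G: "sym_outer x y \<in> G" for x y
  proof -
    have sq: "sym_outer x x \<in> G" for x
      unfolding G_def by (rule real_vector.span_base) simp
    have "sym_outer (x + y) (x + y) = sym_outer x x + 2 *\<^sub>R sym_outer x y + sym_outer y y"
      by (simp add: sym_outer_add sym_outer_add_left sym_outer_commute[of y x] scaleR_2)
    then have "sym_outer x y = (1/2) *\<^sub>R (sym_outer (x + y) (x + y) - sym_outer x x - sym_outer y y)"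
      by simp
    also have "\<dots> \<in> G"
      by (intro real_vector.subspace_scale real_vector.subspace_diff G sq)
    finally show ?thesis .
  qed
  \<comment> \<open>\<open>s\<close> is dominated by \<open>F\<close>, so its negative represents \<open>S\<close>; the factor \<open>1/2\<close> accounts for the two
    summands of \<open>sym_outer\<close>\<close>
  define \<beta> where "\<beta> x y = - s (sym_outer x y) / 2" for x y
  define Qp where "Qp = C * (\<Sum>w\<leftarrow>wp. \<Sum>a\<in>I. (cmod (w a))\<^sup>2) / (\<Sum>w\<leftarrow>wp. scalar_form I A w)"
  define Qn where "Qn = - C * (\<Sum>w\<leftarrow>wn. \<Sum>a\<in>I. (cmod (w a))\<^sup>2) / (\<Sum>w\<leftarrow>wn. scalar_form I A w)"
  obtain S where S: "S \<in> herm_ops" "\<And>x y. \<beta> x y = inner x (blinfun_apply S y)"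
  proof (rule herm_op_of_real_form[of \<beta> "\<bar>Qp\<bar> + \<bar>Qn\<bar>"])
    fix x y z :: 'h and c
    show "\<beta> x (y + z) = \<beta> x y + \<beta> x z"
      by (simp add: \<beta>_def sym_outer_add s_add rank_G)
    show "\<beta> x (c *\<^sub>R y) = c * \<beta> x y"
      by (simp add: \<beta>_def sym_outer_scaleR s_scale rank_G)
    show "\<beta> x y = \<beta> y x" by (simp add: \<beta>_def sym_outer_commute)
    show "\<beta> (\<i> *\<^sub>C x) (\<i> *\<^sub>C y) = \<beta> x y" by (simp add: \<beta>_def sym_outer_imaginary)
    have "s (sym_outer x x) / 2 \<le> Qp * (norm x)\<^sup>2"
      using s_le[OF E_tensor[of wp "1 / (\<Sum>w\<leftarrow>wp. scalar_form I A w)" x]] wp rank_G[of x x] G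
      by (simp add: s_scale real_vector.subspace_scale Qp_def)
    moreover have "- s (sym_outer x x) / 2 \<le> Qn * (norm x)\<^sup>2"
      using s_le[OF E_tensor[of wn "- 1 / (\<Sum>w\<leftarrow>wn. scalar_form I A w)" x]] wn rank_G[of x x] G
      by (simp add: s_scale s_minus real_vector.subspace_scale real_vector.subspace_neg Qn_def)
    moreover have "Qp * (norm x)\<^sup>2 \<le> (\<bar>Qp\<bar> + \<bar>Qn\<bar>) * (norm x)\<^sup>2"
      "Qn * (norm x)\<^sup>2 \<le> (\<bar>Qp\<bar> + \<bar>Qn\<bar>) * (norm x)\<^sup>2"
      by (intro mult_right_mono; simp)+
    ultimately show "\<bar>\<beta> x x\<bar> \<le> (\<bar>Qp\<bar> + \<bar>Qn\<bar>) * (norm x)\<^sup>2"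
      unfolding \<beta>_def by linarith
  qed blast
  have s0: "s 0 = 0" using s_scale[of 0 0] G by (simp add: real_vector.subspace_0)
  have s_sum: "s (\<Sum>a\<in>J. f a) = (\<Sum>a\<in>J. s (f a)) \<and> (\<Sum>a\<in>J. f a) \<in> G"
    if "\<And>a. f a \<in> G" for J :: "nat set" and f
    by (induction J rule: infinite_finite_induct)
      (use that G s_add s0 in \<open>auto simp: real_vector.subspace_0 real_vector.subspace_add\<close>)
  have contr: "s (contraction I A v) = - re_form I A (blinfun_apply S) v"
    and contr_G: "contraction I A v \<in> G" for v
  proof -
    let ?R = "\<lambda>a b. sym_outer (v a) (A a b *\<^sub>C v b)"
    have "A a b * cinner (v a) (blinfun_apply S (v b)) = cinner (v a) (blinfun_apply S (A a b *\<^sub>C v b))" for a b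
      using S(1) by (simp add: herm_opsD cinner_simps)
    then have "Re (A a b * cinner (v a) (blinfun_apply S (v b))) = - s (?R a b) / 2" for a b
      by (simp add: S(2)[symmetric] \<beta>_def flip: inner_eq_Re_cinner)
    then have *: "re_form I A (blinfun_apply S) v = (\<Sum>a\<in>I. \<Sum>b\<in>I. - s (?R a b) / 2)"
      by (simp add: re_form_expand)
    have row: "s (\<Sum>b\<in>I. ?R a b) = (\<Sum>b\<in>I. s (?R a b))" "(\<Sum>b\<in>I. ?R a b) \<in> G" for a
      using s_sum[where f = "?R a" and J = I] rank_G by auto
    have inG: "(\<Sum>a\<in>I. \<Sum>b\<in>I. ?R a b) \<in> G"
      and "s (\<Sum>a\<in>I. \<Sum>b\<in>I. ?R a b) = (\<Sum>a\<in>I. \<Sum>b\<in>I. s (?R a b))"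
      using s_sum[where f = "\<lambda>a. \<Sum>b\<in>I. ?R a b" and J = I] row by auto
    then show "s (contraction I A v) = - re_form I A (blinfun_apply S) v"
      unfolding * contraction_def s_scale[OF inG]
      by (simp add: sum_negf sum_divide_distrib)
    show "contraction I A v \<in> G"
      unfolding contraction_def using inG G by (simp add: real_vector.subspace_scale)
  qed
  have "0 \<le> (\<Sum>v\<leftarrow>vs. F v + re_form I A (blinfun_apply S) v)" if "vs \<in> Cs" for vs
  proof -
    have *: "s (\<Phi> us) = - (\<Sum>v\<leftarrow>us. re_form I A (blinfun_apply S) v) \<and> \<Phi> us \<in> G" for us
      by (induction us)
        (use G s_add s0 contr contr_G in
          \<open>auto simp: \<Phi>_def real_vector.subspace_0 real_vector.subspace_add\<close>)
    have "(\<Phi> vs, (\<Sum>v\<leftarrow>vs. F v)) \<in> E" using that by (auto simp: E_def)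
    with * have "- (\<Sum>v\<leftarrow>vs. re_form I A (blinfun_apply S) v) \<le> (\<Sum>v\<leftarrow>vs. F v)"
      using s_le by metis
    then show ?thesis by (simp add: sum_list_addf)
  qed
  with S(1) that show ?thesis by blast
qed

section \<open>Eliminating all unknown operators\<close>

lemma re_form_zero: "re_form I A (\<lambda>x. 0) v = 0"
  by (simp add: re_form_expand cinner_simps)

lemma re_form_scale_matrix: "re_form I (\<lambda>a b. of_real r * A a b) S v = r * re_form I A S v"
proof -
  have "(\<Sum>a\<in>I. \<Sum>b\<in>I. of_real r * A a b * cinner (v a) (S (v b))) =
      of_real r * (\<Sum>a\<in>I. \<Sum>b\<in>I. A a b * cinner (v a) (S (v b)))"
    by (simp add: sum_distrib_left mult.assoc)
  then show ?thesis by (simp only: re_form_expand Re_of_real_mult)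
qed

lemma re_form_add_matrix: "re_form I (\<lambda>a b. A a b + B a b) S v = re_form I A S v + re_form I B S v"
  by (simp add: re_form_expand distrib_right sum.distrib)

lemma re_form_combination:
  "re_form I (\<lambda>a b. \<Sum>i\<in>M. of_real (t i) * B i a b) S v = (\<Sum>i\<in>M. t i * re_form I (B i) S v)"
proof (induction M rule: infinite_finite_induct)
  case (insert i M)
  then show ?case
    by (simp add: re_form_add_matrix re_form_scale_matrix)
qed (simp_all add: re_form_expand)

lemma null_family_slice:
  assumes "null_family I B k vs"
  shows "null_family I B k (map (slice z) vs)"
proof -
  have "slice y (slice z v) = (\<lambda>a. cnj y * slice z v a)" for y :: complex and v
    by (simp add: slice_def cinner_complex_def fun_eq_iff)
  then show ?thesis
    using assms by (simp add: null_family_def o_def scalar_form_scale sum_list_const_mult)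
qed

lemma re_form_bound:
  assumes I: "finite I" and S: "\<And>x. norm (S x) \<le> K * norm x"
  shows "re_form I A S v \<le> (\<Sum>a\<in>I. \<Sum>b\<in>I. cmod (A a b) * K) * (\<Sum>a\<in>I. (norm (v a))\<^sup>2)"
proof -
  have K: "K * norm x \<ge> 0" for x :: 'a using S[of x] norm_ge_zero order_trans by blast
  let ?N = "\<Sum>a\<in>I. (norm (v a))\<^sup>2"
  have "Re (A a b * cinner (v a) (S (v b))) \<le> cmod (A a b) * K * ?N" if "a \<in> I" "b \<in> I" for a b
  proof -
    have "Re (A a b * cinner (v a) (S (v b))) \<le> cmod (A a b) * cmod (cinner (v a) (S (v b)))"
      using complex_Re_le_cmod[of "A a b * cinner (v a) (S (v b))"] by (simp add: norm_mult)
    also have "cmod (cinner (v a) (S (v b))) \<le> norm (v a) * (K * norm (v b))"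
      by (rule order_trans[OF norm_cinner_le mult_left_mono[OF S]]) simp
    also have "norm (v a) * (K * norm (v b)) \<le> K * ?N"
    proof (cases "K \<ge> 0")
      case True
      have "(norm (v a))\<^sup>2 \<le> ?N" "(norm (v b))\<^sup>2 \<le> ?N"
        using that I by (auto intro: member_le_sum)
      then have "norm (v a) * norm (v b) \<le> ?N"
        using sum_squares_bound[of "norm (v a)" "norm (v b)"] by linarith
      from mult_left_mono[OF this True] show ?thesis by (simp add: mult_ac)
    next
      case False
      then have "norm x = 0" for x :: 'a
        using K[of x] by (metis mult_neg_pos norm_le_zero_iff not_le zero_less_norm_iff norm_zero)
      then show ?thesis by (simp del: norm_eq_zero)
    qed
    finally show ?thesis by (simp add: mult_left_mono mult.assoc)
  qed
  then show ?thesis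
    unfolding re_form_expand Re_sum sum_distrib_right by (intro sum_mono) auto
qed

text \<open>The condition under which the unknowns \<open>S\<^sub>j\<close> can be eliminated one at a time. It excludes that
  \<open>B\<^sub>j\<close> is semidefinite and nonzero on the scalar families that are null for the earlier \<open>B\<^sub>i\<close>;
  then \<open>S\<^sub>j\<close> may have to be large depending on how strictly the other inequalities hold.\<close>

definition balanced :: "nat set \<Rightarrow> (nat \<Rightarrow> nat \<Rightarrow> nat \<Rightarrow> complex) \<Rightarrow> nat \<Rightarrow> bool"
  where "balanced I B k \<longleftrightarrow> (\<forall>j<k.
    (\<forall>ws :: (nat \<Rightarrow> complex) list. null_family I B j ws \<longrightarrow> (\<Sum>w\<leftarrow>ws. scalar_form I (B j) w) = 0) \<or>
    (\<exists>wp wn :: (nat \<Rightarrow> complex) list. null_family I B j wp \<and> null_family I B j wn \<and>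
      (\<Sum>w\<leftarrow>wp. scalar_form I (B j) w) > 0 \<and> (\<Sum>w\<leftarrow>wn. scalar_form I (B j) w) < 0))"

text \<open>In the first case of \<open>balanced\<close>, \<open>B\<^sub>j \<otimes> S\<^sub>j\<close> contributes nothing on null families, because
  their slices are null; in the second case \<open>S\<^sub>j\<close> can be eliminated.\<close>

lemma balanced_imp_operators:
  fixes F :: "(nat \<Rightarrow> 'h::complex_hilbert_space) \<Rightarrow> real"
  assumes I: "finite I" and "balanced I B k"
    and "\<And>t v. F (\<lambda>a. t *\<^sub>R v a) = t\<^sup>2 * F v"
    and "\<And>v. F v \<le> C * (\<Sum>a\<in>I. (norm (v a))\<^sup>2)"
    and "\<And>vs. null_family I B k vs \<Longrightarrow> 0 \<le> (\<Sum>v\<leftarrow>vs. F v)"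
  shows "\<exists>S. (\<forall>i<k. S i \<in> herm_ops) \<and>
    (\<forall>v. 0 \<le> F v + (\<Sum>i<k. re_form I (B i) (blinfun_apply (S i)) v))"
  using assms(2-)
proof (induction k arbitrary: F C)
  case 0
  have "0 \<le> F v" for v using 0(4)[of "[v]"] by (simp add: null_family_def)
  then show ?case by simp
next
  case (Suc k)
  have bal: "balanced I B k" using Suc.prems(1) by (simp add: balanced_def)
  consider (zero) "\<And>ws :: (nat \<Rightarrow> complex) list. null_family I B k ws \<Longrightarrow> (\<Sum>w\<leftarrow>ws. scalar_form I (B k) w) = 0"
    | (both) wp wn :: "(nat \<Rightarrow> complex) list" where "null_family I B k wp" "null_family I B k wn"
      "(\<Sum>w\<leftarrow>wp. scalar_form I (B k) w) > 0" "(\<Sum>w\<leftarrow>wn. scalar_form I (B k) w) < 0"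
    using Suc.prems(1) unfolding balanced_def by (metis lessI)
  then show ?case
  proof cases
    case zero
    have "null_family I B (Suc k) vs" if vs: "null_family I B k vs" for vs :: "(nat \<Rightarrow> 'h) list"
    proof -
      have "(\<Sum>v\<leftarrow>vs. scalar_form I (B k) (slice z v)) = 0" for z
        using zero[OF null_family_slice[OF vs, of z]] by (simp add: o_def)
      with vs show ?thesis by (auto simp: null_family_def less_Suc_eq)
    qed
    then obtain S where S: "\<forall>i<k. S i \<in> herm_ops"
      "\<forall>v. 0 \<le> F v + (\<Sum>i<k. re_form I (B i) (blinfun_apply (S i)) v)"
      using Suc.IH[OF bal Suc.prems(2,3)] Suc.prems(4) by metis
    let ?S = "S(k := 0)"
    have "(\<Sum>i<Suc k. re_form I (B i) (blinfun_apply (?S i)) v) =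
        (\<Sum>i<k. re_form I (B i) (blinfun_apply (S i)) v)" for v
      by (simp add: re_form_zero zero_blinfun.rep_eq)
    then have "(\<forall>i<Suc k. ?S i \<in> herm_ops) \<and>
        (\<forall>v. 0 \<le> F v + (\<Sum>i<Suc k. re_form I (B i) (blinfun_apply (?S i)) v))"
      using S by (auto simp: zero_herm_ops less_Suc_eq)
    then show ?thesis by blast
  next
    case both
    have tens: "map (\<lambda>w a. w a *\<^sub>C x) w \<in> {vs. null_family I B k vs}"
      if "w \<in> {wp, wn}" for w and x :: 'h
      using that both(1,2) null_family_tensor by auto
    have nn: "0 \<le> (\<Sum>v\<leftarrow>vs. F v)"
      if "vs \<in> {vs. null_family I B k vs}" "\<And>z. (\<Sum>v\<leftarrow>vs. scalar_form I (B k) (slice z v)) = 0"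
      for vs :: "(nat \<Rightarrow> 'h) list"
      using that by (intro Suc.prems(4)) (auto simp: null_family_def less_Suc_eq)
    obtain S0 where S0: "S0 \<in> herm_ops"
      "\<And>vs. vs \<in> {vs. null_family I B k vs} \<Longrightarrow>
        0 \<le> (\<Sum>v\<leftarrow>vs. F v + re_form I (B k) (blinfun_apply S0) v)"
      by (rule eliminate_operator[OF _ _ _ Suc.prems(2,3) nn tens both(3,4)])
        (auto simp: null_family_Nil intro: null_family_append null_family_scale)
    let ?F = "\<lambda>v. F v + re_form I (B k) (blinfun_apply S0) v"
    let ?C = "C + (\<Sum>a\<in>I. \<Sum>b\<in>I. cmod (B k a b) * norm S0)"
    have "\<exists>S. (\<forall>i<k. S i \<in> herm_ops) \<and>
        (\<forall>v. 0 \<le> ?F v + (\<Sum>i<k. re_form I (B i) (blinfun_apply (S i)) v))"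
    proof (rule Suc.IH[OF bal])
      show "?F (\<lambda>a. t *\<^sub>R v a) = t\<^sup>2 * ?F v" for t v
        by (simp add: Suc.prems(2) re_form_scaleR blinfun.scaleR_right algebra_simps)
      show "?F v \<le> ?C * (\<Sum>a\<in>I. (norm (v a))\<^sup>2)" for v
        using add_mono[OF Suc.prems(3)[of v] re_form_bound[OF I, of "blinfun_apply S0" "norm S0" "B k" v, OF norm_blinfun]]
        by (simp only: distrib_right)
      show "0 \<le> (\<Sum>v\<leftarrow>vs. ?F v)" if "null_family I B k vs" for vs
        using S0(2) that by simp
    qed
    then obtain S where S: "\<forall>i<k. S i \<in> herm_ops"
      "\<forall>v. 0 \<le> ?F v + (\<Sum>i<k. re_form I (B i) (blinfun_apply (S i)) v)" by blast
    let ?S = "S(k := S0)"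
    have "F v + (\<Sum>i<Suc k. re_form I (B i) (blinfun_apply (?S i)) v) =
        ?F v + (\<Sum>i<k. re_form I (B i) (blinfun_apply (S i)) v)" for v
      by simp
    then have "(\<forall>i<Suc k. ?S i \<in> herm_ops) \<and>
        (\<forall>v. 0 \<le> F v + (\<Sum>i<Suc k. re_form I (B i) (blinfun_apply (?S i)) v))"
      using S S0(1) by (auto simp: less_Suc_eq add_ac)
    then show ?thesis by blast
  qed
qed

text \<open>The first \<open>B\<^sub>j\<close> that violates balancedness is, up to sign, nonnegative on the scalar families
  null for the earlier ones. These earlier ones are balanced, so eliminating their unknowns over
  the Hilbert space \<open>\<complex>\<close>, with \<open>\<plusminus>B\<^sub>j\<close> as the given form, yields operators on \<open>\<complex>\<close>, which are real
  multipliers.\<close>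

lemma not_balanced_imp_psd_combination:
  assumes I: "finite I" and "\<not> balanced I B k"
  shows "\<exists>(t :: nat \<Rightarrow> real) (e :: nat \<Rightarrow> complex).
    (\<forall>w. 0 \<le> (\<Sum>i<k. t i * scalar_form I (B i) w)) \<and> (\<Sum>i<k. t i * scalar_form I (B i) e) > 0"
proof -
  define bad where "bad j \<longleftrightarrow> \<not> (
    (\<forall>ws :: (nat \<Rightarrow> complex) list. null_family I B j ws \<longrightarrow> (\<Sum>w\<leftarrow>ws. scalar_form I (B j) w) = 0) \<or>
    (\<exists>wp wn :: (nat \<Rightarrow> complex) list. null_family I B j wp \<and> null_family I B j wn \<and>
      (\<Sum>w\<leftarrow>wp. scalar_form I (B j) w) > 0 \<and> (\<Sum>w\<leftarrow>wn. scalar_form I (B j) w) < 0))" for j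
  obtain j0 where "j0 < k" "bad j0" using assms(2) unfolding balanced_def bad_def by blast
  define j where "j = (LEAST j. bad j)"
  have "bad j" unfolding j_def using \<open>bad j0\<close> by (rule LeastI)
  have "j < k" using Least_le[of bad, OF \<open>bad j0\<close>] \<open>j0 < k\<close> by (simp add: j_def)
  have "balanced I B j"
  proof -
    have "\<not> bad i" if "i < j" for i using not_less_Least[of i bad] that by (simp add: j_def)
    then show ?thesis unfolding balanced_def bad_def by blast
  qed
  from \<open>bad j\<close> obtain ws :: "(nat \<Rightarrow> complex) list"
    where ws: "null_family I B j ws" "(\<Sum>w\<leftarrow>ws. scalar_form I (B j) w) \<noteq> 0"
    unfolding bad_def by blast
  define \<sigma> where "\<sigma> = sgn (\<Sum>w\<leftarrow>ws. scalar_form I (B j) w)"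
  have \<sigma>: "\<sigma> * (\<Sum>w\<leftarrow>ws. scalar_form I (B j) w) > 0"
    using ws(2) by (simp add: \<sigma>_def sgn_mult_self_eq flip: abs_sgn)
      (simp add: abs_sgn mult.commute flip: abs_sgn)
  have nonneg: "0 \<le> (\<Sum>v\<leftarrow>vs. \<sigma> * scalar_form I (B j) v)"
    if "null_family I B j vs" for vs :: "(nat \<Rightarrow> complex) list"
  proof (rule ccontr)
    assume "\<not> ?thesis"
    then have "\<sigma> * (\<Sum>v\<leftarrow>vs. scalar_form I (B j) v) < 0" by (simp add: sum_list_const_mult)
    with \<sigma> have "(\<Sum>v\<leftarrow>vs. scalar_form I (B j) v) * (\<Sum>w\<leftarrow>ws. scalar_form I (B j) w) < 0"
      unfolding mult_less_0_iff zero_less_mult_iff by linarith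
    with that ws(1) \<open>bad j\<close> show False
      unfolding bad_def mult_less_0_iff by blast
  qed
  have "\<exists>S :: nat \<Rightarrow> complex \<Rightarrow>\<^sub>L complex. (\<forall>i<j. S i \<in> herm_ops) \<and>
    (\<forall>v. 0 \<le> \<sigma> * scalar_form I (B j) v + (\<Sum>i<j. re_form I (B i) (blinfun_apply (S i)) v))"
  proof (rule balanced_imp_operators[OF I \<open>balanced I B j\<close>])
    show "\<sigma> * scalar_form I (B j) (\<lambda>a. t *\<^sub>R v a) = t\<^sup>2 * (\<sigma> * scalar_form I (B j) v)" for t v
      by (simp add: re_form_scaleR)
    show "\<sigma> * scalar_form I (B j) v \<le> (\<Sum>a\<in>I. \<Sum>b\<in>I. cmod (\<sigma> * B j a b) * 1) * (\<Sum>a\<in>I. (norm (v a))\<^sup>2)" for v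
    proof -
      show ?thesis
        using re_form_bound[OF I, of "\<lambda>x. x" 1 "\<lambda>a b. of_real \<sigma> * B j a b" v]
        by (simp add: re_form_scale_matrix)
    qed
  qed (rule nonneg)
  then obtain S :: "nat \<Rightarrow> complex \<Rightarrow>\<^sub>L complex" where S: "\<And>i. i < j \<Longrightarrow> S i \<in> herm_ops"
    "\<And>v. 0 \<le> \<sigma> * scalar_form I (B j) v + (\<Sum>i<j. re_form I (B i) (blinfun_apply (S i)) v)" by blast
  define t where "t i = (if i < j then Re (blinfun_apply (S i) 1) else if i = j then \<sigma> else 0)" for i
  have S_eq: "re_form I (B i) (blinfun_apply (S i)) v = t i * scalar_form I (B i) v" if "i < j" for i v
  proof -
    have "cinner (blinfun_apply (S i) 1) 1 = cinner 1 (blinfun_apply (S i) 1)"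
      using S(1)[OF that] by (rule herm_opsD)
    then have "Im (blinfun_apply (S i) 1) = 0" by (simp add: cinner_complex_def complex_eq_iff)
    then have one: "blinfun_apply (S i) 1 = of_real (t i)"
      using that by (simp add: t_def complex_eq_iff)
    have "blinfun_apply (S i) x = of_real (t i) * x" for x
      using herm_opsD(1)[OF S(1)[OF that], of x 1] one by (simp add: scaleC_complex_def)
    then have "re_form I (B i) (blinfun_apply (S i)) v = scalar_form I (\<lambda>a b. of_real (t i) * B i a b) v"
      by (simp add: re_form_expand cinner_complex_def mult_ac)
    then show ?thesis by (simp only: re_form_scale_matrix)
  qed
  have split: "(\<Sum>i<k. t i * scalar_form I (B i) w) = \<sigma> * scalar_form I (B j) w + (\<Sum>i<j. t i * scalar_form I (B i) w)" for w
  proof -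
    have "(\<Sum>i<k. t i * scalar_form I (B i) w) = (\<Sum>i<Suc j. t i * scalar_form I (B i) w)"
      using \<open>j < k\<close> by (intro sum.mono_neutral_right) (auto simp: t_def)
    then show ?thesis by (simp add: t_def)
  qed
  have "0 \<le> (\<Sum>i<k. t i * scalar_form I (B i) w)" for w
    unfolding split using S(2)[of w] S_eq by simp
  moreover have "\<exists>e. (\<Sum>i<k. t i * scalar_form I (B i) e) > 0"
  proof (rule ccontr)
    assume "\<not> ?thesis"
    then have "(\<Sum>w\<leftarrow>ws. \<Sum>i<k. t i * scalar_form I (B i) w) \<le> 0"
      by (intro sum_list_nonpos) (auto simp: not_less)
    moreover have "(\<Sum>w\<leftarrow>ws. \<Sum>i<k. t i * scalar_form I (B i) w) =
        \<sigma> * (\<Sum>w\<leftarrow>ws. scalar_form I (B j) w) + (\<Sum>i<j. t i * (\<Sum>w\<leftarrow>ws. scalar_form I (B i) w))"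
      unfolding split by (induction ws) (simp_all add: sum.distrib algebra_simps)
    moreover have "(\<Sum>w\<leftarrow>ws. scalar_form I (B i) w) = 0" if "i < j" for i
      using ws(1) that by (rule null_family_scalarD)
    ultimately show False using \<sigma> by simp
  qed
  ultimately show ?thesis by blast
qed

section \<open>Orthonormalisation for a degenerate inner product\<close>

text \<open>Gram-Schmidt for a positive semidefinite form \<open>h\<close>: the given vectors are recovered only up
  to vectors of length zero.\<close>

lemma gram_schmidt_semidefinite:
  fixes h :: "'h::complex_hilbert_space \<Rightarrow> 'h \<Rightarrow> complex" and x :: "nat \<Rightarrow> 'h"
  assumes add: "\<And>x y z. h x (y + z) = h x y + h x z"
    and scale: "\<And>c x y. h x (c *\<^sub>C y) = c * h x y"
    and herm: "\<And>x y. h x y = cnj (h y x)"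
    and nonneg: "\<And>x. Re (h x x) \<ge> 0"
    and null: "\<And>x y. h y y = 0 \<Longrightarrow> h x y = 0"
  shows "\<exists>(r::nat) z. (\<forall>l<r. \<forall>m<r. h (z l) (z m) = (if l = m then 1 else 0)) \<and>
    (\<forall>k<n. h (x k - (\<Sum>l<r. h (z l) (x k) *\<^sub>C z l)) (x k - (\<Sum>l<r. h (z l) (x k) *\<^sub>C z l)) = 0)"
proof (induction n)
  case 0
  show ?case by (rule exI[of _ "0::nat"]) simp
next
  case (Suc n)
  have zero: "h x 0 = 0" for x using scale[of x 0 0] by (simp add: scaleC_0_left)
  have diff: "h x (y - z) = h x y - h x z" for x y z
    using add[of x "y - z" z] by simp
  have sum: "h x (\<Sum>l\<in>A. f l) = (\<Sum>l\<in>A. h x (f l))" for x f and A :: "nat set"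
    by (induction A rule: infinite_finite_induct) (simp_all add: zero add)
  have scale_l: "h (c *\<^sub>C x) y = cnj c * h x y" for c x y
    by (metis complex_cnj_mult herm scale)
  obtain r :: nat and z where orth: "\<And>l m. l < r \<Longrightarrow> m < r \<Longrightarrow> h (z l) (z m) = (if l = m then 1 else 0)"
    and res: "\<And>k. k < n \<Longrightarrow> h (x k - (\<Sum>l<r. h (z l) (x k) *\<^sub>C z l)) (x k - (\<Sum>l<r. h (z l) (x k) *\<^sub>C z l)) = 0"
    using Suc by blast
  define y where "y k = x k - (\<Sum>l<r. h (z l) (x k) *\<^sub>C z l)" for k
  show ?case
  proof (cases "h (y n) (y n) = 0")
    case True
    then show ?thesis
      using orth res by (intro exI[of _ r] exI[of _ z]) (auto simp: less_Suc_eq y_def)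
  next
    case False
    define q where "q = Re (h (y n) (y n))"
    have "Im (h (y n) (y n)) = 0" using arg_cong[OF herm[of "y n" "y n"], of Im] by simp
    then have q: "h (y n) (y n) = of_real q" by (simp add: q_def complex_eq_iff)
    have "q \<ge> 0" unfolding q_def by (rule nonneg)
    moreover have "q \<noteq> 0" using False q by auto
    ultimately have "q > 0" by simp
    define c where "c = complex_of_real (1 / sqrt q)"
    have "1 / sqrt q * (1 / sqrt q) * q = 1" using \<open>q > 0\<close> by simp
    then have "complex_of_real (1 / sqrt q * (1 / sqrt q) * q) = 1" by simp
    then have cc: "c * c * of_real q = 1" unfolding c_def of_real_mult .
    have cnj_c: "cnj c = c" by (simp add: c_def)
    define z' where "z' = z(r := c *\<^sub>C y n)"
    have y_orth: "h (z l) (y k) = 0" if "l < r" for l k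
      using that by (simp add: y_def diff sum scale orth if_distrib[of "(*) _"] cong: if_cong)
    have y_orth': "h (y k) (z l) = 0" if "l < r" for l k
      using y_orth[OF that, of k] herm[of "y k" "z l"] by simp
    have "h (z' l) (z' m) = (if l = m then 1 else 0)" if "l < Suc r" "m < Suc r" for l m
      using that cc cnj_c by (auto simp: z'_def less_Suc_eq orth y_orth y_orth' scale scale_l q mult.assoc)
    moreover have "h (x k - (\<Sum>l<Suc r. h (z' l) (x k) *\<^sub>C z' l)) (x k - (\<Sum>l<Suc r. h (z' l) (x k) *\<^sub>C z' l)) = 0"
      if "k < Suc n" for k
    proof -
      have res': "x k - (\<Sum>l<Suc r. h (z' l) (x k) *\<^sub>C z' l) = y k - (c * h (y n) (x k)) *\<^sub>C c *\<^sub>C y n"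
        by (simp add: z'_def y_def scale_l cnj_c)
      have "x k = y k + (\<Sum>l<r. h (z l) (x k) *\<^sub>C z l)" by (simp add: y_def)
      then have "h (y n) (x k) = h (y n) (y k) + h (y n) (\<Sum>l<r. h (z l) (x k) *\<^sub>C z l)"
        by (metis add)
      then have yx: "h (y n) (x k) = h (y n) (y k)"
        by (simp add: sum scale y_orth')
      show ?thesis
      proof (cases "k = n")
        case True
        have "(c * h (y n) (x k)) *\<^sub>C c *\<^sub>C y n = y n"
          using cc(1) True yx by (simp add: scaleC_scaleC q mult_ac scaleC_one)
        then show ?thesis unfolding res' by (simp add: True zero)
      next
        case False
        then have "h (y k) (y k) = 0" using res[of k] that by (simp add: y_def)
        with null yx have "h (y n) (x k) = 0" by simp
        then show ?thesis unfolding res' using \<open>h (y k) (y k) = 0\<close> by (simp add: scaleC_0_left)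
      qed
    qed
    ultimately show ?thesis by blast
  qed
qed

lemma finite_family_orthonormal_expansion:
  fixes v :: "nat \<Rightarrow> 'h::complex_hilbert_space"
  shows "\<exists>(r::nat) z. (\<forall>l<r. \<forall>m<r. cinner (z l) (z m) = (if l = m then 1 else 0)) \<and>
    (\<forall>k<n. v k = (\<Sum>l<r. cinner (z l) (v k) *\<^sub>C z l))"
proof -
  have "\<exists>(r::nat) z. (\<forall>l<r. \<forall>m<r. cinner (z l) (z m) = (if l = m then 1 else 0)) \<and>
    (\<forall>k<n. cinner (v k - (\<Sum>l<r. cinner (z l) (v k) *\<^sub>C z l)) (v k - (\<Sum>l<r. cinner (z l) (v k) *\<^sub>C z l)) = 0)"
  proof (rule gram_schmidt_semidefinite)
    show "cinner x y = cnj (cinner y x)" for x y :: 'h by (rule cinner_commute)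
    show "0 \<le> Re (cinner x x)" for x :: 'h by (simp add: cinner_self)
    show "cinner x y = 0" if "cinner y y = 0" for x y :: 'h
      using cinner_self_eq_0[OF that] by (simp add: cinner_simps)
  qed (simp_all add: cinner_simps)
  then obtain r :: nat and z where
    orth: "\<forall>l<r. \<forall>m<r. cinner (z l) (z m) = (if l = m then 1 else 0)"
    and res: "\<forall>k<n. cinner (v k - (\<Sum>l<r. cinner (z l) (v k) *\<^sub>C z l))
      (v k - (\<Sum>l<r. cinner (z l) (v k) *\<^sub>C z l)) = 0" by blast
  have "v k = (\<Sum>l<r. cinner (z l) (v k) *\<^sub>C z l)" if "k < n" for k
  proof -
    have "v k - (\<Sum>l<r. cinner (z l) (v k) *\<^sub>C z l) = 0"
      by (rule cinner_self_eq_0) (use res that in blast)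
    then show ?thesis unfolding right_minus_eq .
  qed
  with orth show ?thesis by blast
qed

text \<open>Expanding in an orthonormal basis reduces the claim to scalar vectors.\<close>

lemma psd_amplification:
  fixes u :: "nat \<Rightarrow> 'h::complex_hilbert_space"
  assumes I: "finite I" and psd: "\<And>w. 0 \<le> scalar_form I P w"
  shows "0 \<le> re_form I P (\<lambda>x. x) u"
proof -
  obtain n where n: "I \<subseteq> {..<n}" using finite_nat_iff_bounded I by blast
  obtain r :: nat and z where exp: "\<forall>k<n. u k = (\<Sum>l<r. cinner (z l) (u k) *\<^sub>C z l)"
    using finite_family_orthonormal_expansion[of n u] by blast
  have "cinner (u a) (u b) = (\<Sum>l<r. cnj (slice (z l) u a) * slice (z l) u b)"
    if "a \<in> I" for a b
  proof -
    have "a < n" using that n by auto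
    have "cinner (u a) (u b) = cinner (\<Sum>l<r. cinner (z l) (u a) *\<^sub>C z l) (u b)"
      using exp \<open>a < n\<close> by metis
    then show ?thesis by (simp add: cinner_sum_left cinner_simps slice_def)
  qed
  then have "re_form I P (\<lambda>x. x) u = Re (\<Sum>a\<in>I. \<Sum>b\<in>I. \<Sum>l<r. P a b * (cnj (slice (z l) u a) * slice (z l) u b))"
    by (simp add: re_form_expand sum_distrib_left)
  also have "(\<Sum>a\<in>I. \<Sum>b\<in>I. \<Sum>l<r. P a b * (cnj (slice (z l) u a) * slice (z l) u b)) =
      (\<Sum>l<r. \<Sum>a\<in>I. \<Sum>b\<in>I. P a b * cnj (slice (z l) u a) * slice (z l) u b)"
    by (simp add: sum.swap[of _ "{..<r}"] mult.assoc)
  also have "Re \<dots> = (\<Sum>l<r. scalar_form I P (slice (z l) u))" by (simp only: Re_sum scalar_form_eq)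
  also have "\<dots> \<ge> 0" by (intro sum_nonneg psd)
  finally show ?thesis .
qed

section \<open>Bounded quadratic functions\<close>

definition fnorm :: "nat set \<Rightarrow> (nat \<Rightarrow> 'h::complex_hilbert_space) \<Rightarrow> real"
  where "fnorm I v = L2_set (\<lambda>a. norm (v a)) I"

lemma fnorm_square: "(fnorm I v)\<^sup>2 = (\<Sum>a\<in>I. (norm (v a))\<^sup>2)"
  by (simp add: fnorm_def L2_set_def sum_nonneg)

lemma fnorm_nonneg: "0 \<le> fnorm I v"
  by (simp add: fnorm_def L2_set_nonneg)

lemma norm_le_fnorm: "finite I \<Longrightarrow> a \<in> I \<Longrightarrow> norm (v a) \<le> fnorm I v"
  unfolding fnorm_def by (rule member_le_L2_set) auto

lemma fnorm_triangle: "fnorm I (\<lambda>a. u a + v a) \<le> fnorm I u + fnorm I v"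
proof -
  have "fnorm I (\<lambda>a. u a + v a) \<le> L2_set (\<lambda>a. norm (u a) + norm (v a)) I"
    unfolding fnorm_def by (rule L2_set_mono) (auto intro: norm_triangle_ineq)
  also have "\<dots> \<le> fnorm I u + fnorm I v"
    unfolding fnorm_def by (rule L2_set_triangle_ineq)
  finally show ?thesis .
qed

lemma fnorm_tensor: "fnorm I (\<lambda>a. e a *\<^sub>C h) = L2_set (\<lambda>a. cmod (e a)) I * norm h"
  by (simp add: fnorm_def norm_scaleC L2_set_left_distrib)

text \<open>The properties of \<open>v \<mapsto> \<langle>v, X v\<rangle>\<close>, for \<open>X\<close> a bounded Hermitian operator, on which the reduction of
  the matrix size rests. They survive substitutions \<open>v = (Q \<otimes> 1) u\<close> and sums, so that \<open>X\<close>
  itself never has to be rewritten.\<close>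

definition quad_like :: "nat set \<Rightarrow> ((nat \<Rightarrow> 'h::complex_hilbert_space) \<Rightarrow> real) \<Rightarrow> real \<Rightarrow> bool"
  where "quad_like I F C \<longleftrightarrow> (\<forall>t v. F (\<lambda>a. t *\<^sub>R v a) = t\<^sup>2 * F v) \<and>
    (\<forall>u v. \<bar>F (\<lambda>a. v a + u a) - F v\<bar> \<le> C * (fnorm I u * (fnorm I u + fnorm I v)))"

lemma quad_like_scale: "quad_like I F C \<Longrightarrow> F (\<lambda>a. t *\<^sub>R v a) = t\<^sup>2 * F v"
  by (simp add: quad_like_def)

lemma quad_like_diff:
  "quad_like I F C \<Longrightarrow> \<bar>F (\<lambda>a. v a + u a) - F v\<bar> \<le> C * (fnorm I u * (fnorm I u + fnorm I v))"
  by (simp add: quad_like_def)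

lemma quad_like_bound:
  assumes "quad_like I F C"
  shows "F v \<le> C * (fnorm I v)\<^sup>2"
proof -
  have "F (\<lambda>a. 0 *\<^sub>R v a) = 0\<^sup>2 * F v" using assms by (rule quad_like_scale)
  then have 0: "F (\<lambda>a. 0) = 0" by simp
  have "\<bar>F (\<lambda>a. 0 + v a) - F (\<lambda>a. 0)\<bar> \<le> C * (fnorm I v * (fnorm I v + fnorm I (\<lambda>a. 0 :: 'a)))"
    using assms by (rule quad_like_diff)
  moreover have "fnorm I (\<lambda>a. 0 :: 'a) = 0" by (simp add: fnorm_def L2_set_def)
  ultimately show ?thesis by (simp add: 0 power2_eq_square)
qed

lemma quad_like_add:
  assumes "quad_like I F C" "quad_like I G D"
  shows "quad_like I (\<lambda>v. F v + G v) (C + D)"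
proof -
  have "\<bar>(F (\<lambda>a. v a + u a) + G (\<lambda>a. v a + u a)) - (F v + G v)\<bar> \<le>
      (C + D) * (fnorm I u * (fnorm I u + fnorm I v))" for u v
  proof -
    have "\<bar>F (\<lambda>a. v a + u a) - F v\<bar> \<le> C * (fnorm I u * (fnorm I u + fnorm I v))"
      "\<bar>G (\<lambda>a. v a + u a) - G v\<bar> \<le> D * (fnorm I u * (fnorm I u + fnorm I v))"
      using assms by (auto intro: quad_like_diff)
    then show ?thesis unfolding distrib_right by linarith
  qed
  moreover have "F (\<lambda>a. t *\<^sub>R v a) + G (\<lambda>a. t *\<^sub>R v a) = t\<^sup>2 * (F v + G v)" for t v
    using quad_like_scale[OF assms(1)] quad_like_scale[OF assms(2)] by (simp add: algebra_simps)
  ultimately show ?thesis by (simp add: quad_like_def)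
qed

lemma quad_like_abs:
  assumes "quad_like I F C"
  shows "quad_like I F \<bar>C\<bar>"
proof -
  have "C * (fnorm I u * (fnorm I u + fnorm I v)) \<le> \<bar>C\<bar> * (fnorm I u * (fnorm I u + fnorm I v))"
    for u v :: "nat \<Rightarrow> 'a"
    by (intro mult_right_mono) (simp_all add: fnorm_nonneg)
  then show ?thesis using assms unfolding quad_like_def by (meson order_trans)
qed

lemma sesquilinear_sum_bound:
  fixes X :: "nat \<Rightarrow> nat \<Rightarrow> 'h::complex_hilbert_space \<Rightarrow> 'h"
  assumes I: "finite I" and K: "\<And>a b x. norm (X a b x) \<le> K a b * norm x"
  shows "\<bar>Re (\<Sum>a\<in>I. \<Sum>b\<in>I. cinner (u a) (X a b (v b)))\<bar> \<le>
    (\<Sum>a\<in>I. \<Sum>b\<in>I. \<bar>K a b\<bar>) * (fnorm I u * fnorm I v)"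
proof -
  have *: "\<bar>Re (cinner (u a) (X a b (v b)))\<bar> \<le> \<bar>K a b\<bar> * (fnorm I u * fnorm I v)"
    if "a \<in> I" "b \<in> I" for a b
  proof -
    have "\<bar>Re (cinner (u a) (X a b (v b)))\<bar> \<le> cmod (cinner (u a) (X a b (v b)))"
      by (rule abs_Re_le_cmod)
    also have "\<dots> \<le> norm (u a) * norm (X a b (v b))" by (rule norm_cinner_le)
    also have "\<dots> \<le> fnorm I u * (\<bar>K a b\<bar> * fnorm I v)"
    proof (rule mult_mono)
      have "K a b * norm (v b) \<le> \<bar>K a b\<bar> * fnorm I v"
        using norm_le_fnorm[OF I that(2), of v] by (intro mult_mono) auto
      then show "norm (X a b (v b)) \<le> \<bar>K a b\<bar> * fnorm I v"
        using K[of a b "v b"] by linarith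
    qed (use norm_le_fnorm[OF I that(1), of u] in \<open>auto simp: fnorm_nonneg\<close>)
    finally show ?thesis by (simp add: mult_ac)
  qed
  have "\<bar>Re (\<Sum>a\<in>I. \<Sum>b\<in>I. cinner (u a) (X a b (v b)))\<bar> \<le>
      (\<Sum>a\<in>I. \<bar>\<Sum>b\<in>I. Re (cinner (u a) (X a b (v b)))\<bar>)"
    unfolding Re_sum by (rule sum_abs)
  also have "\<dots> \<le> (\<Sum>a\<in>I. \<Sum>b\<in>I. \<bar>Re (cinner (u a) (X a b (v b)))\<bar>)"
    by (intro sum_mono sum_abs)
  also have "\<dots> \<le> (\<Sum>a\<in>I. \<Sum>b\<in>I. \<bar>K a b\<bar> * (fnorm I u * fnorm I v))"
    by (intro sum_mono *)
  finally show ?thesis by (simp add: sum_distrib_right)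
qed

lemma quad_like_operator_matrix:
  fixes X :: "nat \<Rightarrow> nat \<Rightarrow> 'h::complex_hilbert_space \<Rightarrow> 'h"
  assumes I: "finite I" and K: "\<And>a b x. norm (X a b x) \<le> K a b * norm x"
    and add: "\<And>a b x y. X a b (x + y) = X a b x + X a b y"
    and scale: "\<And>a b c x. X a b (c *\<^sub>R x) = c *\<^sub>R X a b x"
  shows "quad_like I (\<lambda>v. Re (\<Sum>a\<in>I. \<Sum>b\<in>I. cinner (v a) (X a b (v b))))
    (2 * (\<Sum>a\<in>I. \<Sum>b\<in>I. \<bar>K a b\<bar>))"
proof -
  define b where "b u v = Re (\<Sum>a\<in>I. \<Sum>b\<in>I. cinner (u a) (X a b (v b)))" for u v
  let ?K = "\<Sum>a\<in>I. \<Sum>b\<in>I. \<bar>K a b\<bar>"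
  have bound: "\<bar>b u v\<bar> \<le> ?K * (fnorm I u * fnorm I v)" for u v
    unfolding b_def by (rule sesquilinear_sum_bound[OF I K])
  have expand: "b (\<lambda>a. v a + u a) (\<lambda>a. v a + u a) = b v v + b v u + b u v + b u u" for u v
    by (simp add: b_def add cinner_simps sum.distrib)
  have "\<bar>b (\<lambda>a. v a + u a) (\<lambda>a. v a + u a) - b v v\<bar> \<le>
      2 * ?K * (fnorm I u * (fnorm I u + fnorm I v))" for u v
  proof -
    have "0 \<le> ?K * (fnorm I u * fnorm I u)"
      by (intro mult_nonneg_nonneg sum_nonneg) (simp_all add: fnorm_nonneg)
    moreover have "2 * ?K * (fnorm I u * (fnorm I u + fnorm I v)) =
        2 * (?K * (fnorm I u * fnorm I u)) + ?K * (fnorm I u * fnorm I v) + ?K * (fnorm I v * fnorm I u)"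
      by (simp add: algebra_simps)
    ultimately show ?thesis
      using bound[of v u] bound[of u v] bound[of u u] unfolding expand by linarith
  qed
  moreover have "b (\<lambda>a. t *\<^sub>R v a) (\<lambda>a. t *\<^sub>R v a) = t\<^sup>2 * b v v" for t v
  proof -
    have "(\<Sum>a\<in>I. \<Sum>b\<in>I. cinner (t *\<^sub>R v a) (X a b (t *\<^sub>R v b))) =
        of_real (t\<^sup>2) * (\<Sum>a\<in>I. \<Sum>b\<in>I. cinner (v a) (X a b (v b)))"
      by (simp add: scale cinner_simps sum_distrib_left power2_eq_square mult_ac)
    then show ?thesis unfolding b_def by (simp only: Re_of_real_mult)
  qed
  ultimately have "quad_like I (\<lambda>v. b v v) (2 * ?K)" by (simp add: quad_like_def)
  then show ?thesis by (simp add: b_def)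
qed

lemma quad_like_re_form:
  assumes I: "finite I"
  shows "\<exists>C. quad_like I (re_form I A (blinfun_apply S)) C"
proof -
  have "quad_like I (\<lambda>v. Re (\<Sum>a\<in>I. \<Sum>b\<in>I. cinner (v a) (A a b *\<^sub>C blinfun_apply S (v b))))
      (2 * (\<Sum>a\<in>I. \<Sum>b\<in>I. \<bar>cmod (A a b) * norm S\<bar>))"
  proof (rule quad_like_operator_matrix[OF I])
    show "norm (A a b *\<^sub>C blinfun_apply S x) \<le> cmod (A a b) * norm S * norm x" for a b x
      using mult_left_mono[OF norm_blinfun[of S x], of "cmod (A a b)"]
      by (simp add: norm_scaleC mult.assoc)
    show "A a b *\<^sub>C blinfun_apply S (c *\<^sub>R x) = c *\<^sub>R A a b *\<^sub>C blinfun_apply S x" for a b c x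
      by (subst blinfun.scaleR_right) (simp add: scaleR_eq_scaleC scaleC_scaleC mult.commute)
  qed (simp add: blinfun.add_right scaleC_add_right)
  moreover have "re_form I A (blinfun_apply S) =
      (\<lambda>v. Re (\<Sum>a\<in>I. \<Sum>b\<in>I. cinner (v a) (A a b *\<^sub>C blinfun_apply S (v b))))"
    by (simp add: fun_eq_iff re_form_expand cinner_simps)
  ultimately show ?thesis by auto
qed

lemma quad_like_sum_re_form:
  fixes k :: nat
  assumes I: "finite I"
  shows "\<exists>C. quad_like I (\<lambda>v. \<Sum>i<k. re_form I (B i) (blinfun_apply (S i)) v) C"
proof (induction k)
  case 0
  show ?case by (rule exI[of _ 0]) (simp add: quad_like_def)
next
  case (Suc k)
  then obtain C where "quad_like I (\<lambda>v. \<Sum>i<k. re_form I (B i) (blinfun_apply (S i)) v) C" ..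
  moreover obtain D where "quad_like I (re_form I (B k) (blinfun_apply (S k))) D"
    using quad_like_re_form[OF I] by blast
  ultimately show ?case using quad_like_add by fastforce
qed

section \<open>Change of coordinates in the matrix factor\<close>

text \<open>The vector \<open>(Q \<otimes> 1) u\<close>.\<close>

definition lift :: "nat set \<Rightarrow> (nat \<Rightarrow> nat \<Rightarrow> complex) \<Rightarrow> (nat \<Rightarrow> 'h::complex_hilbert_space) \<Rightarrow> nat \<Rightarrow> 'h"
  where "lift J Q u a = (\<Sum>l\<in>J. Q a l *\<^sub>C u l)"

definition congruence ::
    "nat set \<Rightarrow> (nat \<Rightarrow> nat \<Rightarrow> complex) \<Rightarrow> (nat \<Rightarrow> nat \<Rightarrow> complex) \<Rightarrow> nat \<Rightarrow> nat \<Rightarrow> complex"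
  where "congruence I Q A l m = (\<Sum>a\<in>I. \<Sum>b\<in>I. cnj (Q a l) * A a b * Q b m)"

lemma tensor_form_lift:
  fixes S :: "'h::complex_hilbert_space \<Rightarrow>\<^sub>L 'h"
  assumes "\<And>c x. blinfun_apply S (c *\<^sub>C x) = c *\<^sub>C blinfun_apply S x"
  shows "tensor_form I A (blinfun_apply S) (lift J Q u) = tensor_form J (congruence I Q A) (blinfun_apply S) u"
proof -
  have S: "blinfun_apply S (lift J Q u b) = (\<Sum>m\<in>J. Q b m *\<^sub>C blinfun_apply S (u m))" for b
    by (simp add: lift_def blinfun.sum_right assms)
  have "tensor_form I A (blinfun_apply S) (lift J Q u) =
      (\<Sum>a\<in>I. \<Sum>b\<in>I. \<Sum>l\<in>J. \<Sum>m\<in>J. cnj (Q a l) * A a b * Q b m * cinner (u l) (blinfun_apply S (u m)))"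
    unfolding tensor_form_def S unfolding lift_def cinner_sum_left unfolding cinner_sum_right sum_distrib_left
    by (simp add: cinner_simps mult_ac)
  also have "\<dots> = (\<Sum>l\<in>J. \<Sum>m\<in>J. \<Sum>a\<in>I. \<Sum>b\<in>I. cnj (Q a l) * A a b * Q b m * cinner (u l) (blinfun_apply S (u m)))"
    by (simp only: sum.swap[where A = I and B = J])
  also have "\<dots> = tensor_form J (congruence I Q A) (blinfun_apply S) u"
    by (simp add: tensor_form_def congruence_def sum_distrib_right)
  finally show ?thesis .
qed

lemma re_form_lift:
  assumes "S \<in> herm_ops"
  shows "re_form I A (blinfun_apply S) (lift J Q u) = re_form J (congruence I Q A) (blinfun_apply S) u"
  unfolding re_form_def using herm_opsD(1)[OF assms] by (simp add: tensor_form_lift)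

lemma re_form_id_lift: "re_form I A (\<lambda>x. x) (lift J Q u) = re_form J (congruence I Q A) (\<lambda>x. x) u"
  using re_form_lift[OF scaleR_id_herm_ops[of 1], of I A J Q u] by simp

lemma slice_lift: "slice z (lift J Q u) = lift J Q (slice z u)"
  by (simp add: fun_eq_iff slice_def lift_def cinner_sum_right cinner_simps scaleC_complex_def)

lemma null_family_lift:
  assumes "null_family J (\<lambda>i. congruence I Q (B i)) k us"
  shows "null_family I B k (map (lift J Q) us)"
  using assms by (simp add: null_family_def o_def slice_lift re_form_id_lift)

lemma congruence_hermitian:
  assumes "\<And>a b. a \<in> I \<Longrightarrow> b \<in> I \<Longrightarrow> A b a = cnj (A a b)"
  shows "congruence I Q A m l = cnj (congruence I Q A l m)"
proof -
  have "congruence I Q A m l = (\<Sum>b\<in>I. \<Sum>a\<in>I. cnj (Q b m) * A b a * Q a l)"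
    by (simp add: congruence_def)
  also have "\<dots> = (\<Sum>b\<in>I. \<Sum>a\<in>I. cnj (cnj (Q a l) * A a b * Q b m))"
  proof (intro sum.cong refl)
    fix a b assume "b \<in> I" "a \<in> I"
    from assms[OF this(2,1)]
    show "cnj (Q b m) * A b a * Q a l = cnj (cnj (Q a l) * A a b * Q b m)" by (simp add: mult_ac)
  qed
  also have "\<dots> = cnj (congruence I Q A l m)"
    unfolding congruence_def cnj_sum by (rule sum.swap)
  finally show ?thesis .
qed

lemma lift_add: "lift J Q (\<lambda>l. u l + v l) = (\<lambda>a. lift J Q u a + lift J Q v a)"
  by (simp add: fun_eq_iff lift_def scaleC_add_right sum.distrib)

lemma lift_scaleR: "lift J Q (\<lambda>l. t *\<^sub>R u l) = (\<lambda>a. t *\<^sub>R lift J Q u a)"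
  by (simp add: fun_eq_iff lift_def scaleR_eq_scaleC scaleC_sum_right scaleC_scaleC mult.commute)

lemma fnorm_lift_le:
  fixes u :: "nat \<Rightarrow> 'h::complex_hilbert_space"
  assumes "finite I" "finite J"
  shows "fnorm I (lift J Q u) \<le> (\<Sum>a\<in>I. \<Sum>l\<in>J. cmod (Q a l)) * fnorm J u"
proof -
  have "fnorm I (lift J Q u) \<le> (\<Sum>a\<in>I. norm (lift J Q u a))"
    unfolding fnorm_def by (rule L2_set_le_sum) simp
  also have "\<dots> \<le> (\<Sum>a\<in>I. \<Sum>l\<in>J. cmod (Q a l) * fnorm J u)"
  proof (rule sum_mono)
    fix a
    have "norm (lift J Q u a) \<le> (\<Sum>l\<in>J. norm (Q a l *\<^sub>C u l))"
      unfolding lift_def by (rule norm_sum)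
    also have "\<dots> \<le> (\<Sum>l\<in>J. cmod (Q a l) * fnorm J u)"
      by (rule sum_mono) (simp add: norm_scaleC mult_left_mono norm_le_fnorm assms)
    finally show "norm (lift J Q u a) \<le> (\<Sum>l\<in>J. cmod (Q a l) * fnorm J u)" .
  qed
  finally show ?thesis by (simp add: sum_distrib_right)
qed

lemma quad_like_lift:
  assumes "finite I" "finite J" and F: "quad_like I F C"
  shows "\<exists>D. quad_like J (\<lambda>u. F (lift J Q u)) D"
proof -
  define K where "K = (\<Sum>a\<in>I. \<Sum>l\<in>J. cmod (Q a l))"
  have K: "fnorm I (lift J Q u) \<le> K * fnorm J u" for u :: "nat \<Rightarrow> 'a"
    unfolding K_def using assms(1,2) by (rule fnorm_lift_le)
  have "\<bar>F (lift J Q (\<lambda>l. v l + u l)) - F (lift J Q v)\<bar> \<le>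
      (\<bar>C\<bar> * K\<^sup>2) * (fnorm J u * (fnorm J u + fnorm J v))" for u v
  proof -
    have "\<bar>F (lift J Q (\<lambda>l. v l + u l)) - F (lift J Q v)\<bar> \<le>
        \<bar>C\<bar> * (fnorm I (lift J Q u) * (fnorm I (lift J Q u) + fnorm I (lift J Q v)))"
      unfolding lift_add by (rule quad_like_diff[OF quad_like_abs[OF F]])
    also have "\<dots> \<le> \<bar>C\<bar> * ((K * fnorm J u) * (K * fnorm J u + K * fnorm J v))"
      by (intro mult_left_mono mult_mono add_mono K add_nonneg_nonneg fnorm_nonneg
          order_trans[OF fnorm_nonneg K]) simp
    finally show ?thesis by (simp add: power2_eq_square algebra_simps)
  qed
  then have "quad_like J (\<lambda>u. F (lift J Q u)) (\<bar>C\<bar> * K\<^sup>2)"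
    unfolding quad_like_def by (simp add: lift_scaleR quad_like_scale[OF F])
  then show ?thesis ..
qed

section \<open>Reduction of the matrix size\<close>

lemma re_form_add_op:
  "re_form I A (\<lambda>x. S x + T x) v = re_form I A S v + re_form I A T v"
  by (simp add: re_form_expand cinner_simps distrib_left sum.distrib)

lemma re_form_cong_index: "(\<And>a. a \<in> I \<Longrightarrow> u a = v a) \<Longrightarrow> re_form I A S u = re_form I A S v"
  by (simp add: re_form_expand)

lemma quad_like_cong_index:
  assumes "finite I" "quad_like I F C" and eq: "\<And>a. a \<in> I \<Longrightarrow> u a = v a"
  shows "F u = F v"
proof -
  have "fnorm I (\<lambda>a. u a - v a) = 0"
    using eq by (simp add: fnorm_def L2_set_def)
  then have "\<bar>F (\<lambda>a. v a + (u a - v a)) - F v\<bar> \<le> 0"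
    using quad_like_diff[OF assms(2), of v "\<lambda>a. u a - v a"] by simp
  then show ?thesis by simp
qed

text \<open>Let \<open>P\<close> be positive semidefinite and \<open>c = \<langle>e, P e\<rangle> > 0\<close>. The kernel of the functional
  \<open>\<phi> = \<langle>e, P \<cdot>\<rangle>\<close> is parametrised by all coordinates but one, and it is \<open>P\<close>-orthogonal to \<open>e\<close>.
  So \<open>v = Q u + e \<otimes> h\<close> with \<open>Q u\<close> in the kernel, and \<open>P\<close> controls the second summand.\<close>

lemma psd_splitting:
  fixes P :: "nat \<Rightarrow> nat \<Rightarrow> complex"
  assumes I: "finite I" and herm: "\<And>a b. a \<in> I \<Longrightarrow> b \<in> I \<Longrightarrow> P b a = cnj (P a b)"
    and psd: "\<And>w. 0 \<le> scalar_form I P w" and e: "scalar_form I P e > 0"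
  shows "\<exists>a0\<in>I. \<exists>Q.
    (\<forall>u :: nat \<Rightarrow> 'h::complex_hilbert_space.
      fnorm (I - {a0}) u \<le> fnorm I (lift (I - {a0}) Q u)) \<and>
    (\<forall>v :: nat \<Rightarrow> 'h. \<exists>u h. (\<forall>a\<in>I. v a = lift (I - {a0}) Q u a + e a *\<^sub>C h) \<and>
      re_form I P (\<lambda>x. x) v \<ge> scalar_form I P e * (norm h)\<^sup>2)"
proof -
  define \<phi> where "\<phi> b = (\<Sum>a\<in>I. cnj (e a) * P a b)" for b
  define c where "c = (\<Sum>b\<in>I. \<phi> b * e b)"
  have c_alt: "c = (\<Sum>a\<in>I. \<Sum>b\<in>I. P a b * cnj (e a) * e b)"
    unfolding c_def \<phi>_def sum_distrib_right by (subst sum.swap) (simp add: mult_ac)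
  have Re_c: "Re c = scalar_form I P e" unfolding c_alt scalar_form_eq ..
  then have "c \<noteq> 0" using e by auto
  have "\<exists>a0\<in>I. \<phi> a0 \<noteq> 0"
  proof (rule ccontr)
    assume "\<not> ?thesis"
    then have "c = 0" by (simp add: c_def)
    with \<open>c \<noteq> 0\<close> show False ..
  qed
  then obtain a0 where a0: "a0 \<in> I" "\<phi> a0 \<noteq> 0" by blast
  define J where "J = I - {a0}"
  have J: "finite J" "a0 \<notin> J" "I = insert a0 J" using I a0 by (auto simp: J_def)
  define Q where "Q a l = (if a = a0 then - \<phi> l / \<phi> a0 else if a = l then 1 else 0)" for a l
  have lift_J: "lift J Q u a = u a" if "a \<in> J" for u :: "nat \<Rightarrow> 'h" and a
  proof -
    have "lift J Q u a = (\<Sum>l\<in>J. if a = l then u l else 0)"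
      unfolding lift_def using that J(2)
      by (intro sum.cong) (auto simp: Q_def scaleC_one scaleC_0_left)
    then show ?thesis using that J(1) by simp
  qed
  have lift_a0: "lift J Q u a0 = (- 1 / \<phi> a0) *\<^sub>C (\<Sum>l\<in>J. \<phi> l *\<^sub>C u l)" for u :: "nat \<Rightarrow> 'h"
    by (simp add: lift_def Q_def scaleC_sum_right scaleC_scaleC)
  have ker: "(\<Sum>b\<in>I. \<phi> b *\<^sub>C lift J Q u b) = 0" for u :: "nat \<Rightarrow> 'h"
  proof -
    have "(\<Sum>b\<in>I. \<phi> b *\<^sub>C lift J Q u b) = \<phi> a0 *\<^sub>C lift J Q u a0 + (\<Sum>l\<in>J. \<phi> l *\<^sub>C u l)"
      using J by (simp add: lift_J)
    also have "\<phi> a0 *\<^sub>C lift J Q u a0 = - (\<Sum>l\<in>J. \<phi> l *\<^sub>C u l)"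
      using a0(2) by (simp add: lift_a0 scaleC_scaleC scaleC_minus_left scaleC_one)
    finally show ?thesis by simp
  qed
  show ?thesis
  proof (intro bexI[of _ a0] exI[of _ Q] conjI allI)
    show "a0 \<in> I" by fact
    show "fnorm (I - {a0}) u \<le> fnorm I (lift (I - {a0}) Q u)" for u :: "nat \<Rightarrow> 'h"
    proof -
      have "(fnorm J u)\<^sup>2 \<le> (fnorm I (lift J Q u))\<^sup>2"
        unfolding fnorm_square using J by (simp add: lift_J)
      then show ?thesis
        unfolding J_def[symmetric] using fnorm_nonneg by (rule power2_le_imp_le)
    qed
    show "\<exists>u h. (\<forall>a\<in>I. v a = lift (I - {a0}) Q u a + e a *\<^sub>C h) \<and>
      re_form I P (\<lambda>x. x) v \<ge> scalar_form I P e * (norm h)\<^sup>2" for v :: "nat \<Rightarrow> 'h"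
    proof -
      define h where "h = (1 / c) *\<^sub>C (\<Sum>b\<in>I. \<phi> b *\<^sub>C v b)"
      define u where "u l = v l - e l *\<^sub>C h" for l
      have "(\<Sum>b\<in>I. \<phi> b *\<^sub>C u b) = (\<Sum>b\<in>I. \<phi> b *\<^sub>C v b) - c *\<^sub>C h"
        by (simp add: u_def complex_vector.scale_right_diff_distrib sum_subtractf c_def
            scaleC_sum_left scaleC_scaleC)
      also have "\<dots> = 0" using \<open>c \<noteq> 0\<close> by (simp add: h_def scaleC_scaleC scaleC_one)
      finally have "(\<Sum>b\<in>I. \<phi> b *\<^sub>C u b) = 0" .
      then have "(\<Sum>l\<in>J. \<phi> l *\<^sub>C u l) = - (\<phi> a0 *\<^sub>C u a0)"
        using J by (simp add: eq_neg_iff_add_eq_0 add.commute)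
      then have "lift J Q u a0 = u a0"
        using a0(2) by (simp add: lift_a0 scaleC_scaleC scaleC_minus_left scaleC_one
            complex_vector.scale_minus_right)
      then have lift_u: "lift J Q u a = u a" if "a \<in> I" for a
        using that J lift_J by auto
      have dec: "v a = lift J Q u a + e a *\<^sub>C h" if "a \<in> I" for a
        by (simp add: lift_u[OF that] u_def)
      let ?y = "lift J Q u"
      let ?x = "\<lambda>a. e a *\<^sub>C h"
      have "(\<Sum>a\<in>I. \<Sum>b\<in>I. P a b * cinner (?x a) (?y b)) = (\<Sum>b\<in>I. \<phi> b * cinner h (?y b))"
        by (subst sum.swap) (simp add: \<phi>_def cinner_simps sum_distrib_left sum_distrib_right mult_ac)
      also have "\<dots> = cinner h (\<Sum>b\<in>I. \<phi> b *\<^sub>C ?y b)"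
        by (simp add: cinner_sum_right cinner_simps)
      finally have xy: "(\<Sum>a\<in>I. \<Sum>b\<in>I. P a b * cinner (?x a) (?y b)) = 0"
        by (simp add: ker cinner_simps)
      have "(\<Sum>a\<in>I. \<Sum>b\<in>I. P a b * cinner (?y a) (?x b)) =
          (\<Sum>a\<in>I. \<Sum>b\<in>I. cnj (P b a * cinner (?x b) (?y a)))"
      proof (intro sum.cong refl)
        fix a b assume "a \<in> I" "b \<in> I"
        from herm[OF this(2,1)]
        show "P a b * cinner (?y a) (?x b) = cnj (P b a * cinner (?x b) (?y a))"
          by (simp add: cinner_commute[of "?y a" "?x b"])
      qed
      also have "\<dots> = cnj (\<Sum>b\<in>I. \<Sum>a\<in>I. P b a * cinner (?x b) (?y a))"
        unfolding cnj_sum by (rule sum.swap)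
      finally have yx: "(\<Sum>a\<in>I. \<Sum>b\<in>I. P a b * cinner (?y a) (?x b)) = 0"
        by (simp add: xy)
      have "(\<Sum>a\<in>I. \<Sum>b\<in>I. P a b * cinner (?y a + ?x a) (?y b + ?x b)) =
          (\<Sum>a\<in>I. \<Sum>b\<in>I. P a b * cinner (?y a) (?y b)) + (\<Sum>a\<in>I. \<Sum>b\<in>I. P a b * cinner (?x a) (?x b))"
        using xy yx by (simp add: cinner_add_left cinner_add_right distrib_left sum.distrib)
      also have "(\<Sum>a\<in>I. \<Sum>b\<in>I. P a b * cinner (?x a) (?x b)) = of_real ((norm h)\<^sup>2) * c"
        by (simp add: c_alt cinner_simps cinner_self sum_distrib_left mult_ac)
      finally have "re_form I P (\<lambda>x. x) (\<lambda>a. ?y a + ?x a) = re_form I P (\<lambda>x. x) ?y + (norm h)\<^sup>2 * Re c"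
        by (simp only: re_form_expand plus_complex.sel Re_of_real_mult)
      moreover have "re_form I P (\<lambda>x. x) v = re_form I P (\<lambda>x. x) (\<lambda>a. ?y a + ?x a)"
        using dec by (intro re_form_cong_index)
      moreover have "0 \<le> re_form I P (\<lambda>x. x) ?y" by (rule psd_amplification[OF I psd])
      ultimately have "re_form I P (\<lambda>x. x) v \<ge> scalar_form I P e * (norm h)\<^sup>2"
        by (simp add: Re_c mult.commute)
      with dec show ?thesis unfolding J_def[symmetric] by blast
    qed
  qed
qed

text \<open>The quadratic completion behind the reduction step: a large multiple of \<open>P\<close> outweighs the
  mixed terms.\<close>

lemma quadratic_domination:
  fixes \<epsilon> C K L p :: real
  assumes "\<epsilon> > 0" "C \<ge> 0" "K \<ge> 0" "p > 0"
  obtains \<kappa> \<delta> where "\<kappa> \<ge> 0" "\<delta> > 0"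
    and "\<And>\<nu> \<theta>. \<delta> * (K * \<nu> + L * \<theta>)\<^sup>2 \<le>
      \<epsilon> * \<nu>\<^sup>2 - C * (L * \<theta> * (L * \<theta> + K * \<nu>)) + \<kappa> * p * \<theta>\<^sup>2"
proof -
  \<comment> \<open>\<open>\<kappa>\<close> pays for \<open>C (L \<theta>)\<^sup>2\<close>, for the mixed term after completing the square with \<open>\<epsilon> \<nu>\<^sup>2 / 2\<close>, and
    leaves \<open>(L \<theta>)\<^sup>2\<close>\<close>
  define \<kappa> where "\<kappa> = ((C + (C * K)\<^sup>2 / (2 * \<epsilon>) + 1) * L\<^sup>2) / p"
  define \<delta> where "\<delta> = min (\<epsilon> / 2) 1 / (2 * K\<^sup>2 + 2)"
  have K2: "2 * K\<^sup>2 + 2 > 0" by (simp add: add_nonneg_pos)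
  have "\<delta> > 0" using assms K2 by (simp add: \<delta>_def)
  have "\<delta> * (2 * K\<^sup>2 + 2) = min (\<epsilon> / 2) 1" using K2 by (simp add: \<delta>_def)
  then have \<delta>K: "\<delta> * (2 * K\<^sup>2) + \<delta> * 2 \<le> \<epsilon> / 2" "\<delta> * (2 * K\<^sup>2) + \<delta> * 2 \<le> 1"
    by (simp_all add: algebra_simps)
  have "\<delta> * (2 * K\<^sup>2) \<ge> 0" using \<open>\<delta> > 0\<close> by simp
  with \<delta>K \<open>\<delta> > 0\<close> have \<delta>1: "\<delta> * (2 * K\<^sup>2) \<le> \<epsilon> / 2" "\<delta> * 2 \<le> 1" by linarith+
  have "\<kappa> \<ge> 0" using assms by (simp add: \<kappa>_def)
  moreover have "\<delta> * (K * \<nu> + L * \<theta>)\<^sup>2 \<le>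
      \<epsilon> * \<nu>\<^sup>2 - C * (L * \<theta> * (L * \<theta> + K * \<nu>)) + \<kappa> * p * \<theta>\<^sup>2" for \<nu> \<theta>
  proof -
    define \<eta> where "\<eta> = L * \<theta>"
    have "(K * \<nu> + \<eta>)\<^sup>2 \<le> 2 * K\<^sup>2 * \<nu>\<^sup>2 + 2 * \<eta>\<^sup>2"
      using sum_squares_bound[of "K * \<nu>" \<eta>] by (simp add: power2_sum power_mult_distrib)
    then have "\<delta> * (K * \<nu> + \<eta>)\<^sup>2 \<le> \<delta> * (2 * K\<^sup>2 * \<nu>\<^sup>2 + 2 * \<eta>\<^sup>2)"
      using \<open>\<delta> > 0\<close> by simp
    also have "\<dots> = (\<delta> * (2 * K\<^sup>2)) * \<nu>\<^sup>2 + (\<delta> * 2) * \<eta>\<^sup>2"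
      by (simp add: algebra_simps)
    also have "\<dots> \<le> \<epsilon> / 2 * \<nu>\<^sup>2 + 1 * \<eta>\<^sup>2"
      by (intro add_mono mult_right_mono \<delta>1) simp_all
    finally have 1: "\<delta> * (K * \<nu> + \<eta>)\<^sup>2 \<le> \<epsilon> / 2 * \<nu>\<^sup>2 + \<eta>\<^sup>2" by simp
    have "0 \<le> (\<epsilon> * \<nu> - C * K * \<eta>)\<^sup>2 / (2 * \<epsilon>)" using assms by simp
    also have "\<dots> = \<epsilon> / 2 * \<nu>\<^sup>2 - C * K * \<eta> * \<nu> + (C * K)\<^sup>2 / (2 * \<epsilon>) * \<eta>\<^sup>2"
      using assms by (simp add: power2_eq_square field_simps)
    finally have 2: "C * K * \<eta> * \<nu> \<le> \<epsilon> / 2 * \<nu>\<^sup>2 + (C * K)\<^sup>2 / (2 * \<epsilon>) * \<eta>\<^sup>2" by simp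
    have "\<kappa> * p = (C + (C * K)\<^sup>2 / (2 * \<epsilon>) + 1) * L\<^sup>2" using assms by (simp add: \<kappa>_def)
    then have 3: "\<kappa> * p * \<theta>\<^sup>2 = C * \<eta>\<^sup>2 + (C * K)\<^sup>2 / (2 * \<epsilon>) * \<eta>\<^sup>2 + \<eta>\<^sup>2"
      by (simp only: \<eta>_def power_mult_distrib[of L] distrib_right mult_1_left mult.assoc)
    have 4: "C * (\<eta> * (\<eta> + K * \<nu>)) = C * \<eta>\<^sup>2 + C * K * \<eta> * \<nu>"
      by (simp add: power2_eq_square algebra_simps)
    show ?thesis using 1 2 unfolding 3 unfolding \<eta>_def[symmetric] 4 by linarith
  qed
  ultimately show ?thesis using that \<open>\<delta> > 0\<close> by blast
qed

section \<open>Positivity on null families yields the operators\<close>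

text \<open>In the balanced case all unknowns can be eliminated one after the other. Otherwise some
  combination \<open>P\<close> of the \<open>B\<^sub>i\<close> is positive semidefinite and nonzero; null families live in the
  kernel of a functional \<open>\<langle>e, P \<cdot>\<rangle>\<close>, where the claim holds by induction, and adding a large
  multiple of \<open>P \<otimes> 1\<close> takes care of the complementary direction.\<close>

lemma positive_on_null_families_imp_operators:
  fixes F :: "(nat \<Rightarrow> 'h::complex_hilbert_space) \<Rightarrow> real"
  assumes "finite I"
    and "\<And>i a b. i < k \<Longrightarrow> a \<in> I \<Longrightarrow> b \<in> I \<Longrightarrow> B i b a = cnj (B i a b)"
    and "quad_like I F C" and "\<epsilon> > 0"
    and "\<And>vs. null_family I B k vs \<Longrightarrow> \<epsilon> * (\<Sum>v\<leftarrow>vs. (fnorm I v)\<^sup>2) \<le> (\<Sum>v\<leftarrow>vs. F v)"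
  shows "\<exists>S \<delta>. (\<forall>i<k. S i \<in> herm_ops) \<and> \<delta> > 0 \<and>
    (\<forall>v. \<delta> * (fnorm I v)\<^sup>2 \<le> F v + (\<Sum>i<k. re_form I (B i) (blinfun_apply (S i)) v))"
  using assms
proof (induction "card I" arbitrary: I B F C \<epsilon> rule: less_induct)
  case less
  note I = less.prems(1) and herm = less.prems(2) and F = less.prems(3) and eps = less.prems(4)
    and pos = less.prems(5)
  show ?case
  proof (cases "balanced I B k")
    case True
    have "\<exists>S. (\<forall>i<k. S i \<in> herm_ops) \<and>
      (\<forall>v. 0 \<le> (F v - \<epsilon> * (fnorm I v)\<^sup>2) + (\<Sum>i<k. re_form I (B i) (blinfun_apply (S i)) v))"
    proof (rule balanced_imp_operators[OF I True])
      show "F (\<lambda>a. t *\<^sub>R v a) - \<epsilon> * (fnorm I (\<lambda>a. t *\<^sub>R v a))\<^sup>2 = t\<^sup>2 * (F v - \<epsilon> * (fnorm I v)\<^sup>2)" for t v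
        by (simp add: quad_like_scale[OF F] fnorm_square power_mult_distrib sum_distrib_left algebra_simps)
      show "F v - \<epsilon> * (fnorm I v)\<^sup>2 \<le> C * (\<Sum>a\<in>I. (norm (v a))\<^sup>2)" for v
      proof -
        have "0 \<le> \<epsilon> * (fnorm I v)\<^sup>2" using eps by simp
        then show ?thesis using quad_like_bound[OF F, of v] unfolding fnorm_square by linarith
      qed
      show "0 \<le> (\<Sum>v\<leftarrow>vs. F v - \<epsilon> * (fnorm I v)\<^sup>2)" if "null_family I B k vs" for vs
        using pos[OF that] by (simp add: sum_list_subtractf sum_list_const_mult)
    qed
    then obtain S where S: "\<forall>i<k. S i \<in> herm_ops"
      "\<And>v. 0 \<le> (F v - \<epsilon> * (fnorm I v)\<^sup>2) + (\<Sum>i<k. re_form I (B i) (blinfun_apply (S i)) v)" by blast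
    have "\<epsilon> * (fnorm I v)\<^sup>2 \<le> F v + (\<Sum>i<k. re_form I (B i) (blinfun_apply (S i)) v)" for v
      using S(2)[of v] by linarith
    with S(1) eps show ?thesis by blast
  next
    case False
    obtain t e where psd: "\<And>w. 0 \<le> (\<Sum>i<k. t i * scalar_form I (B i) w)"
      and e: "(\<Sum>i<k. t i * scalar_form I (B i) e) > 0"
      using not_balanced_imp_psd_combination[OF I False] by blast
    define P where "P a b = (\<Sum>i<k. of_real (t i) * B i a b)" for a b
    have P: "re_form I P S v = (\<Sum>i<k. t i * re_form I (B i) S v)" for S and v :: "nat \<Rightarrow> 'b::complex_hilbert_space"
      unfolding P_def by (rule re_form_combination)
    have P_herm: "P b a = cnj (P a b)" if "a \<in> I" "b \<in> I" for a b
    proof -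
      have "P b a = (\<Sum>i<k. cnj (of_real (t i) * B i a b))"
        unfolding P_def by (intro sum.cong refl) (simp add: herm[OF _ that])
      then show ?thesis by (simp add: P_def)
    qed
    have P_psd: "0 \<le> scalar_form I P w" and P_e: "scalar_form I P e > 0" for w
      using psd e by (simp_all add: P)
    obtain a0 Q where a0: "a0 \<in> I"
      and Q_ge: "\<And>u :: nat \<Rightarrow> 'h. fnorm (I - {a0}) u \<le> fnorm I (lift (I - {a0}) Q u)"
      and split: "\<And>v :: nat \<Rightarrow> 'h. \<exists>u h. (\<forall>a\<in>I. v a = lift (I - {a0}) Q u a + e a *\<^sub>C h) \<and>
        re_form I P (\<lambda>x. x) v \<ge> scalar_form I P e * (norm h)\<^sup>2"
      using psd_splitting[OF I P_herm P_psd P_e, where 'h = 'h] by blast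
    define J where "J = I - {a0}"
    have J: "finite J" "card J < card I"
      using I card_Diff1_less[OF I a0] by (auto simp: J_def)
    obtain D where D: "quad_like J (\<lambda>u. F (lift J Q u)) D"
      using quad_like_lift[OF I J(1) F] by blast
    have "\<exists>S \<delta>. (\<forall>i<k. S i \<in> herm_ops) \<and> \<delta> > 0 \<and>
      (\<forall>u. \<delta> * (fnorm J u)\<^sup>2 \<le> F (lift J Q u) +
        (\<Sum>i<k. re_form J (congruence I Q (B i)) (blinfun_apply (S i)) u))"
    proof (rule less.hyps[OF J(2,1) _ D eps])
      show "congruence I Q (B i) m l = cnj (congruence I Q (B i) l m)" if "i < k" for i l m
        by (rule congruence_hermitian) (rule herm[OF that])
      show "\<epsilon> * (\<Sum>u\<leftarrow>us. (fnorm J u)\<^sup>2) \<le> (\<Sum>u\<leftarrow>us. F (lift J Q u))"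
        if "null_family J (\<lambda>i. congruence I Q (B i)) k us" for us
      proof -
        have "(\<Sum>u\<leftarrow>us. (fnorm J u)\<^sup>2) \<le> (\<Sum>u\<leftarrow>us. (fnorm I (lift J Q u))\<^sup>2)"
          by (intro sum_list_mono power_mono) (use Q_ge in \<open>auto simp: J_def fnorm_nonneg\<close>)
        then have "\<epsilon> * (\<Sum>u\<leftarrow>us. (fnorm J u)\<^sup>2) \<le> \<epsilon> * (\<Sum>u\<leftarrow>us. (fnorm I (lift J Q u))\<^sup>2)"
          using eps by simp
        also have "\<dots> \<le> (\<Sum>u\<leftarrow>us. F (lift J Q u))"
          using pos[OF null_family_lift[OF that]] by (simp add: o_def)
        finally show ?thesis .
      qed
    qed
    then obtain S \<epsilon>' where S: "\<And>i. i < k \<Longrightarrow> S i \<in> herm_ops" and eps': "\<epsilon>' > 0"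
      and S_pos: "\<And>u. \<epsilon>' * (fnorm J u)\<^sup>2 \<le> F (lift J Q u) +
        (\<Sum>i<k. re_form J (congruence I Q (B i)) (blinfun_apply (S i)) u)" by blast
    define G where "G v = F v + (\<Sum>i<k. re_form I (B i) (blinfun_apply (S i)) v)" for v
    have G_lift: "\<epsilon>' * (fnorm J u)\<^sup>2 \<le> G (lift J Q u)" for u
      using S_pos[of u] S by (simp add: G_def re_form_lift)
    obtain E where "quad_like I G E"
      unfolding G_def using quad_like_sum_re_form[OF I] quad_like_add[OF F] by blast
    then have G: "quad_like I G \<bar>E\<bar>" by (rule quad_like_abs)
    define K where "K = (\<Sum>a\<in>I. \<Sum>l\<in>J. cmod (Q a l))"
    define L where "L = L2_set (\<lambda>a. cmod (e a)) I"
    have K: "fnorm I (lift J Q u) \<le> K * fnorm J u" for u :: "nat \<Rightarrow> 'h"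
      unfolding K_def using I J(1) by (rule fnorm_lift_le)
    have "K \<ge> 0" by (simp add: K_def sum_nonneg)
    obtain \<kappa> \<delta> where \<kappa>: "\<kappa> \<ge> 0" and \<delta>: "\<delta> > 0"
      and dom: "\<And>\<nu> \<theta>. \<delta> * (K * \<nu> + L * \<theta>)\<^sup>2 \<le>
        \<epsilon>' * \<nu>\<^sup>2 - \<bar>E\<bar> * (L * \<theta> * (L * \<theta> + K * \<nu>)) + \<kappa> * scalar_form I P e * \<theta>\<^sup>2"
      using quadratic_domination[OF eps' _ \<open>K \<ge> 0\<close> P_e, of "\<bar>E\<bar>" L] by auto
    define S' where "S' i = S i + (\<kappa> * t i) *\<^sub>R id_blinfun" for i
    have S'_sum: "(\<Sum>i<k. re_form I (B i) (blinfun_apply (S' i)) v) =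
        (\<Sum>i<k. re_form I (B i) (blinfun_apply (S i)) v) + \<kappa> * re_form I P (\<lambda>x. x) v" for v
    proof -
      have "re_form I (B i) (blinfun_apply (S' i)) v =
          re_form I (B i) (blinfun_apply (S i)) v + \<kappa> * (t i * re_form I (B i) (\<lambda>x. x) v)" for i
      proof -
        have "re_form I (B i) (\<lambda>x. (\<kappa> * t i) *\<^sub>R x) v = re_form I (\<lambda>a b. of_real (\<kappa> * t i) * B i a b) (\<lambda>x. x) v"
          by (simp add: re_form_expand cinner_simps mult_ac)
        also have "\<dots> = (\<kappa> * t i) * re_form I (B i) (\<lambda>x. x) v" by (rule re_form_scale_matrix)
        finally show ?thesis
          by (simp add: S'_def plus_blinfun.rep_eq scaleR_blinfun.rep_eq re_form_add_op)
      qed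
      then show ?thesis by (simp add: P sum.distrib sum_distrib_left)
    qed
    have "\<delta> * (fnorm I v)\<^sup>2 \<le> F v + (\<Sum>i<k. re_form I (B i) (blinfun_apply (S' i)) v)" for v
    proof -
      obtain u h where v: "\<And>a. a \<in> I \<Longrightarrow> v a = lift J Q u a + e a *\<^sub>C h"
        and Pv: "re_form I P (\<lambda>x. x) v \<ge> scalar_form I P e * (norm h)\<^sup>2"
        using split[of v] unfolding J_def[symmetric] by blast
      let ?x = "\<lambda>a. e a *\<^sub>C h"
      have x: "fnorm I ?x = L * norm h" by (simp add: fnorm_tensor L_def)
      have "fnorm I v = fnorm I (\<lambda>a. lift J Q u a + ?x a)"
        using v by (simp add: fnorm_def cong: L2_set_cong)
      also have "\<dots> \<le> K * fnorm J u + L * norm h"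
        using fnorm_triangle[of I "lift J Q u" ?x] K[of u] x by linarith
      finally have "\<delta> * (fnorm I v)\<^sup>2 \<le> \<delta> * (K * fnorm J u + L * norm h)\<^sup>2"
        using \<delta> by (intro mult_left_mono power_mono) (auto simp: fnorm_nonneg)
      also note dom[of "fnorm J u" "norm h"]
      also have "\<epsilon>' * (fnorm J u)\<^sup>2 - \<bar>E\<bar> * (L * norm h * (L * norm h + K * fnorm J u)) \<le> G v"
      proof -
        have "G v = G (\<lambda>a. lift J Q u a + ?x a)"
          by (rule quad_like_cong_index[OF I G v])
        moreover have "\<bar>G (\<lambda>a. lift J Q u a + ?x a) - G (lift J Q u)\<bar> \<le>
            \<bar>E\<bar> * (L * norm h * (L * norm h + fnorm I (lift J Q u)))"
          using quad_like_diff[OF G, of "lift J Q u" ?x] unfolding x .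
        moreover have "\<dots> \<le> \<bar>E\<bar> * (L * norm h * (L * norm h + K * fnorm J u))"
          by (intro mult_left_mono add_left_mono K mult_nonneg_nonneg) (simp_all add: L_def L2_set_nonneg)
        ultimately show ?thesis using G_lift[of u] by linarith
      qed
      also have "\<kappa> * scalar_form I P e * (norm h)\<^sup>2 \<le> \<kappa> * re_form I P (\<lambda>x. x) v"
        using mult_left_mono[OF Pv \<kappa>] by (simp add: mult.assoc)
      finally show ?thesis unfolding S'_sum G_def by simp
    qed
    moreover have "S' i \<in> herm_ops" if "i < k" for i
      using S[OF that] by (simp add: S'_def add_herm_ops scaleR_id_herm_ops)
    ultimately show ?thesis using \<delta> by blast
  qed
qed

section \<open>Isometric factorisation of finite families\<close>

text \<open>A family spanning an \<open>r\<close>-dimensional space is the image of \<open>r\<close> vectors under an isometric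
  matrix; this is a version of the polar decomposition. It comes from orthonormalising with
  respect to \<open>h x y = \<langle>x, \<Sum>\<^sub>i |v\<^sub>i\<rangle>\<langle>v\<^sub>i| y\<rangle>\<close>; the resulting vectors \<open>z\<close> are dual to \<open>f\<close>, which shows that
  \<open>f\<close> is linearly independent.\<close>

lemma isometric_factorisation:
  fixes v :: "nat \<Rightarrow> 'h::complex_hilbert_space" and n :: nat
  shows "\<exists>(r::nat) W f z.
    (\<forall>l<r. \<forall>m<r. (\<Sum>i<n. cnj (W i l) * W i m) = (if l = m then 1 else 0)) \<and>
    (\<forall>i<n. v i = (\<Sum>l<r. W i l *\<^sub>C f l)) \<and>
    (\<forall>l<r. \<forall>m<r. cinner (z m) (f l) = (if l = m then 1 else 0))"
proof -
  define h where "h x y = (\<Sum>i<n. cinner x (v i) * cinner (v i) y)" for x y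
  have self: "cinner x (v i) * cinner (v i) x = of_real ((cmod (cinner (v i) x))\<^sup>2)" for x i
    by (simp add: cinner_commute[of x "v i"] complex_norm_square mult.commute del: of_real_power)
  have h_self: "h x x = of_real (\<Sum>i<n. (cmod (cinner (v i) x))\<^sup>2)" for x
    unfolding h_def self by (simp only: of_real_sum)
  have null: "cinner (v i) y = 0" if "h y y = 0" "i < n" for i y
  proof -
    have "(\<Sum>i<n. (cmod (cinner (v i) y))\<^sup>2) = 0" using that(1) unfolding h_self by (simp only: of_real_eq_0_iff)
    then show ?thesis using that(2) by (simp add: sum_nonneg_eq_0_iff)
  qed
  have h_herm: "h x y = cnj (h y x)" for x y
    by (simp add: h_def cinner_commute[of x] cinner_commute[of _ y] mult.commute)
  have "\<exists>(r::nat) z. (\<forall>l<r. \<forall>m<r. h (z l) (z m) = (if l = m then 1 else 0)) \<and>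
    (\<forall>k<n. h (v k - (\<Sum>l<r. h (z l) (v k) *\<^sub>C z l)) (v k - (\<Sum>l<r. h (z l) (v k) *\<^sub>C z l)) = 0)"
  proof (rule gram_schmidt_semidefinite)
    show "h x (y + w) = h x y + h x w" for x y w
      by (simp add: h_def cinner_simps distrib_left sum.distrib)
    show "h x (c *\<^sub>C y) = c * h x y" for c x y
      by (simp add: h_def cinner_simps sum_distrib_left mult_ac)
    show "h x y = cnj (h y x)" for x y by (rule h_herm)
    show "0 \<le> Re (h x x)" for x unfolding h_self by (simp add: sum_nonneg)
    show "h x y = 0" if "h y y = 0" for x y
      using null[OF that] by (simp add: h_def)
  qed
  then obtain r :: nat and z where
    orth: "\<And>l m. l < r \<Longrightarrow> m < r \<Longrightarrow> h (z l) (z m) = (if l = m then 1 else 0)"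
    and res: "\<And>k. k < n \<Longrightarrow> h (v k - (\<Sum>l<r. h (z l) (v k) *\<^sub>C z l)) (v k - (\<Sum>l<r. h (z l) (v k) *\<^sub>C z l)) = 0"
    by blast
  define W where "W i l = cinner (z l) (v i)" for i l
  define f where "f l = (\<Sum>k<n. cinner (v k) (z l) *\<^sub>C v k)" for l
  have cnj_W: "cnj (W i l) = cinner (v i) (z l)" for i l
    unfolding W_def by (rule cinner_commute[symmetric])
  have "(\<Sum>i<n. cnj (W i l) * W i m) = h (z m) (z l)" for l m
    unfolding cnj_W by (simp add: W_def h_def mult.commute)
  then have iso: "(\<Sum>i<n. cnj (W i l) * W i m) = (if l = m then 1 else 0)" if "l < r" "m < r" for l m
    using orth[OF that(2,1)] by auto
  have "cinner (z m) (f l) = h (z m) (z l)" for l m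
    by (simp add: f_def h_def cinner_sum_right cinner_simps mult.commute)
  then have dual: "cinner (z m) (f l) = (if l = m then 1 else 0)" if "l < r" "m < r" for l m
    using orth[OF that(2,1)] by auto
  have exp: "v i = (\<Sum>l<r. W i l *\<^sub>C f l)" if "i < n" for i
  proof -
    define u where "u = v i - (\<Sum>l<r. W i l *\<^sub>C f l)"
    have vu: "cinner (v k) u = 0" if "k < n" for k
    proof -
      have vf: "cinner (v k) (f l) = cnj (h (z l) (v k))" for l
      proof -
        have "cinner (v k) (f l) = h (v k) (z l)"
          by (simp add: f_def h_def cinner_sum_right cinner_simps mult.commute)
        then show ?thesis using h_herm[of "v k" "z l"] by simp
      qed
      have "cinner (v i) (v k - (\<Sum>l<r. h (z l) (v k) *\<^sub>C z l)) = 0"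
        using null[OF res[OF that] \<open>i < n\<close>] .
      then have "cinner (v i) (v k) = (\<Sum>l<r. h (z l) (v k) * cinner (v i) (z l))"
        by (simp add: cinner_diff_right cinner_sum_right cinner_scaleC_right)
      then have "cnj (cinner (v i) (v k)) = (\<Sum>l<r. cnj (h (z l) (v k)) * W i l)"
        by (simp flip: cnj_W)
      then have "cinner (v k) (v i) = (\<Sum>l<r. cnj (h (z l) (v k)) * W i l)"
        by (simp flip: cinner_commute)
      then show ?thesis
        by (simp add: u_def cinner_diff_right cinner_sum_right cinner_scaleC_right vf mult.commute)
    qed
    have fu: "cinner (f l) u = 0" for l
      by (simp add: f_def cinner_sum_left cinner_scaleC_left vu)
    have "cinner (v i - (\<Sum>l<r. W i l *\<^sub>C f l)) u = cinner (v i) u - (\<Sum>l<r. cnj (W i l) * cinner (f l) u)"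
      by (simp only: cinner_diff_left cinner_sum_left cinner_scaleC_left)
    then have "cinner u u = cinner (v i) u - (\<Sum>l<r. cnj (W i l) * cinner (f l) u)"
      by (simp only: u_def)
    then have "cinner u u = 0" by (simp add: vu[OF \<open>i < n\<close>] fu)
    then have "u = 0" by (rule cinner_self_eq_0)
    then show ?thesis by (simp add: u_def)
  qed
  show ?thesis using iso exp dual by blast
qed

lemma dual_system_le_hilbert_dim:
  fixes f z :: "nat \<Rightarrow> 'h::complex_hilbert_space"
  assumes dual: "\<And>l m. l < r \<Longrightarrow> m < r \<Longrightarrow> cinner (z m) (f l) = (if l = m then 1 else 0)"
  shows "enat r \<le> hilbert_dim TYPE('h)"
proof (cases "\<exists>B :: 'h set. finite B \<and> complex_vector.span B = UNIV")
  case True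
  then obtain B :: "'h set" where B: "finite B" "complex_vector.span B = UNIV" by blast
  have inj: "inj_on f {..<r}"
  proof (rule inj_onI)
    fix l m assume "l \<in> {..<r}" "m \<in> {..<r}" "f l = f m"
    then have "(if m = l then 1 else 0) = (1::complex)" using dual[of l l] dual[of m l] by auto
    then show "l = m" by (auto split: if_splits)
  qed
  have ind: "complex_vector.independent (f ` {..<r})"
  proof (rule complex_vector.independent_if_scalars_zero)
    fix g x assume g: "(\<Sum>x\<in>f ` {..<r}. g x *\<^sub>C x) = 0" and "x \<in> f ` {..<r}"
    then obtain m where m: "m < r" "x = f m" by auto
    have "0 = cinner (z m) (\<Sum>l<r. g (f l) *\<^sub>C f l)"
      using g by (simp add: sum.reindex[OF inj] cinner_simps)
    also have "\<dots> = (\<Sum>l<r. g (f l) * (if l = m then 1 else 0))"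
      unfolding cinner_sum_right cinner_scaleC_right using m(1) dual by (intro sum.cong) auto
    also have "\<dots> = g x" using m by (simp add: if_distrib[of "(*) _"] cong: if_cong)
    finally show "g x = 0" by simp
  qed simp
  have "\<exists>b :: 'h set. complex_vector.independent b \<and> UNIV \<subseteq> complex_vector.span b \<and>
    card b = complex_vector.dim (UNIV :: 'h set)"
  proof (rule complex_vector.basis_exists[of "UNIV :: 'h set"])
    fix b :: "'h set"
    assume "complex_vector.independent b" "UNIV \<subseteq> complex_vector.span b"
      "card b = complex_vector.dim (UNIV :: 'h set)"
    then show ?thesis by (intro exI[of _ b] conjI)
  qed
  then obtain b :: "'h set" where b: "complex_vector.independent b" "UNIV \<subseteq> complex_vector.span b"
    "card b = complex_vector.dim (UNIV :: 'h set)" by (elim exE conjE)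
  have "finite b" using complex_vector.independent_span_bound[OF B(1) b(1)] B(2) by auto
  then have "card (f ` {..<r}) \<le> card b"
    using complex_vector.independent_span_bound[OF _ ind] b(2) by auto
  then show ?thesis using True b(3) by (simp add: hilbert_dim_def card_image[OF inj])
next
  case False
  then have "hilbert_dim TYPE('h) = \<infinity>" unfolding hilbert_dim_def by (rule if_not_P)
  then show ?thesis by simp
qed

section \<open>Matrices and polynomials as forms\<close>

abbreviation entry :: "'a mat \<Rightarrow> nat \<Rightarrow> nat \<Rightarrow> 'a"
  where "entry A a b \<equiv> A $$ (a, b)"

lemma mat_adjoint_carrier: "A \<in> carrier_mat d r \<Longrightarrow> mat_adjoint A \<in> carrier_mat r d"
  by (auto simp: mat_adjoint_def)

lemma mat_adjoint_entry:
  fixes A :: "complex mat"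
  assumes "A \<in> carrier_mat d r" "l < r" "a < d"
  shows "mat_adjoint A $$ (l, a) = cnj (A $$ (a, l))"
  using assms by (simp add: mat_adjoint_def mat_of_rows_index)

lemma herm_mats_entry:
  assumes "B \<in> herm_mats d" "a < d" "b < d"
  shows "B $$ (b, a) = cnj (B $$ (a, b))"
proof -
  have "B \<in> carrier_mat d d" "mat_adjoint B = B" using assms(1) by (auto simp: herm_mats_def)
  then show ?thesis using mat_adjoint_entry[of B d d b a] assms by simp
qed

lemma mult_mat_entry:
  assumes "X \<in> carrier_mat r d" "Y \<in> carrier_mat d s" "i < r" "j < s"
  shows "(X * Y) $$ (i, j) = (\<Sum>b<d. X $$ (i, b) * Y $$ (b, j))"
  using assms by (simp add: scalar_prod_def atLeast0LessThan)

lemma congruence_entry: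
  assumes V: "V \<in> carrier_mat d r" and B: "B \<in> carrier_mat d d" and lm: "l < r" "m < r"
  shows "(mat_adjoint V * B * V) $$ (l, m) = congruence {..<d} (entry V) (entry B) l m"
proof -
  note C = mat_adjoint_carrier[OF V]
  have "(mat_adjoint V * B) $$ (l, b) = (\<Sum>a<d. cnj (V $$ (a, l)) * B $$ (a, b))" if "b < d" for b
    unfolding mult_mat_entry[OF C B lm(1) that]
    by (intro sum.cong refl) (use mat_adjoint_entry[OF V lm(1)] in simp)
  then have "(mat_adjoint V * B * V) $$ (l, m) =
      (\<Sum>b<d. (\<Sum>a<d. cnj (V $$ (a, l)) * B $$ (a, b)) * V $$ (b, m))"
    unfolding mult_mat_entry[OF mult_carrier_mat[OF C B] V lm] by (intro sum.cong refl) simp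
  also have "\<dots> = congruence {..<d} (entry V) (entry B) l m"
    unfolding congruence_def sum_distrib_right by (rule sum.swap)
  finally show ?thesis .
qed

lemma tensor_form_cong:
  assumes "\<And>a b. a \<in> I \<Longrightarrow> b \<in> I \<Longrightarrow> A a b = A' a b" "\<And>a. a \<in> I \<Longrightarrow> u a = v a"
  shows "tensor_form I A S u = tensor_form I A' S v"
  unfolding tensor_form_def by (intro sum.cong refl) (simp add: assms)

lemma tensor_form_sum_matrix:
  "tensor_form I (\<lambda>a b. \<Sum>k\<in>K. A k a b) S v = (\<Sum>k\<in>K. tensor_form I (A k) S v)"
proof -
  have "(\<Sum>k\<in>K. tensor_form I (A k) S v) = (\<Sum>a\<in>I. \<Sum>k\<in>K. \<Sum>b\<in>I. A k a b * cinner (v a) (S (v b)))"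
    unfolding tensor_form_def by (rule sum.swap)
  also have "\<dots> = (\<Sum>a\<in>I. \<Sum>b\<in>I. \<Sum>k\<in>K. A k a b * cinner (v a) (S (v b)))"
    by (intro sum.cong refl) (rule sum.swap)
  finally show ?thesis by (simp add: tensor_form_def sum_distrib_right)
qed

lemma tensor_form_real:
  assumes "\<And>a b. a \<in> I \<Longrightarrow> b \<in> I \<Longrightarrow> A b a = cnj (A a b)"
    and "\<And>x y. cinner (S x) y = cinner x (S y)"
  shows "Im (tensor_form I A S v) = 0"
proof -
  have "cnj (tensor_form I A S v) = (\<Sum>a\<in>I. \<Sum>b\<in>I. A b a * cinner (v b) (S (v a)))"
    unfolding tensor_form_def cnj_sum
  proof (intro sum.cong refl)
    fix a b assume "a \<in> I" "b \<in> I"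
    from assms(1)[OF this] assms(2)[of "v b" "v a"]
    show "cnj (A a b * cinner (v a) (S (v b))) = A b a * cinner (v b) (S (v a))"
      by (simp flip: cinner_commute)
  qed
  also have "\<dots> = tensor_form I A S v" unfolding tensor_form_def by (rule sum.swap)
  finally have "Im (cnj (tensor_form I A S v)) = Im (tensor_form I A S v)" by simp
  then show ?thesis by simp
qed

lemma sum_tensor_form_lift:
  fixes S :: "'h::complex_hilbert_space \<Rightarrow>\<^sub>L 'h"
  assumes V: "\<And>j. j < k \<Longrightarrow> V j \<in> carrier_mat d r" and B: "B \<in> carrier_mat d d"
    and S: "\<And>c x. blinfun_apply S (c *\<^sub>C x) = c *\<^sub>C blinfun_apply S x"
  shows "(\<Sum>j<k. tensor_form {..<d} (entry B) (blinfun_apply S) (lift {..<r} (entry (V j)) u)) =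
    tensor_form {..<r} (entry (mat_sum r r (\<lambda>j. mat_adjoint (V j) * B * V j) {..<k})) (blinfun_apply S) u"
proof -
  have "tensor_form {..<r} (entry (mat_sum r r (\<lambda>j. mat_adjoint (V j) * B * V j) {..<k})) (blinfun_apply S) u =
      tensor_form {..<r} (\<lambda>l m. \<Sum>j<k. congruence {..<d} (entry (V j)) (entry B) l m) (blinfun_apply S) u"
    by (rule tensor_form_cong) (simp_all add: mat_sum_def congruence_entry[OF V B])
  then show ?thesis by (simp add: tensor_form_sum_matrix tensor_form_lift[OF S])
qed

lemma tensor_form_one:
  "tensor_form {..<d} (entry (1\<^sub>m d)) (\<lambda>x. x) v = of_real ((fnorm {..<d} v)\<^sup>2)"
proof -
  have "tensor_form {..<d} (entry (1\<^sub>m d)) (\<lambda>x. x) v = (\<Sum>a<d. \<Sum>b<d. if a = b then cinner (v a) (v b) else 0)"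
    unfolding tensor_form_def by (intro sum.cong refl) auto
  then show ?thesis by (simp add: cinner_self fnorm_square)
qed

lemma sum_fnorm_isometry:
  fixes u :: "nat \<Rightarrow> 'h::complex_hilbert_space"
  assumes V: "\<And>j. j < k \<Longrightarrow> V j \<in> carrier_mat d r"
    and iso: "mat_sum r r (\<lambda>j. mat_adjoint (V j) * V j) {..<k} = 1\<^sub>m r"
  shows "(\<Sum>j<k. (fnorm {..<d} (lift {..<r} (entry (V j)) u))\<^sup>2) = (fnorm {..<r} u)\<^sup>2"
proof -
  have "mat_sum r r (\<lambda>j. mat_adjoint (V j) * 1\<^sub>m d * V j) {..<k} =
      mat_sum r r (\<lambda>j. mat_adjoint (V j) * V j) {..<k}"
    unfolding mat_sum_def by (intro cong_mat refl sum.cong)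
      (use right_mult_one_mat[OF mat_adjoint_carrier[OF V]] in auto)
  then have "complex_of_real (\<Sum>j<k. (fnorm {..<d} (lift {..<r} (entry (V j)) u))\<^sup>2) =
      of_real ((fnorm {..<r} u)\<^sup>2)"
    using sum_tensor_form_lift[OF V one_carrier_mat, where k = k and S = id_blinfun and u = u] iso by (simp add: tensor_form_one)
  then show ?thesis by (simp only: of_real_eq_iff)
qed

lemma finite_nc_words: "finite (nc_words p)"
  by (simp add: nc_words_def elements_mat_def)

lemma lookup_not_nc_words:
  assumes "p \<in> carrier_mat d d" "a < d" "b < d" "w \<notin> nc_words p"
  shows "Poly_Mapping.lookup (p $$ (a, b)) w = 0"
proof -
  have "p $$ (a, b) \<in> elements_mat p" using assms by auto
  then show ?thesis using assms(4) by (auto simp: nc_words_def in_keys_iff)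
qed

lemma tensor_op_index:
  "i < dim_row P \<Longrightarrow> vec_index (tensor_op P T v) i = (\<Sum>j<dim_col P. P $$ (i, j) *\<^sub>C blinfun_apply T (vec_index v j))"
  by (simp add: tensor_op_def)

lemma tensor_cinner_op_sum:
  assumes P: "\<And>k. k \<in> K \<Longrightarrow> P k \<in> carrier_mat d d" and u: "u \<in> carrier_vec d"
  shows "tensor_cinner u (op_sum d (\<lambda>k. tensor_op (P k) (S k)) K u) =
    (\<Sum>k\<in>K. tensor_form {..<d} (entry (P k)) (blinfun_apply (S k)) (vec_index u))"
proof -
  have "tensor_cinner u (op_sum d (\<lambda>k. tensor_op (P k) (S k)) K u) =
      (\<Sum>a<d. \<Sum>k\<in>K. cinner (vec_index u a) (vec_index (tensor_op (P k) (S k) u) a))"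
    using u by (simp add: tensor_cinner_def op_sum_def cinner_sum_right)
  also have "\<dots> = (\<Sum>k\<in>K. \<Sum>a<d. cinner (vec_index u a) (vec_index (tensor_op (P k) (S k) u) a))"
    by (rule sum.swap)
  also have "\<dots> = (\<Sum>k\<in>K. tensor_form {..<d} (entry (P k)) (blinfun_apply (S k)) (vec_index u))"
    unfolding tensor_form_def
  proof (intro sum.cong refl)
    fix k a assume "k \<in> K" "a \<in> {..<d}"
    then show "cinner (vec_index u a) (vec_index (tensor_op (P k) (S k) u) a) =
        (\<Sum>b<d. entry (P k) a b * cinner (vec_index u a) (blinfun_apply (S k) (vec_index u b)))"
      using carrier_matD[OF P[OF \<open>k \<in> K\<close>]]
      by (simp add: tensor_op_index cinner_sum_right cinner_simps)
  qed
  finally show ?thesis .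
qed

definition poly_form ::
    "(nat \<Rightarrow> 'h::complex_hilbert_space \<Rightarrow>\<^sub>L 'h) \<Rightarrow> ncpoly mat \<Rightarrow> nat \<Rightarrow> (nat \<Rightarrow> 'h) \<Rightarrow> complex"
  where "poly_form T p d v = (\<Sum>w\<in>nc_words p.
    tensor_form {..<d} (\<lambda>a b. Poly_Mapping.lookup (p $$ (a, b)) w) (blinfun_apply (word_eval T w)) v)"

lemma tensor_cinner_nc_eval:
  assumes p: "p \<in> carrier_mat d d" and u: "u \<in> carrier_vec d"
  shows "tensor_cinner u (nc_eval T p u) = poly_form T p d (vec_index u)"
proof -
  have C: "nc_coeff p w \<in> carrier_mat d d" for w using p by (auto simp: nc_coeff_def)
  have "tensor_cinner u (nc_eval T p u) =
      (\<Sum>w\<in>nc_words p. tensor_form {..<d} (entry (nc_coeff p w)) (blinfun_apply (word_eval T w)) (vec_index u))"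
    unfolding nc_eval_def using p tensor_cinner_op_sum[OF C u, of _ "word_eval T"] by auto
  also have "\<dots> = poly_form T p d (vec_index u)"
    unfolding poly_form_def using p by (intro sum.cong tensor_form_cong) (auto simp: nc_coeff_def)
  finally show ?thesis .
qed

lemma word_eval_scaleC:
  assumes "\<And>i. i \<in> set w \<Longrightarrow> T i \<in> herm_ops"
  shows "blinfun_apply (word_eval T w) (c *\<^sub>C x) = c *\<^sub>C blinfun_apply (word_eval T w) x"
  using assms by (induction w) (auto simp: word_eval_def herm_opsD)

lemma word_eval_append:
  "blinfun_apply (word_eval T (v @ w)) x = blinfun_apply (word_eval T v) (blinfun_apply (word_eval T w) x)"
  by (induction v) (simp_all add: word_eval_def)

lemma word_eval_adjoint:
  assumes "\<And>i. i \<in> set w \<Longrightarrow> T i \<in> herm_ops"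
  shows "cinner (blinfun_apply (word_eval T w) x) y = cinner x (blinfun_apply (word_eval T (rev w)) y)"
  using assms
proof (induction w arbitrary: x y)
  case Nil
  show ?case by (simp add: word_eval_def)
next
  case (Cons i w)
  have "blinfun_apply (word_eval T (i # w)) x = blinfun_apply (T i) (blinfun_apply (word_eval T w) x)"
    by (simp add: word_eval_def)
  moreover have "blinfun_apply (word_eval T [i]) y = blinfun_apply (T i) y"
    by (simp add: word_eval_def)
  moreover have "T i \<in> herm_ops" using Cons.prems by simp
  ultimately show ?case
    using Cons.IH[of x "blinfun_apply (T i) y"] Cons.prems by (simp add: herm_opsD word_eval_append)
qed

lemma ncmat_words:
  assumes "p \<in> ncmat n d" "w \<in> nc_words p"
  shows "set w \<subseteq> {1..n}"
  using assms by (auto simp: ncmat_def nc_words_def in_lists_conv_set)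

lemma herm_ncmat_lookup:
  assumes p: "p \<in> herm_ncmat n d" and ab: "a < d" "b < d"
  shows "cnj (Poly_Mapping.lookup (p $$ (a, b)) w) = Poly_Mapping.lookup (p $$ (b, a)) (rev w)"
proof -
  have C: "p \<in> carrier_mat d d" and star: "ncmat_star p = p"
    using p by (auto simp: herm_ncmat_def ncmat_def)
  have "p $$ (b, a) = ncstar (p $$ (a, b))"
    using arg_cong[OF star, of "\<lambda>q. q $$ (b, a)"] C ab by (simp add: ncmat_star_def)
  then show ?thesis by (simp add: lookup_ncstar)
qed

text \<open>Hermiticity pairs the words \<open>w\<close> and \<open>rev w\<close>.\<close>

lemma poly_form_real:
  assumes p: "p \<in> herm_ncmat n d" and T: "\<And>i. i \<in> {1..n} \<Longrightarrow> T i \<in> herm_ops"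
  shows "Im (poly_form T p d v) = 0"
proof -
  have C: "p \<in> carrier_mat d d" and pn: "p \<in> ncmat n d"
    using p by (auto simp: herm_ncmat_def ncmat_def)
  have rev_words: "rev w \<in> nc_words p" if w: "w \<in> nc_words p" for w
  proof -
    obtain a b where ab: "a < d" "b < d" "w \<in> Poly_Mapping.keys (p $$ (a, b))"
      using w C by (auto simp: nc_words_def elements_mat_def)
    then have "rev w \<in> Poly_Mapping.keys (p $$ (b, a))"
      using herm_ncmat_lookup[OF p ab(1,2), of w] by (auto simp: in_keys_iff)
    moreover have "p $$ (b, a) \<in> elements_mat p" using C ab by auto
    ultimately show ?thesis by (auto simp: nc_words_def)
  qed
  have cnj_form: "cnj (tensor_form {..<d} (\<lambda>a b. Poly_Mapping.lookup (p $$ (a, b)) w) (blinfun_apply (word_eval T w)) v) =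
      tensor_form {..<d} (\<lambda>a b. Poly_Mapping.lookup (p $$ (a, b)) (rev w)) (blinfun_apply (word_eval T (rev w))) v"
    if w: "w \<in> nc_words p" for w
  proof -
    have Tw: "T i \<in> herm_ops" if "i \<in> set w" for i
      using ncmat_words[OF pn w] that T by blast
    have "cnj (tensor_form {..<d} (\<lambda>a b. Poly_Mapping.lookup (p $$ (a, b)) w) (blinfun_apply (word_eval T w)) v) =
        (\<Sum>a<d. \<Sum>b<d. Poly_Mapping.lookup (p $$ (b, a)) (rev w) *
          cinner (v b) (blinfun_apply (word_eval T (rev w)) (v a)))"
      unfolding tensor_form_def cnj_sum
    proof (intro sum.cong refl)
      fix a b assume "a \<in> {..<d}" "b \<in> {..<d}"
      then have "cnj (Poly_Mapping.lookup (p $$ (a, b)) w) = Poly_Mapping.lookup (p $$ (b, a)) (rev w)"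
        by (intro herm_ncmat_lookup[OF p]) auto
      moreover have "cnj (cinner (v a) (blinfun_apply (word_eval T w) (v b))) =
          cinner (v b) (blinfun_apply (word_eval T (rev w)) (v a))"
        using word_eval_adjoint[OF Tw, where x = "v b" and y = "v a"] by (simp flip: cinner_commute)
      ultimately show "cnj (Poly_Mapping.lookup (p $$ (a, b)) w * cinner (v a) (blinfun_apply (word_eval T w) (v b))) =
          Poly_Mapping.lookup (p $$ (b, a)) (rev w) * cinner (v b) (blinfun_apply (word_eval T (rev w)) (v a))"
        by simp
    qed
    also have "\<dots> = tensor_form {..<d} (\<lambda>a b. Poly_Mapping.lookup (p $$ (a, b)) (rev w)) (blinfun_apply (word_eval T (rev w))) v"
      unfolding tensor_form_def by (rule sum.swap)
    finally show ?thesis .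
  qed
  have "cnj (poly_form T p d v) = (\<Sum>w\<in>nc_words p.
      tensor_form {..<d} (\<lambda>a b. Poly_Mapping.lookup (p $$ (a, b)) (rev w)) (blinfun_apply (word_eval T (rev w))) v)"
    unfolding poly_form_def cnj_sum by (intro sum.cong refl cnj_form)
  also have "\<dots> = poly_form T p d v"
    unfolding poly_form_def by (rule sum.reindex_bij_witness[of _ rev rev]) (auto intro: rev_words)
  finally have "Im (cnj (poly_form T p d v)) = Im (poly_form T p d v)" by simp
  then show ?thesis by simp
qed

lemma poly_form_compress:
  assumes p: "p \<in> ncmat n d" and T: "\<And>i. i \<in> {1..n} \<Longrightarrow> T i \<in> herm_ops"
    and V: "V \<in> carrier_mat d r"
  shows "poly_form T (nc_compress V p) r u = poly_form T p d (lift {..<r} (entry V) u)"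
proof -
  have C: "p \<in> carrier_mat d d" using p by (simp add: ncmat_def)
  let ?A = "\<lambda>w a b. Poly_Mapping.lookup (p $$ (a, b)) w"
  have look: "Poly_Mapping.lookup (nc_compress V p $$ (l, m)) w =
      (if w \<in> nc_words p then congruence {..<d} (entry V) (?A w) l m else 0)"
    if lm: "l < r" "m < r" for l m w
  proof -
    have coeff: "nc_coeff p w \<in> carrier_mat d d" for w using C by (auto simp: nc_coeff_def)
    have D: "mat_adjoint V * nc_coeff p w * V \<in> carrier_mat r r" for w
      using mat_adjoint_carrier[OF V] coeff V by auto
    have "(mat_adjoint V * nc_coeff p w * V) $$ (l, m) = congruence {..<d} (entry V) (?A w) l m" for w
      unfolding congruence_entry[OF V coeff lm] congruence_def
      by (intro sum.cong refl) (use C in \<open>auto simp: nc_coeff_def\<close>)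
    then have "nc_compress V p $$ (l, m) =
        (\<Sum>w\<in>nc_words p. Poly_Mapping.single w (congruence {..<d} (entry V) (?A w) l m))"
      using V lm carrier_matD[OF D] by (simp add: nc_compress_def mat_sum_def nc_monom_def)
    then show ?thesis
      using finite_nc_words[of p] by (simp add: lookup_sum lookup_single when_def sum.delta)
  qed
  have Cr: "nc_compress V p \<in> carrier_mat r r"
    using V by (auto simp: nc_compress_def mat_sum_def)
  have sub: "nc_words (nc_compress V p) \<subseteq> nc_words p"
  proof
    fix w assume "w \<in> nc_words (nc_compress V p)"
    then obtain l m where "l < r" "m < r" "w \<in> Poly_Mapping.keys (nc_compress V p $$ (l, m))"
      using Cr by (auto simp: nc_words_def elements_mat_def)
    then show "w \<in> nc_words p" using look[of l m w] by (auto simp: in_keys_iff split: if_splits)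
  qed
  have "poly_form T (nc_compress V p) r u = (\<Sum>w\<in>nc_words p.
      tensor_form {..<r} (\<lambda>l m. Poly_Mapping.lookup (nc_compress V p $$ (l, m)) w) (blinfun_apply (word_eval T w)) u)"
    unfolding poly_form_def
  proof (intro sum.mono_neutral_left ballI finite_nc_words sub)
    fix w assume "w \<in> nc_words p - nc_words (nc_compress V p)"
    then show "tensor_form {..<r} (\<lambda>l m. Poly_Mapping.lookup (nc_compress V p $$ (l, m)) w) (blinfun_apply (word_eval T w)) u = 0"
      unfolding tensor_form_def using lookup_not_nc_words[OF Cr] by (intro sum.neutral ballI) auto
  qed
  also have "\<dots> = poly_form T p d (lift {..<r} (entry V) u)"
    unfolding poly_form_def
  proof (intro sum.cong refl)
    fix w assume w: "w \<in> nc_words p"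
    have "tensor_form {..<r} (\<lambda>l m. Poly_Mapping.lookup (nc_compress V p $$ (l, m)) w) (blinfun_apply (word_eval T w)) u =
        tensor_form {..<r} (congruence {..<d} (entry V) (?A w)) (blinfun_apply (word_eval T w)) u"
      by (rule tensor_form_cong) (simp_all add: look w)
    also have "\<dots> = tensor_form {..<d} (?A w) (blinfun_apply (word_eval T w)) (lift {..<r} (entry V) u)"
      by (rule tensor_form_lift[symmetric], rule word_eval_scaleC) (use ncmat_words[OF p w] T in blast)
    finally show "tensor_form {..<r} (\<lambda>l m. Poly_Mapping.lookup (nc_compress V p $$ (l, m)) w) (blinfun_apply (word_eval T w)) u =
        tensor_form {..<d} (?A w) (blinfun_apply (word_eval T w)) (lift {..<r} (entry V) u)" .
  qed
  finally show ?thesis .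
qed

lemma quad_like_poly_form:
  "\<exists>C. quad_like {..<d} (\<lambda>v. Re (poly_form T p d v)) C"
proof -
  define X where "X a b x = (\<Sum>w\<in>nc_words p. Poly_Mapping.lookup (p $$ (a, b)) w *\<^sub>C blinfun_apply (word_eval T w) x)" for a b x
  have "poly_form T p d v = (\<Sum>a<d. \<Sum>b<d. cinner (v a) (X a b (v b)))" for v
  proof -
    have "poly_form T p d v = (\<Sum>a<d. \<Sum>w\<in>nc_words p. \<Sum>b<d. Poly_Mapping.lookup (p $$ (a, b)) w *
        cinner (v a) (blinfun_apply (word_eval T w) (v b)))"
      unfolding poly_form_def tensor_form_def by (rule sum.swap)
    also have "\<dots> = (\<Sum>a<d. \<Sum>b<d. \<Sum>w\<in>nc_words p. Poly_Mapping.lookup (p $$ (a, b)) w *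
        cinner (v a) (blinfun_apply (word_eval T w) (v b)))"
      by (intro sum.cong refl) (rule sum.swap)
    finally show ?thesis by (simp add: X_def cinner_sum_right cinner_simps)
  qed
  moreover have "quad_like {..<d} (\<lambda>v. Re (\<Sum>a<d. \<Sum>b<d. cinner (v a) (X a b (v b))))
    (2 * (\<Sum>a<d. \<Sum>b<d. \<bar>\<Sum>w\<in>nc_words p. cmod (Poly_Mapping.lookup (p $$ (a, b)) w) * norm (word_eval T w)\<bar>))"
  proof (rule quad_like_operator_matrix)
    show "norm (X a b x) \<le> (\<Sum>w\<in>nc_words p. cmod (Poly_Mapping.lookup (p $$ (a, b)) w) * norm (word_eval T w)) * norm x" for a b x
      unfolding X_def sum_distrib_right mult.assoc
      by (rule sum_norm_le) (simp add: norm_scaleC mult_left_mono norm_blinfun)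
    show "X a b (x + y) = X a b x + X a b y" for a b x y
      by (simp add: X_def blinfun.add_right scaleC_add_right sum.distrib)
    show "X a b (c *\<^sub>R x) = c *\<^sub>R X a b x" for a b c x
      unfolding X_def blinfun.scaleR_right
      by (simp add: scaleR_eq_scaleC scaleC_sum_right scaleC_scaleC mult.commute)
  qed simp
  ultimately show ?thesis by auto
qed

lemma poly_form_cong: "(\<And>a. a < d \<Longrightarrow> u a = v a) \<Longrightarrow> poly_form T p d u = poly_form T p d v"
  unfolding poly_form_def by (intro sum.cong refl tensor_form_cong) auto

lemma tensor_cinner_add:
  "tensor_cinner u (x + y) = tensor_cinner u x + tensor_cinner u y"
  if "u \<in> carrier_vec d" "x \<in> carrier_vec d" "y \<in> carrier_vec d"
  for u :: "'h::complex_hilbert_space vec"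
  using that by (simp add: tensor_cinner_def cinner_simps sum.distrib)

lemma tensor_cinner_diff:
  "tensor_cinner u (x - y) = tensor_cinner u x - tensor_cinner u y"
  if "u \<in> carrier_vec d" "x \<in> carrier_vec d" "y \<in> carrier_vec d"
  for u :: "'h::complex_hilbert_space vec"
  using that by (simp add: tensor_cinner_def cinner_simps sum_subtractf)

lemma tensor_cinner_scaled_id:
  assumes u: "u \<in> carrier_vec d"
  shows "tensor_cinner u (scaled_id d \<epsilon> u) = of_real (\<epsilon> * (fnorm {..<d} (vec_index u))\<^sup>2)"
proof -
  have "vec_index (scaled_id d \<epsilon> u) a = complex_of_real \<epsilon> *\<^sub>C vec_index u a" if "a < d" for a
  proof -
    have "vec_index (scaled_id d \<epsilon> u) a = (\<Sum>b<d. (of_real \<epsilon> * (if a = b then 1 else 0)) *\<^sub>C vec_index u b)"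
      unfolding scaled_id_def using that by (simp add: tensor_op_def)
    also have "\<dots> = (\<Sum>b<d. if a = b then of_real \<epsilon> *\<^sub>C vec_index u b else 0)"
      by (intro sum.cong refl) (simp add: scaleC_0_left)
    finally show ?thesis using that by simp
  qed
  then have "tensor_cinner u (scaled_id d \<epsilon> u) = (\<Sum>a<d. of_real \<epsilon> * cinner (vec_index u a) (vec_index u a))"
    using u by (simp add: tensor_cinner_def cinner_simps)
  then show ?thesis by (simp add: cinner_self fnorm_square sum_distrib_left)
qed

lemma tensor_cinner_sum_eval:
  assumes X: "\<And>j. j < k \<Longrightarrow> tensor_cinner u (X j u) = x j" and u: "u \<in> carrier_vec r"
  shows "tensor_cinner u (op_sum r X {..<k} u) = (\<Sum>j<k. x j)"
proof -
  have "tensor_cinner u (op_sum r X {..<k} u) = (\<Sum>a<r. \<Sum>j<k. cinner (vec_index u a) (vec_index (X j u) a))"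
    using u by (simp add: tensor_cinner_def op_sum_def cinner_sum_right)
  also have "\<dots> = (\<Sum>j<k. tensor_cinner u (X j u))"
    using u by (subst sum.swap) (simp add: tensor_cinner_def)
  finally show ?thesis using X by simp
qed

text \<open>Polarisation, at \<open>e\<^sub>l + c e\<^sub>m\<close> with \<open>c\<close> the conjugate of \<open>M\<^sub>l\<^sub>m\<close>.\<close>

lemma hermitian_form_zero:
  assumes herm: "\<And>l m. l < r \<Longrightarrow> m < r \<Longrightarrow> M m l = cnj (M l m)"
    and zero: "\<And>\<zeta>. scalar_form {..<r} M \<zeta> = 0" and lm: "l < r" "m < (r::nat)"
  shows "M l m = 0"
proof -
  define D where "D i c b = (if b = i then c else 0)" for i b :: nat and c :: complex
  have cross: "(\<Sum>a<r. \<Sum>b<r. M a b * cnj (D i x a) * D j y b) = M i j * cnj x * y" if "i < r" "j < r" for i j x y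
  proof -
    have "(\<Sum>a<r. \<Sum>b<r. M a b * cnj (D i x a) * D j y b) =
        (\<Sum>a<r. \<Sum>b<r. if b = j then M a b * cnj (D i x a) * y else 0)"
      by (intro sum.cong refl) (simp add: D_def[of j])
    also have "\<dots> = (\<Sum>a<r. M a j * cnj (D i x a) * y)" using that by simp
    also have "\<dots> = (\<Sum>a<r. if a = i then M a j * cnj x * y else 0)"
      by (intro sum.cong refl) (simp add: D_def)
    finally show ?thesis using that by simp
  qed
  let ?c = "cnj (M l m)"
  have "scalar_form {..<r} M (\<lambda>a. D l 1 a + D m ?c a) = scalar_form {..<r} M (D l 1) + scalar_form {..<r} M (D m ?c) +
      Re ((\<Sum>a<r. \<Sum>b<r. M a b * cnj (D l 1 a) * D m ?c b) + (\<Sum>a<r. \<Sum>b<r. M a b * cnj (D m ?c a) * D l 1 b))"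
    unfolding scalar_form_eq by (simp add: distrib_left distrib_right sum.distrib)
  also have "(\<Sum>a<r. \<Sum>b<r. M a b * cnj (D l 1 a) * D m ?c b) + (\<Sum>a<r. \<Sum>b<r. M a b * cnj (D m ?c a) * D l 1 b) =
      2 * (M l m * cnj (M l m))"
    unfolding cross[OF lm] cross[OF lm(2,1)] herm[OF lm] by simp
  finally have "Re (2 * (M l m * cnj (M l m))) = 0" by (simp only: zero)
  moreover have "Re (2 * (M l m * cnj (M l m))) = 2 * ((Re (M l m))\<^sup>2 + (Im (M l m))\<^sup>2)"
    by (simp add: power2_eq_square)
  ultimately have "(Re (M l m))\<^sup>2 + (Im (M l m))\<^sup>2 = 0"
    by (metis mult_eq_0_iff zero_neq_numeral)
  then show ?thesis by (simp add: complex_eq_iff sum_power2_eq_zero_iff)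
qed

section \<open>Compressions and null families\<close>

text \<open>By the isometric factorisation, the members of a null family are the images \<open>V\<^sub>j u\<close> of one
  vector \<open>u\<close> of \<open>\<complex>\<^sup>r \<otimes> H\<close> under matrices \<open>V\<^sub>j\<close> that are normalised and annihilate the \<open>B\<^sub>i\<close>. So
  positivity of the compressions, tested at \<open>u\<close>, is positivity on the family. The size \<open>r\<close> is the
  dimension of the span of the components of the family, hence at most \<open>dim H\<close>.\<close>

lemma compressions_nonneg_imp_null_families_nonneg:
  fixes T :: "nat \<Rightarrow> 'h::complex_hilbert_space \<Rightarrow>\<^sub>L 'h" and vs :: "(nat \<Rightarrow> 'h) list"
  assumes p: "p \<in> herm_ncmat n d" and T: "\<And>i. i \<in> {1..n} \<Longrightarrow> T i \<in> herm_ops"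
    and B: "\<And>i. i < m \<Longrightarrow> B i \<in> herm_mats d"
    and psd: "\<And>r (k::nat) V. enat r \<le> hilbert_dim TYPE('h) \<Longrightarrow>
      (\<And>j. j < k \<Longrightarrow> V j \<in> carrier_mat d r) \<Longrightarrow>
      (\<And>i. i < m \<Longrightarrow> mat_sum r r (\<lambda>j. mat_adjoint (V j) * B i * V j) {..<k} = 0\<^sub>m r r) \<Longrightarrow>
      mat_sum r r (\<lambda>j. mat_adjoint (V j) * V j) {..<k} = 1\<^sub>m r \<Longrightarrow>
      op_ge r (op_sum r (\<lambda>j. nc_eval T (nc_compress (V j) p)) {..<k})
        (scaled_id r \<epsilon> :: 'h vec \<Rightarrow> 'h vec)"
    and null: "null_family {..<d} (\<lambda>i. entry (B i)) m vs"
  shows "\<epsilon> * (\<Sum>v\<leftarrow>vs. (fnorm {..<d} v)\<^sup>2) \<le> (\<Sum>v\<leftarrow>vs. Re (poly_form T p d v))"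
proof -
  have pn: "p \<in> ncmat n d" using p by (simp add: herm_ncmat_def)
  define k where "k = length vs"
  have list_sum: "(\<Sum>v\<leftarrow>vs. g v) = (\<Sum>j<k. g (vs ! j))" for g :: "(nat \<Rightarrow> 'h) \<Rightarrow> real"
    by (simp add: k_def sum_list_sum_nth atLeast0LessThan)
  obtain r :: nat and W f z where
    iso: "\<And>l m. l < r \<Longrightarrow> m < r \<Longrightarrow> (\<Sum>i<k * d. cnj (W i l) * W i m) = (if l = m then 1 else 0)"
    and exp: "\<And>i. i < k * d \<Longrightarrow> (vs ! (i div d)) (i mod d) = (\<Sum>l<r. W i l *\<^sub>C f l)"
    and dual: "\<And>l m. l < r \<Longrightarrow> m < r \<Longrightarrow> cinner (z m) (f l) = (if l = m then 1 else 0)"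
    using isometric_factorisation[of "k * d" "\<lambda>i. (vs ! (i div d)) (i mod d)"] by blast
  \<comment> \<open>all components of all members form one family; row \<open>j * d + a\<close> of \<open>W\<close> belongs to component \<open>a\<close>
    of member \<open>j\<close>\<close>
  define V where "V j = mat d r (\<lambda>(a, l). W (j * d + a) l)" for j
  have V: "V j \<in> carrier_mat d r" for j by (simp add: V_def)
  have lift_f: "lift {..<r} (entry (V j)) f a = (vs ! j) a" if "j < k" "a < d" for j a
  proof -
    have "j * d + a < (j + 1) * d" using that by simp
    also have "\<dots> \<le> k * d" using that by (intro mult_right_mono) auto
    finally have "j * d + a < k * d" .
    from exp[OF this] show ?thesis using that by (simp add: lift_def V_def)
  qed
  have one: "mat_sum r r (\<lambda>j. mat_adjoint (V j) * V j) {..<k} = 1\<^sub>m r"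
  proof (rule eq_matI)
    fix l m assume "l < dim_row (1\<^sub>m r :: complex mat)" "m < dim_col (1\<^sub>m r :: complex mat)"
    then have lm: "l < r" "m < r" by auto
    have "(mat_adjoint (V j) * V j) $$ (l, m) = (\<Sum>i\<in>{j * d..<j * d + d}. cnj (W i l) * W i m)" for j
    proof -
      have "(mat_adjoint (V j) * V j) $$ (l, m) = (\<Sum>a<d. cnj (W (j * d + a) l) * W (j * d + a) m)"
        unfolding mult_mat_entry[OF mat_adjoint_carrier[OF V] V lm]
        by (intro sum.cong refl) (use lm mat_adjoint_entry[OF V lm(1)] in \<open>simp add: V_def\<close>)
      also have "\<dots> = (\<Sum>i\<in>{j * d..<j * d + d}. cnj (W i l) * W i m)"
        by (rule sum.reindex_bij_witness[of _ "\<lambda>i. i - j * d" "\<lambda>a. j * d + a"]) auto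
      finally show ?thesis .
    qed
    then have "mat_sum r r (\<lambda>j. mat_adjoint (V j) * V j) {..<k} $$ (l, m) =
        (\<Sum>j<k. \<Sum>i\<in>{j * d..<j * d + d}. cnj (W i l) * W i m)"
      using lm by (simp add: mat_sum_def)
    also have "\<dots> = (\<Sum>i<k * d. cnj (W i l) * W i m)" by (rule sum.nat_group)
    finally show "mat_sum r r (\<lambda>j. mat_adjoint (V j) * V j) {..<k} $$ (l, m) = 1\<^sub>m r $$ (l, m)"
      using iso[OF lm] lm by simp
  qed (simp_all add: mat_sum_def)
  have zero: "mat_sum r r (\<lambda>j. mat_adjoint (V j) * B i * V j) {..<k} = 0\<^sub>m r r" if i: "i < m" for i
  proof -
    let ?M = "mat_sum r r (\<lambda>j. mat_adjoint (V j) * B i * V j) {..<k}"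
    have Bi: "B i \<in> carrier_mat d d" using B[OF i] by (simp add: herm_mats_def)
    have herm: "?M $$ (q, l) = cnj (?M $$ (l, q))" if "l < r" "q < r" for l q
    proof -
      have "congruence {..<d} (entry (V j)) (entry (B i)) q l =
          cnj (congruence {..<d} (entry (V j)) (entry (B i)) l q)" for j
        by (rule congruence_hermitian) (rule herm_mats_entry[OF B[OF i]]; simp)
      then show ?thesis using that by (simp add: mat_sum_def congruence_entry[OF V Bi])
    qed
    have "scalar_form {..<r} (entry ?M) \<zeta> = 0" for \<zeta>
    proof -
      \<comment> \<open>the dual vectors \<open>z\<close> realise an arbitrary \<open>\<zeta>\<close> as a slice of \<open>f\<close>\<close>
      define y where "y = (\<Sum>q<r. cnj (\<zeta> q) *\<^sub>C z q)"
      have slice_f: "slice y f l = \<zeta> l" if "l < r" for l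
      proof -
        have "slice y f l = (\<Sum>q<r. \<zeta> q * cinner (z q) (f l))"
          by (simp add: slice_def y_def cinner_sum_left cinner_simps)
        also have "\<dots> = (\<Sum>q<r. if l = q then \<zeta> q else 0)"
          by (intro sum.cong refl) (use dual that in simp)
        finally show ?thesis using that by simp
      qed
      have "0 = (\<Sum>j<k. scalar_form {..<d} (entry (B i)) (slice y (vs ! j)))"
        using null i unfolding null_family_def list_sum by simp
      also have "\<dots> = (\<Sum>j<k. scalar_form {..<d} (entry (B i)) (lift {..<r} (entry (V j)) (slice y f)))"
        by (intro sum.cong refl re_form_cong_index)
          (simp add: lift_f slice_def flip: slice_lift)
      also have "\<dots> = Re (\<Sum>j<k. tensor_form {..<d} (entry (B i)) (blinfun_apply id_blinfun)
          (lift {..<r} (entry (V j)) (slice y f)))"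
        by (simp add: re_form_def)
      also have "\<dots> = Re (tensor_form {..<r} (entry ?M) (blinfun_apply id_blinfun) (slice y f))"
        by (subst sum_tensor_form_lift[OF V Bi]) simp_all
      also have "\<dots> = scalar_form {..<r} (entry ?M) \<zeta>"
        unfolding re_form_def by (intro arg_cong[of _ _ Re]) (simp add: tensor_form_def slice_f)
      finally show ?thesis by simp
    qed
    from hermitian_form_zero[OF herm this] show ?thesis
      by (intro eq_matI) (simp_all add: mat_sum_def)
  qed
  let ?u = "vec r f"
  have u: "?u \<in> carrier_vec r" by simp
  have "op_ge r (op_sum r (\<lambda>j. nc_eval T (nc_compress (V j) p)) {..<k}) (scaled_id r \<epsilon> :: 'h vec \<Rightarrow> 'h vec)"
    by (rule psd) (use dual_system_le_hilbert_dim[OF dual] V zero one in blast)+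
  then have "tensor_cinner ?u (op_sum r (\<lambda>j. nc_eval T (nc_compress (V j) p)) {..<k} ?u - scaled_id r \<epsilon> ?u) \<in> \<real>\<^sub>\<ge>\<^sub>0"
    using u unfolding op_ge_def op_psd_def by blast
  moreover have "tensor_cinner ?u (op_sum r (\<lambda>j. nc_eval T (nc_compress (V j) p)) {..<k} ?u) =
      (\<Sum>j<k. poly_form T p d (vs ! j))"
  proof (rule tensor_cinner_sum_eval[OF _ u])
    fix j assume "j < k"
    have "nc_compress (V j) p \<in> carrier_mat r r"
      using V[of j] by (simp add: nc_compress_def mat_sum_def)
    then have "tensor_cinner ?u (nc_eval T (nc_compress (V j) p) ?u) =
        poly_form T (nc_compress (V j) p) r (vec_index ?u)"
      by (rule tensor_cinner_nc_eval[OF _ u])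
    also have "\<dots> = poly_form T (nc_compress (V j) p) r f"
      by (rule poly_form_cong) simp
    also have "\<dots> = poly_form T p d (lift {..<r} (entry (V j)) f)"
      using poly_form_compress[OF pn T V] by simp
    also have "\<dots> = poly_form T p d (vs ! j)"
      by (rule poly_form_cong) (simp add: lift_f \<open>j < k\<close>)
    finally show "tensor_cinner ?u (nc_eval T (nc_compress (V j) p) ?u) = poly_form T p d (vs ! j)" .
  qed
  moreover have "tensor_cinner ?u (scaled_id r \<epsilon> ?u) = of_real (\<epsilon> * (\<Sum>j<k. (fnorm {..<d} (vs ! j))\<^sup>2))"
  proof -
    have "(fnorm {..<r} (vec_index ?u))\<^sup>2 = (fnorm {..<r} f)\<^sup>2"
      by (simp add: fnorm_square)
    also have "\<dots> = (\<Sum>j<k. (fnorm {..<d} (lift {..<r} (entry (V j)) f))\<^sup>2)"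
      by (rule sum_fnorm_isometry[OF V one, symmetric])
    also have "\<dots> = (\<Sum>j<k. (fnorm {..<d} (vs ! j))\<^sup>2)"
      by (simp add: fnorm_square lift_f)
    finally show ?thesis using tensor_cinner_scaled_id[OF u] by simp
  qed
  moreover have "op_sum r (\<lambda>j. nc_eval T (nc_compress (V j) p)) {..<k} ?u \<in> carrier_vec r"
    "scaled_id r \<epsilon> ?u \<in> carrier_vec r"
    by (simp_all add: op_sum_def scaled_id_def tensor_op_def)
  ultimately have "(\<Sum>j<k. poly_form T p d (vs ! j)) - of_real (\<epsilon> * (\<Sum>j<k. (fnorm {..<d} (vs ! j))\<^sup>2)) \<in> \<real>\<^sub>\<ge>\<^sub>0"
    using tensor_cinner_diff[OF u] by metis
  then have "0 \<le> Re ((\<Sum>j<k. poly_form T p d (vs ! j)) - of_real (\<epsilon> * (\<Sum>j<k. (fnorm {..<d} (vs ! j))\<^sup>2)))"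
    by (simp only: complex_nonneg_Reals_iff)
  then show ?thesis by (simp add: list_sum)
qed

lemma carrier_vec_nc_eval: "p \<in> carrier_mat d d \<Longrightarrow> nc_eval T p v \<in> carrier_vec d"
  by (simp add: nc_eval_def op_sum_def)

lemma carrier_vec_op_sum: "op_sum d F K v \<in> carrier_vec d"
  by (simp add: op_sum_def)

lemma carrier_vec_scaled_id: "scaled_id d \<epsilon> v \<in> carrier_vec d"
  by (simp add: scaled_id_def tensor_op_def)

lemma tensor_cinner_perturbation:
  assumes p: "p \<in> carrier_mat d d" and B: "\<And>i. i \<in> M \<Longrightarrow> B i \<in> carrier_mat d d"
    and v: "v \<in> carrier_vec d"
  shows "tensor_cinner v (nc_eval T p v + op_sum d (\<lambda>i. tensor_op (B i) (S i)) M v - scaled_id d \<epsilon> v) =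
    poly_form T p d (vec_index v) + (\<Sum>i\<in>M. tensor_form {..<d} (entry (B i)) (blinfun_apply (S i)) (vec_index v))
      - of_real (\<epsilon> * (fnorm {..<d} (vec_index v))\<^sup>2)"
proof -
  note C = carrier_vec_nc_eval[OF p] carrier_vec_op_sum carrier_vec_scaled_id
  show ?thesis
    by (simp add: tensor_cinner_diff[OF v add_carrier_vec[OF C(1,2)] C(3)] tensor_cinner_add[OF v C(1,2)]
        tensor_cinner_nc_eval[OF p v] tensor_cinner_op_sum[OF B v] tensor_cinner_scaled_id[OF v])
qed

text \<open>The easy direction: compressing by the \<open>V\<^sub>j\<close> and summing preserves the lower bound \<open>\<epsilon>\<close>, because
  the \<open>V\<^sub>j\<close> are normalised, and it removes the terms \<open>B\<^sub>i \<otimes> S\<^sub>i\<close>.\<close>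

lemma positive_imp_compressions_nonneg:
  fixes T :: "nat \<Rightarrow> 'h::complex_hilbert_space \<Rightarrow>\<^sub>L 'h" and k :: nat
  assumes p: "p \<in> ncmat n d" and T: "\<And>i. i \<in> {1..n} \<Longrightarrow> T i \<in> herm_ops"
    and B: "\<And>i. i \<in> M \<Longrightarrow> B i \<in> carrier_mat d d" and S: "\<And>i. i \<in> M \<Longrightarrow> S i \<in> herm_ops"
    and pos: "op_ge d (\<lambda>v. nc_eval T p v + op_sum d (\<lambda>i. tensor_op (B i) (S i)) M v) (scaled_id d \<epsilon>)"
    and V: "\<And>j. j < k \<Longrightarrow> V j \<in> carrier_mat d r"
    and zero: "\<And>i. i \<in> M \<Longrightarrow> mat_sum r r (\<lambda>j. mat_adjoint (V j) * B i * V j) {..<k} = 0\<^sub>m r r"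
    and one: "mat_sum r r (\<lambda>j. mat_adjoint (V j) * V j) {..<k} = 1\<^sub>m r"
  shows "op_ge r (op_sum r (\<lambda>j. nc_eval T (nc_compress (V j) p)) {..<k}) (scaled_id r \<epsilon>)"
  unfolding op_ge_def op_psd_def
proof
  fix u :: "'h vec" assume u: "u \<in> carrier_vec r"
  have C: "p \<in> carrier_mat d d" using p by (simp add: ncmat_def)
  let ?v = "\<lambda>j. lift {..<r} (entry (V j)) (vec_index u)"
  have "poly_form T p d (?v j) + (\<Sum>i\<in>M. tensor_form {..<d} (entry (B i)) (blinfun_apply (S i)) (?v j))
      - of_real (\<epsilon> * (fnorm {..<d} (?v j))\<^sup>2) \<in> \<real>\<^sub>\<ge>\<^sub>0" for j
  proof -
    let ?w = "vec d (?v j)"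
    have w: "?w \<in> carrier_vec d" by simp
    have "poly_form T p d (vec_index ?w) = poly_form T p d (?v j)"
      by (rule poly_form_cong) simp
    moreover have "tensor_form {..<d} (entry (B i)) (blinfun_apply (S i)) (vec_index ?w) =
        tensor_form {..<d} (entry (B i)) (blinfun_apply (S i)) (?v j)" for i
      by (rule tensor_form_cong) simp_all
    moreover have "(fnorm {..<d} (vec_index ?w))\<^sup>2 = (fnorm {..<d} (?v j))\<^sup>2"
      by (simp add: fnorm_square)
    moreover have "tensor_cinner ?w (nc_eval T p ?w + op_sum d (\<lambda>i. tensor_op (B i) (S i)) M ?w - scaled_id d \<epsilon> ?w) \<in> \<real>\<^sub>\<ge>\<^sub>0"
      using pos w unfolding op_ge_def op_psd_def by blast
    ultimately show ?thesis by (simp only: tensor_cinner_perturbation[OF C B w])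
  qed
  then have "(\<Sum>j<k. poly_form T p d (?v j) + (\<Sum>i\<in>M. tensor_form {..<d} (entry (B i)) (blinfun_apply (S i)) (?v j))
      - of_real (\<epsilon> * (fnorm {..<d} (?v j))\<^sup>2)) \<in> \<real>\<^sub>\<ge>\<^sub>0" (is "?s \<in> _")
    by (induction k) simp_all
  also have "?s = (\<Sum>j<k. poly_form T p d (?v j)) +
      (\<Sum>i\<in>M. \<Sum>j<k. tensor_form {..<d} (entry (B i)) (blinfun_apply (S i)) (?v j))
      - of_real (\<epsilon> * (\<Sum>j<k. (fnorm {..<d} (?v j))\<^sup>2))"
    by (simp add: sum.distrib sum_subtractf sum_distrib_left sum.swap[of _ _ M])
  also have "(\<Sum>i\<in>M. \<Sum>j<k. tensor_form {..<d} (entry (B i)) (blinfun_apply (S i)) (?v j)) = 0"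
  proof (rule sum.neutral, rule ballI)
    fix i assume i: "i \<in> M"
    have "(\<Sum>j<k. tensor_form {..<d} (entry (B i)) (blinfun_apply (S i)) (?v j)) =
        tensor_form {..<r} (entry (0\<^sub>m r r)) (blinfun_apply (S i)) (vec_index u)"
      using sum_tensor_form_lift[OF V B[OF i] herm_opsD(1)[OF S[OF i]], where k = k and u = "vec_index u"]
      by (simp add: zero[OF i])
    then show "(\<Sum>j<k. tensor_form {..<d} (entry (B i)) (blinfun_apply (S i)) (?v j)) = 0"
      by (simp add: tensor_form_def)
  qed
  also have "(\<Sum>j<k. (fnorm {..<d} (?v j))\<^sup>2) = (fnorm {..<r} (vec_index u))\<^sup>2"
    by (rule sum_fnorm_isometry[OF V one])
  finally have nonneg: "(\<Sum>j<k. poly_form T p d (?v j)) - of_real (\<epsilon> * (fnorm {..<r} (vec_index u))\<^sup>2) \<in> \<real>\<^sub>\<ge>\<^sub>0"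
    by simp
  have "tensor_cinner u (op_sum r (\<lambda>j. nc_eval T (nc_compress (V j) p)) {..<k} u) =
      (\<Sum>j<k. poly_form T p d (?v j))"
  proof (rule tensor_cinner_sum_eval[OF _ u])
    fix j assume "j < k"
    then have "nc_compress (V j) p \<in> carrier_mat r r"
      using V[of j] by (simp add: nc_compress_def mat_sum_def)
    then show "tensor_cinner u (nc_eval T (nc_compress (V j) p) u) = poly_form T p d (?v j)"
      using tensor_cinner_nc_eval[OF _ u] poly_form_compress[OF p T V[OF \<open>j < k\<close>]] by simp
  qed
  then show "tensor_cinner u (op_sum r (\<lambda>j. nc_eval T (nc_compress (V j) p)) {..<k} u - scaled_id r \<epsilon> u) \<in> \<real>\<^sub>\<ge>\<^sub>0"
    using nonneg
    by (simp add: tensor_cinner_diff[OF u carrier_vec_op_sum carrier_vec_scaled_id] tensor_cinner_scaled_id[OF u])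
qed

section \<open>The equivalence\<close>

theorem theorem3p5:
  fixes d n m :: nat
    and p :: "ncpoly mat"
    and B :: "nat \<Rightarrow> complex mat"
    and T :: "nat \<Rightarrow> 'h::complex_hilbert_space \<Rightarrow>\<^sub>L 'h"
  assumes "p \<in> herm_ncmat n d"
    and "\<forall>i\<in>{1..m}. B i \<in> herm_mats d"
    and "\<forall>i\<in>{1..n}. T i \<in> herm_ops"
  shows "(\<exists>S :: nat \<Rightarrow> 'h \<Rightarrow>\<^sub>L 'h. (\<forall>i\<in>{1..m}. S i \<in> herm_ops) \<and>
        op_pos d (\<lambda>v. nc_eval T p v + op_sum d (\<lambda>i. tensor_op (B i) (S i)) {1..m} v))
    \<longleftrightarrow>
    (\<exists>\<epsilon>::real. \<epsilon> > 0 \<and>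
      (\<forall>r::nat. enat r \<le> max (hilbert_dim TYPE('h)) (enat d) \<longrightarrow>
        (\<forall>(k::nat) (V :: nat \<Rightarrow> complex mat).
          (\<forall>j<k. V j \<in> carrier_mat d r) \<and>
          (\<forall>i\<in>{1..m}. mat_sum r r (\<lambda>j. mat_adjoint (V j) * B i * V j) {..<k} = 0\<^sub>m r r) \<and>
          mat_sum r r (\<lambda>j. mat_adjoint (V j) * V j) {..<k} = 1\<^sub>m r
          \<longrightarrow> op_ge r (op_sum r (\<lambda>j. nc_eval T (nc_compress (V j) p)) {..<k})
                (scaled_id r \<epsilon>))))"
    (is "?perturbation \<longleftrightarrow> ?compressions")
proof
  have T: "T i \<in> herm_ops" if "i \<in> {1..n}" for i using assms(3) that by blast
  have p: "p \<in> ncmat n d" and C: "p \<in> carrier_mat d d"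
    using assms(1) by (auto simp: herm_ncmat_def ncmat_def)
  have B: "B i \<in> herm_mats d" "B i \<in> carrier_mat d d" if "i \<in> {1..m}" for i
    using assms(2) that by (auto simp: herm_mats_def)
  {
    assume ?perturbation
    then obtain S \<epsilon> where S: "\<forall>i\<in>{1..m}. S i \<in> herm_ops" and "\<epsilon> > 0"
      and pos: "op_ge d (\<lambda>v. nc_eval T p v + op_sum d (\<lambda>i. tensor_op (B i) (S i)) {1..m} v) (scaled_id d \<epsilon>)"
      unfolding op_pos_def by blast
    have "op_ge r (op_sum r (\<lambda>j. nc_eval T (nc_compress (V j) p)) {..<k}) (scaled_id r \<epsilon>)"
      if "\<forall>j<k. V j \<in> carrier_mat d r"
        "\<forall>i\<in>{1..m}. mat_sum r r (\<lambda>j. mat_adjoint (V j) * B i * V j) {..<k} = 0\<^sub>m r r"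
        "mat_sum r r (\<lambda>j. mat_adjoint (V j) * V j) {..<k} = 1\<^sub>m r" for r V and k :: nat
      by (rule positive_imp_compressions_nonneg[OF p T B(2) _ pos]) (use S that in auto)
    with \<open>\<epsilon> > 0\<close> show ?compressions by blast
  next
    assume ?compressions
    then obtain \<epsilon> where "\<epsilon> > 0" and comp: "\<forall>r. enat r \<le> max (hilbert_dim TYPE('h)) (enat d) \<longrightarrow>
      (\<forall>(k::nat) (V :: nat \<Rightarrow> complex mat).
        (\<forall>j<k. V j \<in> carrier_mat d r) \<and>
        (\<forall>i\<in>{1..m}. mat_sum r r (\<lambda>j. mat_adjoint (V j) * B i * V j) {..<k} = 0\<^sub>m r r) \<and>
        mat_sum r r (\<lambda>j. mat_adjoint (V j) * V j) {..<k} = 1\<^sub>m r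
        \<longrightarrow> op_ge r (op_sum r (\<lambda>j. nc_eval T (nc_compress (V j) p)) {..<k}) (scaled_id r \<epsilon>))"
      by (elim exE conjE)
    have null: "\<epsilon> * (\<Sum>v\<leftarrow>vs. (fnorm {..<d} v)\<^sup>2) \<le> (\<Sum>v\<leftarrow>vs. Re (poly_form T p d v))"
      if "null_family {..<d} (\<lambda>i. entry (B (Suc i))) m vs" for vs
    proof (rule compressions_nonneg_imp_null_families_nonneg[OF assms(1) T _ _ that])
      show "B (Suc i) \<in> herm_mats d" if "i < m" for i using that by (intro B) auto
      show "op_ge r (op_sum r (\<lambda>j. nc_eval T (nc_compress (V j) p)) {..<k}) (scaled_id r \<epsilon>)"
        if r: "enat r \<le> hilbert_dim TYPE('h)" and V: "\<And>j. j < k \<Longrightarrow> V j \<in> carrier_mat d r"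
          and zero: "\<And>i. i < m \<Longrightarrow> mat_sum r r (\<lambda>j. mat_adjoint (V j) * B (Suc i) * V j) {..<k} = 0\<^sub>m r r"
          and one: "mat_sum r r (\<lambda>j. mat_adjoint (V j) * V j) {..<k} = 1\<^sub>m r" for r V and k :: nat
      proof -
        have "mat_sum r r (\<lambda>j. mat_adjoint (V j) * B i * V j) {..<k} = 0\<^sub>m r r" if "i \<in> {1..m}" for i
        proof -
          from \<open>i \<in> {1..m}\<close> have "i - 1 < m" "Suc (i - 1) = i" by auto
          with zero[of "i - 1"] show ?thesis by simp
        qed
        moreover have "enat r \<le> max (hilbert_dim TYPE('h)) (enat d)"
          using r by (simp add: le_max_iff_disj)
        ultimately show ?thesis
          by (intro comp[THEN spec, THEN mp, THEN spec, THEN spec, THEN mp] conjI ballI allI impI V one)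
      qed
    qed auto
    obtain Q where quad: "quad_like {..<d} (\<lambda>v. Re (poly_form T p d v)) Q"
      using quad_like_poly_form by blast
    have herm: "B (Suc i) $$ (b, a) = cnj (B (Suc i) $$ (a, b))"
      if "i < m" "a \<in> {..<d}" "b \<in> {..<d}" for i a b
      using that by (intro herm_mats_entry[OF B(1)]) auto
    have "\<exists>S \<delta>. (\<forall>i<m. S i \<in> herm_ops) \<and> \<delta> > 0 \<and>
      (\<forall>v. \<delta> * (fnorm {..<d} v)\<^sup>2 \<le> Re (poly_form T p d v) +
        (\<Sum>i<m. re_form {..<d} (entry (B (Suc i))) (blinfun_apply (S i)) v))"
      by (rule positive_on_null_families_imp_operators[OF finite_lessThan herm quad \<open>\<epsilon> > 0\<close> null])
    then obtain S \<delta> where S: "\<And>i. i < m \<Longrightarrow> S i \<in> herm_ops" and "\<delta> > 0"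
      and pos: "\<And>v. \<delta> * (fnorm {..<d} v)\<^sup>2 \<le> Re (poly_form T p d v) +
        (\<Sum>i<m. re_form {..<d} (entry (B (Suc i))) (blinfun_apply (S i)) v)" by blast
    define S' where "S' i = S (i - 1)" for i
    have S': "S' i \<in> herm_ops" if "i \<in> {1..m}" for i
      using that by (auto simp: S'_def intro!: S)
    have "op_ge d (\<lambda>v. nc_eval T p v + op_sum d (\<lambda>i. tensor_op (B i) (S' i)) {1..m} v) (scaled_id d \<delta>)"
      unfolding op_ge_def op_psd_def
    proof
      fix v :: "'h vec" assume v: "v \<in> carrier_vec d"
      let ?c = "poly_form T p d (vec_index v) +
        (\<Sum>i\<in>{1..m}. tensor_form {..<d} (entry (B i)) (blinfun_apply (S' i)) (vec_index v)) -
        of_real (\<delta> * (fnorm {..<d} (vec_index v))\<^sup>2)"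
      have "Im (tensor_form {..<d} (entry (B i)) (blinfun_apply (S' i)) (vec_index v)) = 0" if "i \<in> {1..m}" for i
        by (rule tensor_form_real; (rule herm_mats_entry[OF B(1)[OF that]]; simp)?)
          (rule herm_opsD(2)[OF S'[OF that]])
      then have "Im ?c = 0" using poly_form_real[OF assms(1) T] by simp
      moreover have "Re ?c \<ge> 0"
      proof -
        have "(\<Sum>i\<in>{1..m}. re_form {..<d} (entry (B i)) (blinfun_apply (S' i)) (vec_index v)) =
            (\<Sum>i<m. re_form {..<d} (entry (B (Suc i))) (blinfun_apply (S i)) (vec_index v))"
          by (simp add: S'_def sum.atLeast1_atMost_eq)
        then show ?thesis using pos[of "vec_index v"] by (simp add: re_form_def)
      qed
      ultimately have "?c \<in> \<real>\<^sub>\<ge>\<^sub>0" by (simp only: complex_nonneg_Reals_iff)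
      then show "tensor_cinner v (nc_eval T p v + op_sum d (\<lambda>i. tensor_op (B i) (S' i)) {1..m} v - scaled_id d \<delta> v) \<in> \<real>\<^sub>\<ge>\<^sub>0"
        by (simp only: tensor_cinner_perturbation[where M = "{1..m}" and B = B, OF C B(2) v])
    qed
    with S' \<open>\<delta> > 0\<close> show ?perturbation unfolding op_pos_def by blast
  }
qed

end
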